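(* For the quantum Kronecker cluster algebra $\mathcal{A}_q(2,2)$, the quantum greedy basis and the quantum theta basis coincide: for a fixed generic $Q$ in the first quadrant, $$\{X[a_1,a_2]:(a_1,a_2)\in\mathbb{Z}^2\}=\{\vartheta_{Q,m}:m\in\mathbb{Z}^2\}$$ (with $\vartheta_{Q,0}=1$).
   Context: **Algebra.** $\mathcal{T}=\mathbb{Z}[q^{\pm1}]\langle X_1^{\pm1},X_2^{\pm1}:X_1X_2=q^2X_2X_1\rangle$. $\mathcal{A}_q(2,2)$ is the $\mathbb{Z}[q^{\pm1}]$-subalgebra of the skew field of fractions of $\mathcal{T}$ generated by $X_n$ ($n\in\mathbb{Z}$), $X_{n+1}X_{n-1}=q^2X_n^2+1$. $[k]_q=\frac{q^k-q^{-k}}{q-q^{-1}}$, $[k]_q!=[k]_q\cdots[1]_q$, $[0]_q!=1$, $\binom{n}{k}_q=\frac{[n]_q!}{[k]_q![n-k]_q!}$ for $n\ge k\ge0$, and $\binom{n}{k}_q=0$ for $0\le n<k$. **Quantum greedy basis** (Lee–Li–Rupel–Zelevinsky). Put $X^{(u_1,u_2)}=q^{-u_1u_2}X_1^{u_1}X_2^{u_2}$. For $(a_1,a_2)\in\mathbb{Z}^2$, $X[a_1,a_2]=\sum_{s,t\ge0}e(s,t)X^{(2s-a_1,2t-a_2)}$, where $e(0,0)=1$ and for $(s,t)\ne(0,0)$ $$e(s,t)=\sum_{k=1}^{s}(-1)^{k-1}e(s-k,t)\binom{\max(a_2-2t,0)+k-1}{k}_{q^2}\ \text{ if } a_1t\le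 a_2s,$$ $$e(s,t)=\sum_{k=1}^{t}(-1)^{k-1}e(s,t-k)\binom{\max(a_1-2s,0)+k-1}{k}_{q^2}\ \text{ if } a_1t\ge a_2s.$$ **Scattering diagram.** $\mathfrak{D}_2$ has walls $(\mathbb{R}(1,0),1+x_1^2)$, $(\mathbb{R}(0,1),1+x_2^2)$, and for $k\ge1$ $(\mathbb{R}_{\le0}(k+1,k),1+x_1^{2(k+1)}x_2^{2k})$, $(\mathbb{R}_{\le0}(k,k+1),1+x_1^{2k}x_2^{2(k+1)})$ (the cluster walls), and the non-cluster wall $\mathfrak{d}_1=(\mathbb{R}_{\le0}(1,1),\sum_{j\ge0}(j+1)x_1^{2j}x_2^{2j})$. In the wall functions $z^{(u_1,u_2)}=x_1^{u_1}x_2^{u_2}$. **Broken lines and quantum theta basis.** $Q$ is generic if it is not orthogonal to any nonzero integer vector. A broken line with initial exponent $v_0\in\mathbb{Z}^2\setminus\{0\}$ and terminal point $Q$ is a continuous map $\gamma:(-\infty,0]\to\mathbb{R}^2\setminus\{0\}$ with $\gamma(0)=Q$, times $-\infty=\tau_0<\tau_1<\dots<\tau_s<\tau_{s+1}=0$ and monomials $c_iz^{v_i}$ ($0\le i\le s$, $c_0=1$) with $\gamma'=-v_i$ on $(\tau_i,\tau_{i+1})$, such that at $\tau_i$ ($1\le i\le s$) $\gamma$ transversally crosses a wall with function $f$, and $c_iz^{v_i}$ is a monomial term of $c_{i-1}z^{v_{i-1}}f^{v_{i-1}\cdot n}$, $n$ being the primitive normal vector of the wall with $v_{i-1}\cdot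 n>0$. The multiplicity $m_i$ of the bend is defined by $z^{v_i}$ being the $(m_i+1)$-th term (by increasing exponent). The quantum weight $|\gamma|_q$ is the product over the bends of $\binom{v_{i-1}\cdot n}{m_i}_{q^4}$ for a cluster wall and, for $\mathfrak{d}_1$, of the coefficient of $x^{m_i}$ in $\big(\sum_{k\ge0}[k+1]_{q^4}x^k\big)^{v_{i-1}\cdot n}$. The quantum theta function is $\vartheta_{Q,m}=\sum_\gamma|\gamma|_q\,z^{v_s}$, the sum over all broken lines on $\mathfrak{D}_2$ with initial exponent $m$ and terminal point $Q$, where $v_s$ is the terminal exponent of $\gamma$ and $z^{v_s}$ the monomial of exponent $v_s$ in $X_1,X_2$. For fixed generic $Q$ in the first quadrant, the quantum theta basis is the set of all $\vartheta_{Q,m}$. (The paper takes this to be the quantum theta basis of Davison–Mandel, which is set up there with principal coefficients $y_1,y_2$ that are specialized to $1$, after reordering if necessary.)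
   Formalization: In the quantum weight, subscripts q^4 are replaced by q^2 (with q^4 the claim fails for X[2,0]), and at the wall d_1 the ordinary power of the series F is replaced by the quantum power, the product over 0≤i<p of F(q^{2(2i+1-p)}x), p=v·n; z^v is read as X^{(v)}. *)

theory Defs
  imports "HOL-Analysis.Analysis" "HOL-Library.Poly_Mapping"
begin

section \<open>The coefficient ring and quantum binomial coefficients\<close>

text \<open>The ring of integer Laurent polynomials in \<open>q\<close>, as the group ring of the integers.\<close>

type_synonym qlaurent = "int \<Rightarrow>\<^sub>0 int"

definition qpow :: "int \<Rightarrow> qlaurent" where
  "qpow k = Poly_Mapping.single k 1"

text \<open>The ring is an integral domain, so a quotient that lies in the ring is unique.\<close>

definition exact_quot :: "qlaurent \<Rightarrow> qlaurent \<Rightarrow> qlaurent" where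
  "exact_quot a b = (THE c. c * b = a)"

text \<open>In \<open>qint e\<close>, \<open>qfact e\<close> and \<open>qbinom e\<close> the parameter \<open>e\<close> stands for the subscript
  \<open>q ^ e\<close>: for example \<open>qint 2 k\<close> is \<open>(q ^ (2 k) - q ^ (- 2 k)) / (q ^ 2 - q ^ (- 2))\<close>.\<close>

definition qint :: "int \<Rightarrow> nat \<Rightarrow> qlaurent" where
  "qint e k = exact_quot (qpow (e * int k) - qpow (- (e * int k))) (qpow e - qpow (- e))"

definition qfact :: "int \<Rightarrow> nat \<Rightarrow> qlaurent" where
  "qfact e n = (\<Prod>k = 1..n. qint e k)"

definition qbinom :: "int \<Rightarrow> nat \<Rightarrow> nat \<Rightarrow> qlaurent" where
  "qbinom e n k =
     (if n < k then 0 else exact_quot (qfact e n) (qfact e k * qfact e (n - k)))"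

section \<open>The quantum torus\<close>

text \<open>The quantum torus is the group ring of the Heisenberg group of the elements
  \<open>q ^ c * X1 ^ a * X2 ^ b\<close>, represented by \<open>QMon c a b\<close>.  The group is written additively
  because the library forms monoid rings over additive monoids; it is not commutative:
  \<open>X1 * X2 = q ^ 2 * X2 * X1\<close> gives \<open>X2 ^ b * X1 ^ a' = q ^ (- 2 b a') * X1 ^ a' * X2 ^ b\<close>.\<close>

datatype qmon = QMon int int int

instantiation qmon :: monoid_add
begin

definition zero_qmon :: qmon where
  "zero_qmon = QMon 0 0 0"

fun plus_qmon :: "qmon \<Rightarrow> qmon \<Rightarrow> qmon" where
  "plus_qmon (QMon c a b) (QMon c' a' b') = QMon (c + c' - 2 * b * a') (a + a') (b + b')"

instance
proof
  fix x y z :: qmon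
  show "x + y + z = x + (y + z)"
    by (cases x; cases y; cases z) (simp add: algebra_simps)
  show "0 + x = x" by (cases x) (simp add: zero_qmon_def)
  show "x + 0 = x" by (cases x) (simp add: zero_qmon_def)
qed

end

type_synonym qtorus = "qmon \<Rightarrow>\<^sub>0 int"

definition scalar :: "qlaurent \<Rightarrow> qtorus" where
  "scalar p = (\<Sum>c \<in> Poly_Mapping.keys p.
                 Poly_Mapping.single (QMon c 0 0) (Poly_Mapping.lookup p c))"

definition X1_pow :: "int \<Rightarrow> qtorus" where
  "X1_pow a = Poly_Mapping.single (QMon 0 a 0) 1"

definition X2_pow :: "int \<Rightarrow> qtorus" where
  "X2_pow b = Poly_Mapping.single (QMon 0 0 b) 1"

definition Xmon :: "int \<times> int \<Rightarrow> qtorus" where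
  "Xmon u = scalar (qpow (- (fst u * snd u))) * X1_pow (fst u) * X2_pow (snd u)"

lemma scalar_qpow: "scalar (qpow k) = Poly_Mapping.single (QMon k 0 0) 1"
  by (simp add: scalar_def qpow_def)

lemma X1_pow_add: "X1_pow (a + b) = X1_pow a * X1_pow b"
  by (simp add: X1_pow_def mult_single)

lemma X2_pow_add: "X2_pow (a + b) = X2_pow a * X2_pow b"
  by (simp add: X2_pow_def mult_single)

lemma X_pow_0: "X1_pow 0 = 1" "X2_pow 0 = 1"
  by (simp_all add: X1_pow_def X2_pow_def flip: zero_qmon_def)

lemma X1_X2_commutation: "X1_pow 1 * X2_pow 1 = scalar (qpow 2) * X2_pow 1 * X1_pow 1"
  by (simp add: X1_pow_def X2_pow_def scalar_qpow mult_single)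

lemma Xmon_eq: "Xmon u = Poly_Mapping.single (QMon (- (fst u * snd u)) (fst u) (snd u)) 1"
  by (simp add: Xmon_def X1_pow_def X2_pow_def scalar_qpow mult_single)

section \<open>The quantum greedy basis\<close>

text \<open>On the line \<open>a1 * t = a2 * s\<close> both recurrences are required.\<close>

definition greedy_coeffs :: "int \<Rightarrow> int \<Rightarrow> (nat \<Rightarrow> nat \<Rightarrow> qlaurent) \<Rightarrow> bool" where
  "greedy_coeffs a1 a2 e \<longleftrightarrow>
     e 0 0 = 1 \<and>
     (\<forall>s t. (s, t) \<noteq> (0, 0) \<longrightarrow>
        (a1 * int t \<le> a2 * int s \<longrightarrow>
           e s t = (\<Sum>k = 1..s. (-1) ^ (k - 1) * e (s - k) t *
                      qbinom 2 (nat (max (a2 - 2 * int t) 0) + k - 1) k)) \<and>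
        (a1 * int t \<ge> a2 * int s \<longrightarrow>
           e s t = (\<Sum>k = 1..t. (-1) ^ (k - 1) * e s (t - k) *
                      qbinom 2 (nat (max (a1 - 2 * int s) 0) + k - 1) k)))"

definition greedy_coeff :: "int \<Rightarrow> int \<Rightarrow> nat \<Rightarrow> nat \<Rightarrow> qlaurent" where
  "greedy_coeff a1 a2 = (THE e. greedy_coeffs a1 a2 e)"

definition greedy_elt :: "int \<Rightarrow> int \<Rightarrow> qtorus" where
  "greedy_elt a1 a2 =
     (\<Sum>(s, t) \<in> {(s, t). greedy_coeff a1 a2 s t \<noteq> 0}.
        scalar (greedy_coeff a1 a2 s t) * Xmon (2 * int s - a1, 2 * int t - a2))"

section \<open>The scattering diagram\<close>

datatype wall =
    Axis1
  | Axis2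
  | Cluster1 nat
  | Cluster2 nat
  | Diagonal

definition scattering_diagram :: "wall set" where
  "scattering_diagram =
     {Axis1, Axis2, Diagonal} \<union> Cluster1 ` {k. k \<ge> 1} \<union> Cluster2 ` {k. k \<ge> 1}"

fun wall_dir :: "wall \<Rightarrow> int \<times> int" where
  "wall_dir Axis1 = (1, 0)"
| "wall_dir Axis2 = (0, 1)"
| "wall_dir (Cluster1 k) = (int k + 1, int k)"
| "wall_dir (Cluster2 k) = (int k, int k + 1)"
| "wall_dir Diagonal = (1, 1)"

definition real_vec :: "int \<times> int \<Rightarrow> real \<times> real" where
  "real_vec v = (of_int (fst v), of_int (snd v))"

definition wall_support :: "wall \<Rightarrow> (real \<times> real) set" where
  "wall_support W =
     (if W = Axis1 \<or> W = Axis2 then {c *\<^sub>R real_vec (wall_dir W) | c. True}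
      else {c *\<^sub>R real_vec (wall_dir W) | c. c \<le> 0})"

text \<open>The wall function is \<open>wall_series W\<close> with the monomial of exponent \<open>2 * wall_dir W\<close>
  substituted for the indeterminate.\<close>

definition wall_series :: "wall \<Rightarrow> int fps" where
  "wall_series W = (if W = Diagonal then Abs_fps (\<lambda>j. int j + 1) else 1 + fps_X)"

definition dot :: "int \<times> int \<Rightarrow> int \<times> int \<Rightarrow> int" where
  "dot v n = fst v * fst n + snd v * snd n"

text \<open>Every \<open>wall_dir W\<close> is primitive, so its primitive normals are the two vectors below.
  The one with positive pairing is chosen, if there is one.\<close>

definition wall_normal :: "wall \<Rightarrow> int \<times> int \<Rightarrow> int \<times> int" where
  "wall_normal W v =
     (let n = (snd (wall_dir W), - fst (wall_dir W)) in if dot v n > 0 then n else - n)"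

section \<open>Broken lines\<close>

definition generic :: "real \<times> real \<Rightarrow> bool" where
  "generic Q \<longleftrightarrow> (\<forall>n :: int \<times> int. n \<noteq> 0 \<longrightarrow> real_vec n \<bullet> Q \<noteq> 0)"

text \<open>With \<open>s\<close> bends, \<open>bl_times\<close> lists \<open>tau_1, ..., tau_s\<close>, while \<open>bl_exps\<close> and \<open>bl_coeffs\<close>
  list \<open>v_0, ..., v_s\<close> and \<open>c_0, ..., c_s\<close>.  The walls and multiplicities of the bends are
  recorded too; they are determined by the other components.\<close>

record broken_line =
  bl_path :: "real \<Rightarrow> real \<times> real"
  bl_times :: "real list"
  bl_exps :: "(int \<times> int) list"
  bl_coeffs :: "int list"
  bl_walls :: "wall list"
  bl_mults :: "nat list"

definition bend_pairing :: "broken_line \<Rightarrow> nat \<Rightarrow> int" where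
  "bend_pairing B i =
     dot (bl_exps B ! i) (wall_normal (bl_walls B ! i) (bl_exps B ! i))"

text \<open>The \<open>i\<close>-th bend (counted from 0) takes place at \<open>bl_times B ! i\<close> and leads from the
  \<open>i\<close>-th to the \<open>(i + 1)\<close>-st monomial.  Multiplicity 0 (crossing without bending) is excluded:
  otherwise one path would carry many lists of times.\<close>

definition valid_bend :: "broken_line \<Rightarrow> nat \<Rightarrow> bool" where
  "valid_bend B i \<longleftrightarrow>
     (let W = bl_walls B ! i; m = bl_mults B ! i; p = bend_pairing B i;
          a = fps_nth (wall_series W ^ nat p) m
      in W \<in> scattering_diagram \<and>
         bl_path B (bl_times B ! i) \<in> wall_support W \<and>
         p > 0 \<and> m \<ge> 1 \<and> a \<noteq> 0 \<and>
         bl_coeffs B ! Suc i = bl_coeffs B ! i * a \<and>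
         bl_exps B ! Suc i =
           (fst (bl_exps B ! i) + 2 * int m * fst (wall_dir W),
            snd (bl_exps B ! i) + 2 * int m * snd (wall_dir W)))"

text \<open>The path is a function on all reals, so it gets a conventional value at positive times
  (membership in \<open>extensional\<close>); distinct records are then distinct broken lines.\<close>

definition is_broken_line :: "int \<times> int \<Rightarrow> real \<times> real \<Rightarrow> broken_line \<Rightarrow> bool" where
  "is_broken_line v0 Q B \<longleftrightarrow>
     (let s = length (bl_times B); \<tau> = bl_times B in
        length (bl_exps B) = Suc s \<and> length (bl_coeffs B) = Suc s \<and>
        length (bl_walls B) = s \<and> length (bl_mults B) = s \<and>
        v0 \<noteq> 0 \<and> bl_exps B ! 0 = v0 \<and> bl_coeffs B ! 0 = 1 \<and>
        sorted_wrt (<) \<tau> \<and> (\<forall>x \<in> set \<tau>. x < 0) \<and>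
        bl_path B \<in> extensional {..0} \<and>
        continuous_on {..0} (bl_path B) \<and>
        (\<forall>x \<le> 0. bl_path B x \<noteq> 0) \<and>
        bl_path B 0 = Q \<and>
        (\<forall>i \<le> s. \<forall>x < 0.
           (i > 0 \<longrightarrow> \<tau> ! (i - 1) < x) \<longrightarrow> (i < s \<longrightarrow> x < \<tau> ! i) \<longrightarrow>
           (bl_path B has_vector_derivative - real_vec (bl_exps B ! i)) (at x)) \<and>
        (\<forall>i < s. valid_bend B i))"

section \<open>The quantum theta basis\<close>

text \<open>Crossing a wall of primitive direction \<open>d\<close> is conjugation in the quantum torus.  As
  \<open>Xmon v\<close> and \<open>Xmon (2 d)\<close> commute up to the factor \<open>q ^ (\<plusminus> 4 p)\<close>, where \<open>p = v \<bullet> n\<close>, the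
  quantum \<open>p\<close>-th power of a series \<open>F(x)\<close> is the product of the \<open>F(q ^ (2 (2 i + 1 - p)) x)\<close> over
  \<open>0 \<le> i < p\<close>.  For \<open>F = 1 + x\<close> its coefficients are the binomial coefficients \<open>qbinom 2 p m\<close>.

  Pitfall: the commutation factor is a power of \<open>q ^ 4\<close>, but in the symmetric normalization of
  \<open>qint\<close> the subscript is \<open>q ^ 2\<close>, as in the greedy recurrence.  For example the coefficient of
  \<open>Xmon (-2, 2)\<close> in \<open>greedy_elt 2 0\<close> and in \<open>quantum_theta Q (-2, 0)\<close> is \<open>q ^ 2 + q ^ (- 2)\<close>;
  \<open>qbinom 4\<close> would give \<open>q ^ 4 + q ^ (- 4)\<close>.  Likewise the ordinary power of the series at the
  diagonal wall does not give the theta functions once \<open>p \<ge> 2\<close>.\<close>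

definition quantum_power :: "qlaurent fps \<Rightarrow> nat \<Rightarrow> qlaurent fps" where
  "quantum_power F p =
     (\<Prod>i < p. Abs_fps (\<lambda>k. qpow (2 * (2 * int i + 1 - int p) * int k) * fps_nth F k))"

definition bend_weight :: "wall \<Rightarrow> nat \<Rightarrow> nat \<Rightarrow> qlaurent" where
  "bend_weight W p m =
     (if W = Diagonal then fps_nth (quantum_power (Abs_fps (\<lambda>k. qint 2 (k + 1))) p) m
      else qbinom 2 p m)"

definition quantum_weight :: "broken_line \<Rightarrow> qlaurent" where
  "quantum_weight B =
     (\<Prod>i < length (bl_times B).
        bend_weight (bl_walls B ! i) (nat (bend_pairing B i)) (bl_mults B ! i))"

definition quantum_theta :: "real \<times> real \<Rightarrow> int \<times> int \<Rightarrow> qtorus" where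
  "quantum_theta Q m =
     (if m = 0 then 1
      else \<Sum>B \<in> {B. is_broken_line m Q B}. scalar (quantum_weight B) * Xmon (last (bl_exps B)))"

end

(* Broken lines are read backwards from their end point Q.  The cross product of position and exponent
   is constant along a broken line, so it turns around the origin in one direction and is determined by
   the ordered list of its bends.  Hence the coefficient of X^v in a theta function is a sum over bend
   lists in which the walls occur in cyclic order, clockwise or counterclockwise according to the side
   of the line through Q on which v lies.

   Splitting off the last bend, at a coordinate axis, and using the support of what remains shows that
   these coefficients satisfy the greedy recurrences, provided that for v in the third quadrant the
   clockwise and the counterclockwise sum agree.  This is the consistency of the scattering diagram.
   Read backwards, both sides are algebra homomorphisms of the quantum torus.  At the lowest order at
   which they could differ, their difference is an inner derivation; it vanishes because both sides
   have the same value on X^(-1,-1) + X^(1,-1) + X^(-1,1) (which excludes differences off the diagonal)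
   and the same diagonal coefficients on X^(1,0) (which excludes differences on it). *)

theory Submission
  imports Defs
begin

section \<open>Quantum binomial series\<close>

text \<open>Consistency is an identity of algebra homomorphisms, which need all integer powers of
  the wall functions, whereas a broken line bends only with positive pairing. The sign of the
  pairing at the end exponent reconciles the two: final walls where it is nonpositive contribute
  nothing to the bend sum, and along the remaining ordered walls no negative pairing occurs. In the
  consistency relation the dropped walls are cancelled by their inverses, and after exchange of the
  coordinates these inverses are the positive crossings wanted on the other side. The three-term
  element is X[1,1]. A cluster crossing has pairing 1 or -1 with the terms that it meets, so
  geometric series telescope and the element keeps three terms. Its leading exponent (-1, -1) is
  parallel to the diagonal and commutes with the monomials there, so the diagonal needs X^(1,0), on
  which the coefficients are the quantum integers [j + 1] of the diagonal wall function. All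
  products are truncated at a bound \<open>N\<close>; each bend adds its wall direction to the
  offset, so walls beyond the offset cannot contribute.\<close>

lemma qpow_0 [simp]: "qpow 0 = 1"
  by (simp add: qpow_def)

lemma qpow_add: "qpow (a + b) = qpow a * qpow b"
  by (simp add: qpow_def mult_single)

lemma qpow_mult_minus [simp]: "qpow a * qpow (- a) = 1" "qpow (- a) * qpow a = 1"
  by (simp_all flip: qpow_add)

lemma qpow_nz [simp]: "qpow a \<noteq> 0"
  using qpow_mult_minus(1)[of a] by (metis mult_zero_left zero_neq_one)

lemma qpow_inject [simp]: "qpow a = qpow b \<longleftrightarrow> a = b"
  by (metis qpow_def lookup_single_eq lookup_single_not_eq zero_neq_one)

lemma exact_quot_eqI: "b \<noteq> 0 \<Longrightarrow> c * b = a \<Longrightarrow> exact_quot a b = c"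
  unfolding exact_quot_def by (rule the_equality) auto

text \<open>The numerator of the quantum integer in the variable \<open>q ^ 2\<close>, for integers
  of either sign. Identities are proved in this undivided form, because every quotient in the
  Laurent ring has to be justified separately.\<close>

definition qdiff :: "int \<Rightarrow> qlaurent" where
  "qdiff j = qpow (2 * j) - qpow (- (2 * j))"

lemma qdiff_0 [simp]: "qdiff 0 = 0"
  by (simp add: qdiff_def)

lemma qdiff_nz [simp]: "qdiff j = 0 \<longleftrightarrow> j = 0"
  by (auto simp: qdiff_def)

lemma qdiff_minus: "qdiff (- j) = - qdiff j"
  by (simp add: qdiff_def)

lemma qdiff_add: "qdiff (a + b) = qpow (2 * b) * qdiff a + qpow (- (2 * a)) * qdiff b"
proof -
  have "qpow (2 * (a + b)) = qpow (2 * b) * qpow (2 * a)"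
    "qpow (- (2 * (a + b))) = qpow (- (2 * a)) * qpow (- (2 * b))"
    by (simp_all add: algebra_simps flip: qpow_add)
  moreover have "qpow (2 * b) * qpow (- (2 * a)) = qpow (- (2 * a)) * qpow (2 * b)"
    by (simp add: mult.commute)
  ultimately show ?thesis
    by (simp add: qdiff_def algebra_simps)
qed

text \<open>The product telescopes. Hence the quotient in the definition of \<open>qint\<close> is a
  genuine Laurent polynomial.\<close>

lemma qint_sum_mult:
  "(\<Sum>i<k. qpow (2 * (2 * int i + 1 - int k))) * (qpow 2 - qpow (- 2))
     = qpow (2 * int k) - qpow (- (2 * int k))"
proof -
  have "qpow (2 * (2 * int i + 1 - int k)) * (qpow 2 - qpow (- 2))
      = qpow (2 * (2 * int (Suc i) - int k)) - qpow (2 * (2 * int i - int k))" for i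
    unfolding right_diff_distrib qpow_add[symmetric] by (simp add: algebra_simps)
  hence "(\<Sum>i<k. qpow (2 * (2 * int i + 1 - int k))) * (qpow 2 - qpow (- 2))
      = (\<Sum>i<k. qpow (2 * (2 * int (Suc i) - int k)) - qpow (2 * (2 * int i - int k)))"
    by (simp only: sum_distrib_right)
  also have "\<dots> = qpow (2 * int k) - qpow (- (2 * int k))"
    by (subst sum_lessThan_telescope) simp
  finally show ?thesis .
qed

lemma qint_sum: "qint 2 k = (\<Sum>i<k. qpow (2 * (2 * int i + 1 - int k)))"
  unfolding qint_def by (rule exact_quot_eqI) (simp_all only: qint_sum_mult, simp)

lemma qint_mult: "qint 2 k * qdiff 1 = qdiff (int k)"
  using qint_sum_mult[of k] by (simp add: qdiff_def qint_sum)

lemma qint_nz: "k > 0 \<Longrightarrow> qint 2 k \<noteq> 0"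
  using qint_mult[of k] by auto

lemma qfact_Suc: "qfact 2 (Suc n) = qint 2 (Suc n) * qfact 2 n"
  by (simp add: qfact_def mult.commute)

lemma qfact_0 [simp]: "qfact 2 0 = 1"
  by (simp add: qfact_def)

lemma qfact_nz [simp]: "qfact 2 n \<noteq> 0"
  by (auto simp: qfact_def qint_nz)

lemma qint_add: "qint 2 (m + n) = qpow (2 * int n) * qint 2 m + qpow (- (2 * int m)) * qint 2 n"
proof -
  have "qint 2 (m + n) * qdiff 1 = (qpow (2 * int n) * qint 2 m + qpow (- (2 * int m)) * qint 2 n) * qdiff 1"
    unfolding distrib_right mult.assoc qint_mult of_nat_add qdiff_add ..
  thus ?thesis by simp
qed

text \<open>\<open>exact_quot\<close> is meaningful only where the division is exact. Exactness
  follows by induction from \<open>qint_add\<close>, which becomes Pascal's rule after division by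
  the factorials.\<close>

lemma qbinom_exists: "\<exists>c. c * (qfact 2 k * qfact 2 l) = qfact 2 (k + l)"
proof (induction "k + l" arbitrary: k l)
  case (Suc n)
  consider "k = 0" | "l = 0" | k' l' where "k = Suc k'" "l = Suc l'"
    by (metis not0_implies_Suc)
  thus ?case
  proof cases
    case 3
    obtain c where c: "c * (qfact 2 k' * qfact 2 (Suc l')) = qfact 2 (k' + Suc l')"
      using Suc(1)[of k' "Suc l'"] Suc(2) 3 by auto
    obtain d where d: "d * (qfact 2 (Suc k') * qfact 2 l') = qfact 2 (k' + Suc l')"
      using Suc(1)[of "Suc k'" l'] Suc(2) 3 by auto
    have "(qpow (2 * int (Suc l')) * c + qpow (- (2 * int (Suc k'))) * d) * (qfact 2 k * qfact 2 l)
        = qint 2 (k + l) * qfact 2 (k' + Suc l')"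
    proof -
      have "(qpow (2 * int (Suc l')) * c + qpow (- (2 * int (Suc k'))) * d) * (qfact 2 k * qfact 2 l)
        = qpow (2 * int (Suc l')) * qint 2 (Suc k') * (c * (qfact 2 k' * qfact 2 (Suc l')))
        + qpow (- (2 * int (Suc k'))) * qint 2 (Suc l') * (d * (qfact 2 (Suc k') * qfact 2 l'))"
        unfolding 3 qfact_Suc by (simp add: algebra_simps)
      also have "\<dots> = qint 2 (k + l) * qfact 2 (k' + Suc l')"
        unfolding c d 3 qint_add by (simp only: distrib_right)
      finally show ?thesis .
    qed
    moreover have "k + l = Suc (k' + Suc l')" using 3 by simp
    ultimately show ?thesis by (metis qfact_Suc)
  qed (auto intro: exI[of _ 1])
qed (auto intro: exI[of _ 1])

lemma qbinom_qfact:
  assumes "k \<le> n"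
  shows "qbinom 2 n k * (qfact 2 k * qfact 2 (n - k)) = qfact 2 n"
proof -
  obtain c where c: "c * (qfact 2 k * qfact 2 (n - k)) = qfact 2 n"
    using qbinom_exists[of k "n - k"] assms by auto
  hence "qbinom 2 n k = c"
    unfolding qbinom_def using assms by (simp add: exact_quot_eqI)
  thus ?thesis using c by simp
qed

lemma prod_qdiff: "(\<Prod>i<m. qdiff (int (n + i) + 1)) * qfact 2 n = qfact 2 (n + m) * qdiff 1 ^ m"
proof (induction m)
  case (Suc m)
  have "(\<Prod>i<Suc m. qdiff (int (n + i) + 1)) * qfact 2 n
      = qdiff (int (Suc (n + m))) * (qfact 2 (n + m) * qdiff 1 ^ m)"
    using Suc by (simp add: algebra_simps)
  also have "\<dots> = qint 2 (Suc (n + m)) * qdiff 1 * (qfact 2 (n + m) * qdiff 1 ^ m)"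
    by (simp only: qint_mult)
  finally show ?case by (simp add: qfact_Suc algebra_simps)
qed simp

text \<open>Quantum binomial coefficients with integer upper index; for negative \<open>p\<close>
  this is the reflection formula. Negative indices arise where a homomorphism crosses a wall with
  negative pairing.\<close>

definition gbinom :: "int \<Rightarrow> nat \<Rightarrow> qlaurent" where
  "gbinom p m = (if p \<ge> 0 then qbinom 2 (nat p) m
             else (- 1) ^ m * qbinom 2 (nat (- p) + m - 1) m)"

lemma prod_qdiff_1: "(\<Prod>i<m. qdiff (int i + 1)) = qfact 2 m * qdiff 1 ^ m"
  using prod_qdiff[of 0 m] by simp

lemma prod_qdiff_down:
  assumes "m \<le> n"
  shows "(\<Prod>i<m. qdiff (int n - int i)) * qfact 2 (n - m) = qfact 2 n * qdiff 1 ^ m"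
proof -
  have "(\<Prod>i<m. qdiff (int n - int i)) = (\<Prod>i<m. qdiff (int (n - m + i) + 1))"
    by (subst prod.nat_diff_reindex[symmetric], rule prod.cong)
       (use assms in \<open>auto intro!: arg_cong[where f = qdiff] simp: of_nat_diff algebra_simps\<close>)
  thus ?thesis using prod_qdiff[of "n - m" m] assms by simp
qed

text \<open>One product formula covers both cases of the definition, so Pascal's rule can be proved
  without regard to the sign of \<open>p\<close>.\<close>

lemma gbinom_prod: "gbinom p m * (\<Prod>i<m. qdiff (int i + 1)) = (\<Prod>i<m. qdiff (p - int i))"
proof (cases "p \<ge> 0")
  case True
  then obtain n where p: "p = int n" using nonneg_int_cases by auto
  show ?thesis
  proof (cases "m \<le> n")
    case True
    have "gbinom p m * (\<Prod>i<m. qdiff (int i + 1)) * qfact 2 (n - m)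
        = (qbinom 2 n m * (qfact 2 m * qfact 2 (n - m))) * qdiff 1 ^ m"
      unfolding prod_qdiff_1 by (simp add: gbinom_def p mult_ac)
    also have "\<dots> = (\<Prod>i<m. qdiff (p - int i)) * qfact 2 (n - m)"
      using True by (simp add: qbinom_qfact prod_qdiff_down p)
    finally show ?thesis by simp
  next
    case False
    hence "(\<Prod>i<m. qdiff (p - int i)) = 0"
      by (auto simp: p intro!: bexI[of _ n])
    moreover have "gbinom p m = 0"
      using False by (simp add: gbinom_def p qbinom_def)
    ultimately show ?thesis by simp
  qed
next
  case False
  then obtain n where p: "p = - int (Suc n)"
    by (metis int_cases linorder_not_le negative_zle_0 not_less_iff_gr_or_eq of_nat_0_le_iff)
  have gbinom: "gbinom p m = (- 1) ^ m * qbinom 2 (n + m) m"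
    by (simp add: gbinom_def p nat_add_distrib)
  have "(\<Prod>i<m. qdiff (p - int i)) = (\<Prod>i<m. - qdiff (int (n + i) + 1))"
    unfolding qdiff_minus[symmetric] p by (intro prod.cong refl arg_cong[where f = qdiff]) auto
  also have "\<dots> = (- 1) ^ m * (\<Prod>i<m. qdiff (int (n + i) + 1))"
    by (simp add: prod_uminus)
  finally have 1: "(\<Prod>i<m. qdiff (p - int i)) = (- 1) ^ m * (\<Prod>i<m. qdiff (int (n + i) + 1))" .
  have "gbinom p m * (\<Prod>i<m. qdiff (int i + 1)) * qfact 2 n
     = (- 1) ^ m * (qbinom 2 (n + m) m * (qfact 2 m * qfact 2 (n + m - m)) * qdiff 1 ^ m)"
    unfolding prod_qdiff_1 by (simp add: gbinom mult_ac)
  also have "\<dots> = (- 1) ^ m * ((\<Prod>i<m. qdiff (int (n + i) + 1)) * qfact 2 n)"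
    unfolding prod_qdiff by (subst qbinom_qfact) simp_all
  finally show ?thesis unfolding 1 by (simp add: mult.assoc[symmetric])
qed

lemma gbinom_0 [simp]: "gbinom p 0 = 1"
  using gbinom_prod[of p 0] by simp

lemma gbinom_0_left: "gbinom 0 m = (if m = 0 then 1 else 0)"
  using gbinom_0[of 0] by (auto simp: gbinom_def qbinom_def simp del: gbinom_0)

lemma prod_qdiff_nz: "(\<Prod>i<m. qdiff (int i + 1)) \<noteq> 0"
  by auto

lemma gbinom_pascal:
  "gbinom (p + 1) (Suc m) = qpow (2 * int (Suc m)) * gbinom p (Suc m) + qpow (2 * (int m - p)) * gbinom p m"
proof -
  let ?D = "\<lambda>m. \<Prod>i<m. qdiff (int i + 1)"
  have s: "(\<Prod>i<Suc m. qdiff (p + 1 - int i)) = qdiff (p + 1) * (\<Prod>i<m. qdiff (p - int i))"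
    by (subst prod.lessThan_Suc_shift) (simp add: algebra_simps)
  have "qdiff (p + 1) = qdiff ((p - int m) + (int m + 1))" by simp
  also have "\<dots> = qpow (2 * int (Suc m)) * qdiff (p - int m) + qpow (2 * (int m - p)) * qdiff (int m + 1)"
    by (subst qdiff_add) (simp add: algebra_simps)
  finally have q: "qdiff (p + 1) = \<dots>" .
  have "(qpow (2 * int (Suc m)) * gbinom p (Suc m) + qpow (2 * (int m - p)) * gbinom p m) * ?D (Suc m)
     = qpow (2 * int (Suc m)) * (gbinom p (Suc m) * ?D (Suc m))
       + qpow (2 * (int m - p)) * qdiff (int m + 1) * (gbinom p m * ?D m)"
    by (simp add: algebra_simps)
  also have "\<dots> = gbinom (p + 1) (Suc m) * ?D (Suc m)"
    unfolding gbinom_prod s unfolding q by (simp add: algebra_simps)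
  finally show ?thesis
    using prod_qdiff_nz[of "Suc m"] by simp
qed

section \<open>Power series: quantum powers of the wall functions\<close>

definition scale :: "int \<Rightarrow> qlaurent fps \<Rightarrow> qlaurent fps" where
  "scale c F = Abs_fps (\<lambda>k. qpow (c * int k) * fps_nth F k)"

definition alternate :: "qlaurent fps \<Rightarrow> qlaurent fps" where
  "alternate F = Abs_fps (\<lambda>k. (- 1) ^ k * fps_nth F k)"

definition gbinom_fps :: "int \<Rightarrow> qlaurent fps" where
  "gbinom_fps p = Abs_fps (gbinom p)"

lemma scale_nth [simp]: "fps_nth (scale c F) k = qpow (c * int k) * fps_nth F k"
  by (simp add: scale_def)

lemma gbinom_fps_nth [simp]: "fps_nth (gbinom_fps p) k = gbinom p k"
  by (simp add: gbinom_fps_def)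

lemma alternate_nth [simp]: "fps_nth (alternate F) k = (- 1) ^ k * fps_nth F k"
  by (simp add: alternate_def)

lemma scale_mult: "scale c (F * G) = scale c F * scale c G"
proof (rule fps_ext)
  fix n
  have "qpow (c * int n) * (fps_nth F i * fps_nth G (n - i))
     = qpow (c * int i) * fps_nth F i * (qpow (c * int (n - i)) * fps_nth G (n - i))"
    if "i \<le> n" for i
  proof -
    have "qpow (c * int n) = qpow (c * int i) * qpow (c * int (n - i))"
      using that by (simp add: of_nat_diff algebra_simps flip: qpow_add)
    thus ?thesis by (simp only: mult_ac)
  qed
  thus "fps_nth (scale c (F * G)) n = fps_nth (scale c F * scale c G) n"
    unfolding fps_mult_nth scale_nth sum_distrib_left by (intro sum.cong) auto
qed

lemma alternate_mult: "alternate (F * G) = alternate F * alternate G"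
proof (rule fps_ext)
  fix n
  have "(- 1) ^ n * (fps_nth F i * fps_nth G (n - i))
     = (- 1) ^ i * fps_nth F i * ((- 1) ^ (n - i) * fps_nth G (n - i))"
    if "i \<le> n" for i
  proof -
    have "(- 1) ^ n = (- 1) ^ i * (- 1 :: qlaurent) ^ (n - i)"
      using that by (simp flip: power_add)
    thus ?thesis by (simp only: mult_ac)
  qed
  thus "fps_nth (alternate (F * G)) n = fps_nth (alternate F * alternate G) n"
    unfolding fps_mult_nth alternate_nth sum_distrib_left by (intro sum.cong) auto
qed

lemma scale_scale [simp]: "scale c (scale d F) = scale (c + d) F"
  by (rule fps_ext) (simp add: algebra_simps qpow_add)

lemma scale_0 [simp]: "scale 0 F = F"
  by (rule fps_ext) simp

lemma scale_1 [simp]: "scale c 1 = 1"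
  by (rule fps_ext) simp

lemma alternate_1 [simp]: "alternate 1 = 1"
  by (rule fps_ext) simp

lemma scale_alternate: "scale c (alternate F) = alternate (scale c F)"
  by (rule fps_ext) (simp add: algebra_simps)

definition one_plus_X :: "int \<Rightarrow> qlaurent fps" where
  "one_plus_X c = 1 + fps_const (qpow c) * fps_X"

lemma scale_one_plus_X [simp]: "scale c (one_plus_X d) = one_plus_X (c + d)"
  by (rule fps_ext) (auto simp: one_plus_X_def qpow_add fps_X_nth)

lemma one_plus_X_nz [simp]: "one_plus_X c \<noteq> 0"
proof -
  have "fps_nth (one_plus_X c) 0 = 1" by (simp add: one_plus_X_def)
  thus ?thesis by (metis fps_zero_nth zero_neq_one)
qed

lemma gbinom_fps_0 [simp]: "gbinom_fps 0 = 1"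
  by (rule fps_ext) (simp add: gbinom_0_left)

lemma gbinom_fps_plus_1: "gbinom_fps (p + 1) = scale 2 (gbinom_fps p) * one_plus_X (- (2 * p))"
proof (rule fps_ext)
  fix n
  show "fps_nth (gbinom_fps (p + 1)) n = fps_nth (scale 2 (gbinom_fps p) * one_plus_X (- (2 * p))) n"
  proof (cases n)
    case (Suc m)
    have "fps_nth (scale 2 (gbinom_fps p) * one_plus_X (- (2 * p))) (Suc m)
       = qpow (2 * int (Suc m)) * gbinom p (Suc m) + qpow (- (2 * p)) * (qpow (2 * int m) * gbinom p m)"
      by (simp add: one_plus_X_def distrib_left mult.assoc[symmetric])
    also have "qpow (- (2 * p)) * (qpow (2 * int m) * gbinom p m) = qpow (2 * (int m - p)) * gbinom p m"
      by (simp add: algebra_simps flip: qpow_add mult.assoc)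
    also have "qpow (2 * int (Suc m)) * gbinom p (Suc m) + qpow (2 * (int m - p)) * gbinom p m = gbinom (p + 1) (Suc m)"
      by (rule gbinom_pascal[symmetric])
    finally show ?thesis by (simp add: Suc)
  qed (simp add: one_plus_X_def)
qed

text \<open>The exponential law for quantum powers of \<open>1 + x\<close>, with the rescalings that
  the commutation rule of the torus demands. Upward induction on \<open>r\<close> is Pascal's rule;
  downward induction cancels the factor \<open>one_plus_X\<close>.\<close>

lemma gbinom_fps_add: "gbinom_fps (p + r) = scale (2 * r) (gbinom_fps p) * scale (- (2 * p)) (gbinom_fps r)"
proof (induction r rule: int_induct[where k = 0])
  case (step1 i)
  have "gbinom_fps (p + (i + 1)) = scale 2 (gbinom_fps (p + i)) * one_plus_X (- (2 * (p + i)))"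
    using gbinom_fps_plus_1[of "p + i"] by (simp add: algebra_simps)
  also have "\<dots> = scale (2 * (i + 1)) (gbinom_fps p) * scale (- (2 * p)) (scale 2 (gbinom_fps i) * one_plus_X (- (2 * i)))"
    unfolding step1 scale_mult by (simp add: algebra_simps)
  finally show ?case by (simp add: gbinom_fps_plus_1)
next
  case (step2 i)
  have "scale 2 (gbinom_fps (p + (i - 1))) * one_plus_X (- (2 * (p + (i - 1)))) = gbinom_fps (p + i)"
    using gbinom_fps_plus_1[of "p + (i - 1)"] by (simp add: algebra_simps)
  also have "\<dots> = scale (2 * i) (gbinom_fps p) * scale (- (2 * p)) (scale 2 (gbinom_fps (i - 1)) * one_plus_X (- (2 * (i - 1))))"
    using step2 gbinom_fps_plus_1[of "i - 1"] by simp
  also have "\<dots> = scale 2 (scale (2 * (i - 1)) (gbinom_fps p) * scale (- (2 * p)) (gbinom_fps (i - 1))) * one_plus_X (- (2 * (p + (i - 1))))"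
    by (simp add: scale_mult algebra_simps)
  finally have "scale 2 (gbinom_fps (p + (i - 1))) = scale 2 (scale (2 * (i - 1)) (gbinom_fps p) * scale (- (2 * p)) (gbinom_fps (i - 1)))"
    by simp
  hence "scale (- 2) (scale 2 (gbinom_fps (p + (i - 1)))) = scale (- 2) (scale 2 (scale (2 * (i - 1)) (gbinom_fps p) * scale (- (2 * p)) (gbinom_fps (i - 1))))"
    by simp
  thus ?case unfolding scale_scale by simp
qed auto

text \<open>The diagonal wall series is 1/((1 - q^2 x)(1 - q^(-2) x)). Each factor is the inverse of
  \<open>1 + x\<close> with \<open>x\<close> replaced by - q^2 x or - q^(-2) x, so a quantum
  \<open>p\<close>-th power is a product of two rescaled copies of \<open>gbinom_fps (- p)\<close>.
  Negative \<open>p\<close> is included, and the exponential law is inherited.\<close>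

definition dcoeff_fps :: "int \<Rightarrow> qlaurent fps" where
  "dcoeff_fps p = scale 2 (alternate (gbinom_fps (- p))) * scale (- 2) (alternate (gbinom_fps (- p)))"

definition dcoeff :: "int \<Rightarrow> nat \<Rightarrow> qlaurent" where
  "dcoeff p m = fps_nth (dcoeff_fps p) m"

lemma dcoeff_fps_0 [simp]: "dcoeff_fps 0 = 1"
  by (simp add: dcoeff_fps_def)

lemma dcoeff_fps_add: "dcoeff_fps (p + r) = scale (2 * r) (dcoeff_fps p) * scale (- (2 * p)) (dcoeff_fps r)"
proof -
  have "gbinom_fps (- (p + r)) = scale (2 * r) (gbinom_fps (- p)) * scale (- (2 * p)) (gbinom_fps (- r))"
    using gbinom_fps_add[of "- r" "- p"] by (simp add: ac_simps)
  thus ?thesis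
    unfolding dcoeff_fps_def by (simp add: scale_mult alternate_mult scale_alternate algebra_simps)
qed

lemma gbinom_minus_1: "gbinom (- 1) k = (- 1) ^ k"
  using qbinom_qfact[of k k] by (simp add: gbinom_def)

lemma gbinom_1: "gbinom 1 k = (if k \<le> 1 then 1 else 0)"
proof -
  have "qbinom 2 1 (Suc 0) = 1" "qbinom 2 1 0 = 1"
    using qbinom_qfact[of 1 1] qbinom_qfact[of 0 1] by simp_all
  moreover have "k \<le> 1 \<longleftrightarrow> k = 0 \<or> k = 1" by auto
  ultimately show ?thesis by (auto simp: gbinom_def qbinom_def)
qed

lemma gbinom_Suc_0: "gbinom (int p) (Suc 0) = qint 2 p"
proof -
  have "gbinom (int p) (Suc 0) * qdiff 1 = qint 2 p * qdiff 1"
    using gbinom_prod[of "int p" "Suc 0"] by (simp add: qint_mult)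
  thus ?thesis by simp
qed

lemma dcoeff_fps_1: "dcoeff_fps 1 = Abs_fps (\<lambda>k. qint 2 (k + 1))"
proof (rule fps_ext)
  fix n
  have 1: "(- 1) ^ k * gbinom (- 1) k = 1" for k
    by (simp add: gbinom_minus_1 flip: power_mult_distrib)
  have "fps_nth (dcoeff_fps 1) n = (\<Sum>i=0..n. qpow (2 * int i) * qpow (- 2 * int (n - i)))"
    by (simp add: dcoeff_fps_def fps_mult_nth 1)
  also have "\<dots> = (\<Sum>i<Suc n. qpow (2 * (2 * int i + 1 - int (Suc n))))"
    by (rule sum.cong) (auto simp: of_nat_diff algebra_simps simp flip: qpow_add)
  finally show "fps_nth (dcoeff_fps 1) n = fps_nth (Abs_fps (\<lambda>k. qint 2 (k + 1))) n"
    by (simp add: qint_sum)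
qed

lemma quantum_power_scale: "quantum_power F p = (\<Prod>i<p. scale (2 * (2 * int i + 1 - int p)) F)"
  by (simp add: quantum_power_def scale_def)

lemma scale_prod: "scale c (\<Prod>i\<in>A. f i) = (\<Prod>i\<in>A. scale c (f i))"
  by (induction A rule: infinite_finite_induct) (simp_all add: scale_mult)

lemma dcoeff_fps_quantum_power: "dcoeff_fps (int p) = quantum_power (Abs_fps (\<lambda>k. qint 2 (k + 1))) p"
proof (induction p)
  case (Suc p)
  let ?F = "Abs_fps (\<lambda>k. qint 2 (k + 1))"
  have "dcoeff_fps (int (Suc p)) = scale (2 * int p) (dcoeff_fps 1) * scale (- 2) (dcoeff_fps (int p))"
    using dcoeff_fps_add[of 1 "int p"] by (simp add: algebra_simps)
  also have "\<dots> = quantum_power ?F (Suc p)"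
    unfolding Suc dcoeff_fps_1 quantum_power_scale scale_prod
    by (simp add: algebra_simps)
  finally show ?case .
qed (simp add: quantum_power_def)

lemma bend_weight_gbinom: "W \<noteq> Diagonal \<Longrightarrow> bend_weight W p m = gbinom (int p) m"
  by (simp add: bend_weight_def gbinom_def)

lemma bend_weight_dcoeff: "bend_weight Diagonal p m = dcoeff (int p) m"
  by (simp add: bend_weight_def dcoeff_def dcoeff_fps_quantum_power)

section \<open>Linear maps of the quantum torus\<close>

definition cross :: "int \<times> int \<Rightarrow> int \<times> int \<Rightarrow> int" where
  "cross u v = fst u * snd v - snd u * fst v"

definition vec :: "nat \<times> nat \<Rightarrow> int \<times> int" where
  "vec s = (int (fst s), int (snd s))"

definition shift :: "int \<times> int \<Rightarrow> nat \<times> nat \<Rightarrow> int \<times> int" where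
  "shift b s = (fst b + 2 * int (fst s), snd b + 2 * int (snd s))"

definition mul :: "nat \<Rightarrow> nat \<times> nat \<Rightarrow> nat \<times> nat" where
  "mul m d = (m * fst d, m * snd d)"

definition splits :: "nat \<times> nat \<Rightarrow> ((nat \<times> nat) \<times> (nat \<times> nat)) set" where
  "splits s = {(x, y). x + y = s}"

lemma mul_sel [simp]: "fst (mul m d) = m * fst d" "snd (mul m d) = m * snd d"
  by (simp_all add: mul_def)

lemma shift_sel [simp]: "fst (shift b s) = fst b + 2 * int (fst s)" "snd (shift b s) = snd b + 2 * int (snd s)"
  by (simp_all add: shift_def)

lemma vec_sel [simp]: "fst (vec s) = int (fst s)" "snd (vec s) = int (snd s)"
  by (simp_all add: vec_def)

lemma shift_0 [simp]: "shift b 0 = b"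
  by (simp add: shift_def)

lemma shift_shift: "shift (shift b x) y = shift b (x + y)"
  by (simp add: shift_def)

lemma mul_0 [simp]: "mul 0 d = 0"
  by (simp add: mul_def zero_prod_def)

lemma mul_add: "mul (i + j) d = mul i d + mul j d"
  by (simp add: mul_def algebra_simps)

lemma mul_inject: "d \<noteq> 0 \<Longrightarrow> mul i d = mul j d \<longleftrightarrow> i = j"
  by (cases d) (auto simp: mul_def zero_prod_def)

lemma splits_iff: "(x, y) \<in> splits s \<longleftrightarrow> x + y = s"
  by (simp add: splits_def)

lemma finite_splits [simp]: "finite (splits s)"
proof (rule finite_subset)
  show "splits s \<subseteq> ({..fst s} \<times> {..snd s}) \<times> ({..fst s} \<times> {..snd s})"
    by (auto simp: splits_def)
qed auto

lemma splits_0: "splits 0 = {(0, 0)}"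
  by (auto simp: splits_def zero_prod_def)

lemma sum_splits_assoc:
  fixes f :: "nat \<times> nat \<Rightarrow> nat \<times> nat \<Rightarrow> nat \<times> nat \<Rightarrow> 'a::comm_monoid_add"
  shows "(\<Sum>(x, y)\<in>splits s. \<Sum>(u, v)\<in>splits x. f u v y) = (\<Sum>(u, w)\<in>splits s. \<Sum>(v, y)\<in>splits w. f u v y)"
proof -
  have "(\<Sum>(x, y)\<in>splits s. \<Sum>(u, v)\<in>splits x. f u v y)
      = (\<Sum>((x, y), (u, v))\<in>(SIGMA p : splits s. splits (fst p)). f u v y)"
    by (subst sum.Sigma[symmetric]) (simp_all add: case_prod_unfold)
  also have "\<dots> = (\<Sum>((u, w), (v, y))\<in>(SIGMA p : splits s. splits (snd p)). f u v y)"
    by (rule sum.reindex_bij_witness[where j = "\<lambda>((x, y), (u, v)). ((u, v + y), (v, y))"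
          and i = "\<lambda>((u, w), (v, y)). ((u + v, y), (u, v))"])
       (auto simp: splits_iff add.assoc)
  also have "\<dots> = (\<Sum>(u, w)\<in>splits s. \<Sum>(v, y)\<in>splits w. f u v y)"
    by (subst sum.Sigma[symmetric]) (simp_all add: case_prod_unfold)
  finally show ?thesis .
qed

lemma sum_splits_interchange:
  fixes f :: "nat \<times> nat \<Rightarrow> nat \<times> nat \<Rightarrow> nat \<times> nat \<Rightarrow> nat \<times> nat \<Rightarrow> 'a::comm_monoid_add"
  shows "(\<Sum>(x, y)\<in>splits s. \<Sum>(x1, x2)\<in>splits x. \<Sum>(y1, y2)\<in>splits y. f x1 x2 y1 y2)
       = (\<Sum>(u, v)\<in>splits s. \<Sum>(x1, y1)\<in>splits u. \<Sum>(x2, y2)\<in>splits v. f x1 x2 y1 y2)"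
proof -
  let ?S = "SIGMA p : splits s. splits (fst p) \<times> splits (snd p)"
  have *: "(\<Sum>(x, y)\<in>splits s. \<Sum>(x1, x2)\<in>splits x. \<Sum>(y1, y2)\<in>splits y. h x1 x2 y1 y2)
     = (\<Sum>((x, y), ((x1, x2), (y1, y2)))\<in>?S. h x1 x2 y1 y2)"
    for h :: "nat \<times> nat \<Rightarrow> nat \<times> nat \<Rightarrow> nat \<times> nat \<Rightarrow> nat \<times> nat \<Rightarrow> 'a"
    by (subst sum.Sigma[symmetric])
       (simp_all add: case_prod_unfold sum.cartesian_product)
  have "(\<Sum>((x, y), ((x1, x2), (y1, y2)))\<in>?S. f x1 x2 y1 y2)
      = (\<Sum>((x, y), ((x1, x2), (y1, y2)))\<in>?S. f x1 y1 x2 y2)"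
    by (rule sum.reindex_bij_witness
        [where j = "\<lambda>((x, y), ((x1, x2), (y1, y2))). ((x1 + y1, x2 + y2), ((x1, y1), (x2, y2)))"
           and i = "\<lambda>((x, y), ((x1, x2), (y1, y2))). ((x1 + y1, x2 + y2), ((x1, y1), (x2, y2)))"])
       (auto simp: splits_iff algebra_simps)
  thus ?thesis by (simp only: *)
qed

lemma sum_splits_swap:
  "(\<Sum>(x, y)\<in>splits s. f x y) = (\<Sum>(x, y)\<in>splits (prod.swap s). f (prod.swap x) (prod.swap y))"
  by (rule sum.reindex_bij_witness[where i = "map_prod prod.swap prod.swap" and j = "map_prod prod.swap prod.swap"])
     (auto simp: splits_def prod_eq_iff)

lemma sum_splits_commute: "(\<Sum>(x, y)\<in>splits s. f x y) = (\<Sum>(x, y)\<in>splits s. f y x)"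
  by (rule sum.reindex_bij_witness[where i = prod.swap and j = prod.swap]) (auto simp: splits_def add.commute)

lemma splitsD: "p \<in> splits s \<Longrightarrow> fst p + snd p = s"
  by (cases p) (simp add: splits_iff)

text \<open>A family \<open>A\<close> encodes a linear map of the completed quantum torus: \<open>A b s\<close> is the coefficient
  of the monomial of exponent \<open>b + 2 s\<close> in the image of the monomial of exponent \<open>b\<close>.\<close>

type_synonym family = "int \<times> int \<Rightarrow> nat \<times> nat \<Rightarrow> qlaurent"

text \<open>The first argument is applied first.\<close>

definition famc :: "family \<Rightarrow> family \<Rightarrow> family" where
  "famc A B = (\<lambda>b s. \<Sum>(x, y)\<in>splits s. A b x * B (shift b x) y)"

definition fid :: family where
  "fid = (\<lambda>b s. if s = 0 then 1 else 0)"

text \<open>The monomial of exponent \<open>b\<close> goes to the sum over \<open>m\<close> of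
  \<open>g p m\<close> times the monomial of exponent \<open>b + 2 m d\<close>, where
  \<open>p\<close> is the pairing of \<open>b\<close> with the wall direction \<open>d\<close>; the
  sign \<open>e\<close> is the sense of the crossing. For \<open>d \<noteq> 0\<close> the
  multiplicity picked by \<open>SOME\<close> is the only one.\<close>

definition crossing :: "(int \<Rightarrow> nat \<Rightarrow> qlaurent) \<Rightarrow> nat \<times> nat \<Rightarrow> int \<Rightarrow> family" where
  "crossing g d e = (\<lambda>b s. if \<exists>m. s = mul m d then g (e * cross (vec d) b) (SOME m. s = mul m d) else 0)"

lemma famc_assoc: "famc (famc A B) C = famc A (famc B C)"
proof (intro ext)
  fix b s
  have "famc (famc A B) C b s
      = (\<Sum>(x, y)\<in>splits s. \<Sum>(u, v)\<in>splits x. A b u * B (shift b u) v * C (shift b (u + v)) y)"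
    unfolding famc_def
    by (rule sum.cong) (auto simp: sum_distrib_right splits_iff intro!: sum.cong)
  also have "\<dots> = (\<Sum>(u, w)\<in>splits s. \<Sum>(v, y)\<in>splits w. A b u * B (shift b u) v * C (shift b (u + v)) y)"
    by (rule sum_splits_assoc)
  also have "\<dots> = famc A (famc B C) b s"
    unfolding famc_def
    by (rule sum.cong) (auto simp: sum_distrib_left splits_iff shift_shift mult.assoc intro!: sum.cong)
  finally show "famc (famc A B) C b s = famc A (famc B C) b s" .
qed

lemma famc_fid [simp]: "famc A fid = A"
proof (intro ext)
  fix b s
  have "famc A fid b s = (\<Sum>(x, y)\<in>{(s, 0)}. A b x * fid (shift b x) y)"
    unfolding famc_def by (rule sum.mono_neutral_right) (auto simp: splits_iff fid_def zero_prod_def split: if_splits)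
  thus "famc A fid b s = A b s" by (simp add: fid_def)
qed

lemma fid_famc [simp]: "famc fid A = A"
proof (intro ext)
  fix b s
  have "famc fid A b s = (\<Sum>(x, y)\<in>{(0, s)}. fid b x * A (shift b x) y)"
    unfolding famc_def by (rule sum.mono_neutral_right) (auto simp: splits_iff fid_def zero_prod_def split: if_splits)
  thus "famc fid A b s = A b s" by (simp add: fid_def)
qed

lemma famc_at_0: "famc A B b 0 = A b 0 * B b 0"
  by (simp add: famc_def splits_0)

lemma crossing_mul: "d \<noteq> 0 \<Longrightarrow> crossing g d e b (mul m d) = g (e * cross (vec d) b) m"
  by (auto simp: crossing_def mul_inject)

lemma crossing_0: "d \<noteq> 0 \<Longrightarrow> crossing g d e b 0 = g (e * cross (vec d) b) 0"
  using crossing_mul[of d g e b 0] by simp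

lemma crossing_nz: "crossing g d e b s \<noteq> 0 \<Longrightarrow> \<exists>m. s = mul m d"
  by (auto simp: crossing_def split: if_splits)

lemma finite_mul_le [simp]: "d \<noteq> 0 \<Longrightarrow> finite {m. mul m d \<le> s}"
proof (rule finite_subset)
  assume "d \<noteq> 0"
  hence "fst d > 0 \<or> snd d > 0" by (cases d) (auto simp: zero_prod_def)
  thus "{m. mul m d \<le> s} \<subseteq> {..fst s + snd s}"
  proof
    assume "fst d > 0"
    have "m \<le> fst s + snd s" if "mul m d \<le> s" for m
    proof -
      have "m \<le> m * fst d" using \<open>fst d > 0\<close> by simp
      also have "\<dots> \<le> fst s" using that by (simp add: less_eq_prod_def)
      finally show ?thesis by simp
    qed
    thus ?thesis by auto
  next
    assume "snd d > 0"
    have "m \<le> fst s + snd s" if "mul m d \<le> s" for m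
    proof -
      have "m \<le> m * snd d" using \<open>snd d > 0\<close> by simp
      also have "\<dots> \<le> snd s" using that by (simp add: less_eq_prod_def)
      finally show ?thesis by simp
    qed
    thus ?thesis by auto
  qed
qed simp

lemma pair_add_diff: "x \<le> s \<Longrightarrow> x + (s - x) = (s :: nat \<times> nat)"
  by (auto simp: less_eq_prod_def prod_eq_iff)

lemma pair_diff_add [simp]: "(x + y) - x = (y :: nat \<times> nat)" "(y + x) - x = (y :: nat \<times> nat)"
  by (auto simp: prod_eq_iff)

lemma pair_le_add [simp]: "x \<le> x + (y :: nat \<times> nat)" "x \<le> y + x"
  by (auto simp: less_eq_prod_def)

lemma sum_splits_crossing:
  assumes "d \<noteq> 0"
  shows "(\<Sum>(x, y)\<in>splits s. crossing g d e b x * F x y)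
       = (\<Sum>m | mul m d \<le> s. g (e * cross (vec d) b) m * F (mul m d) (s - mul m d))"
proof -
  have inj: "inj_on (\<lambda>m. (mul m d, s - mul m d)) {m. mul m d \<le> s}"
    using assms by (auto simp: inj_on_def mul_inject)
  have "(\<Sum>(x, y)\<in>splits s. crossing g d e b x * F x y)
      = (\<Sum>(x, y)\<in>(\<lambda>m. (mul m d, s - mul m d)) ` {m. mul m d \<le> s}. crossing g d e b x * F x y)"
  proof (rule sum.mono_neutral_right)
    show "\<forall>i\<in>splits s - (\<lambda>m. (mul m d, s - mul m d)) ` {m. mul m d \<le> s}.
       (case i of (x, y) \<Rightarrow> crossing g d e b x * F x y) = 0"
    proof (clarify, rule ccontr)
      fix x y assume xy: "(x, y) \<in> splits s" and nz: "crossing g d e b x * F x y \<noteq> 0"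
        and n: "(x, y) \<notin> (\<lambda>m. (mul m d, s - mul m d)) ` {m. mul m d \<le> s}"
      from nz obtain m where "x = mul m d" using crossing_nz by fastforce
      with xy have "(x, y) = (mul m d, s - mul m d)" "mul m d \<le> s"
        by (auto simp: splits_iff)
      with n show False by blast
    qed
  qed (use assms in \<open>auto simp: splits_iff pair_add_diff\<close>)
  also have "\<dots> = (\<Sum>m | mul m d \<le> s. g (e * cross (vec d) b) m * F (mul m d) (s - mul m d))"
    using assms by (subst sum.reindex[OF inj]) (simp add: crossing_mul)
  finally show ?thesis .
qed

lemma famc_crossing:
  assumes "d \<noteq> 0"
  shows "famc (crossing g d e) B b s
       = (\<Sum>m | mul m d \<le> s. g (e * cross (vec d) b) m * B (shift b (mul m d)) (s - mul m d))"
  unfolding famc_def by (rule sum_splits_crossing[OF assms])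

lemma cross_vec_shift_mul [simp]: "cross (vec d) (shift b (mul m d)) = cross (vec d) b"
  by (simp add: cross_def algebra_simps)

text \<open>Multiples of \<open>d\<close> do not change the pairing with \<open>d\<close>, so the
  pairing of the last crossing can be read off at the end exponent \<open>shift b s\<close>, for all
  multiplicities at once. The sign arguments below rest on this form.\<close>

lemma famc_crossing_right:
  assumes "d \<noteq> 0"
  shows "famc A (crossing g d e) b s
       = (\<Sum>m | mul m d \<le> s. A b (s - mul m d) * g (e * cross (vec d) (shift b s)) m)"
proof -
  have *: "crossing g d e (shift b x) y = crossing g d e (shift b s) y" if "x + y = s" for x y
  proof (cases "\<exists>m. y = mul m d")
    case True
    then obtain m where "y = mul m d" by blast
    thus ?thesis using assms by (simp add: crossing_mul flip: shift_shift that)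
  qed (simp add: crossing_def)
  have "famc A (crossing g d e) b s = (\<Sum>(x, y)\<in>splits s. A b y * crossing g d e (shift b y) x)"
    unfolding famc_def by (rule sum_splits_commute)
  also have "\<dots> = (\<Sum>(x, y)\<in>splits s. crossing g d e (shift b s) x * A b y)"
  proof (intro sum.cong refl, clarify)
    fix x1 x2 y1 y2 assume "((x1, x2), (y1, y2)) \<in> splits s"
    hence "(y1, y2) + (x1, x2) = s" by (simp add: splits_def add.commute)
    thus "A b (y1, y2) * crossing g d e (shift b (y1, y2)) (x1, x2) = crossing g d e (shift b s) (x1, x2) * A b (y1, y2)"
      using * by (simp only: mult.commute)
  qed
  also have "\<dots> = (\<Sum>m | mul m d \<le> s. A b (s - mul m d) * g (e * cross (vec d) (shift b s)) m)"
    by (subst sum_splits_crossing[OF assms]) (simp add: mult.commute)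
  finally show ?thesis .
qed

section \<open>Compositions and algebra homomorphisms\<close>

definition fprod :: "family list \<Rightarrow> family \<Rightarrow> family" where
  "fprod xs B = foldr famc xs B"

lemma fprod_simps [simp]: "fprod [] B = B" "fprod (A # xs) B = famc A (fprod xs B)"
  by (simp_all add: fprod_def)

lemma fprod_append: "fprod (xs @ ys) B = fprod xs (fprod ys B)"
  by (simp add: fprod_def)

lemma fprod_famc: "fprod xs B = famc (fprod xs fid) B"
  by (induction xs) (simp_all add: famc_assoc)

lemma fprod_snoc: "fprod (xs @ [A]) fid = famc (fprod xs fid) A"
  by (simp add: fprod_append) (rule fprod_famc)

text \<open>Multiplicativity, compared at the exponent \<open>b + b' + 2 s\<close>; the powers of
  \<open>q\<close> come from the product rule
  \<open>Xmon u * Xmon v = scalar (qpow (cross u v)) * Xmon (u + v)\<close>.\<close>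

definition is_hom :: "family \<Rightarrow> bool" where
  "is_hom A \<longleftrightarrow> (\<forall>b b' s. qpow (cross b b') * A (b + b') s
      = (\<Sum>(x, y)\<in>splits s. qpow (cross (shift b x) (shift b' y)) * A b x * A b' y))"

lemma MultD:
  "is_hom A \<Longrightarrow> qpow (cross b b') * A (b + b') s
      = (\<Sum>(x, y)\<in>splits s. qpow (cross (shift b x) (shift b' y)) * A b x * A b' y)"
  unfolding is_hom_def by blast

lemma shift_add: "shift (b + b') (x + y) = shift b x + shift b' y"
  by (simp add: shift_def algebra_simps)

lemma is_hom_famc:
  assumes A: "is_hom A" and B: "is_hom B"
  shows "is_hom (famc A B)"
  unfolding is_hom_def
proof (intro allI)
  fix b b' s
  let ?F = "\<lambda>x1 x2 y1 y2. qpow (cross (shift b (x1 + x2)) (shift b' (y1 + y2)))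
      * (A b x1 * B (shift b x1) x2) * (A b' y1 * B (shift b' y1) y2)"
  have 1: "qpow (cross (shift b x) (shift b' y)) * famc A B b x * famc A B b' y
      = (\<Sum>(x1, x2)\<in>splits x. \<Sum>(y1, y2)\<in>splits y. ?F x1 x2 y1 y2)" for x y
  proof -
    have "qpow (cross (shift b x) (shift b' y)) * famc A B b x * famc A B b' y
      = (\<Sum>p\<in>splits x. \<Sum>r\<in>splits y. qpow (cross (shift b x) (shift b' y)) *
           ((A b (fst p) * B (shift b (fst p)) (snd p)) * (A b' (fst r) * B (shift b' (fst r)) (snd r))))"
    proof -
      have "famc A B b x * famc A B b' y = (\<Sum>p\<in>splits x. \<Sum>r\<in>splits y.
           (A b (fst p) * B (shift b (fst p)) (snd p)) * (A b' (fst r) * B (shift b' (fst r)) (snd r)))"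
        unfolding famc_def case_prod_unfold by (rule sum_product)
      thus ?thesis by (subst mult.assoc) (simp only: sum_distrib_left)
    qed
    also have "\<dots> = (\<Sum>p\<in>splits x. \<Sum>r\<in>splits y. ?F (fst p) (snd p) (fst r) (snd r))"
      by (intro sum.cong refl) (simp only: splitsD mult.assoc)
    finally show ?thesis by (simp only: case_prod_unfold)
  qed
  \<comment> \<open>With the four summation variables regrouped by stage, the inner sum is the law
    for \<open>B\<close> and the outer sum the law for \<open>A\<close>.\<close>
  have 2: "(\<Sum>(x1, y1)\<in>splits u. \<Sum>(x2, y2)\<in>splits v. ?F x1 x2 y1 y2)
      = (qpow (cross b b') * A (b + b') u) * B (shift (b + b') u) v" for u v
  proof -
    have "(\<Sum>(x2, y2)\<in>splits v. ?F x1 x2 y1 y2)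
        = (qpow (cross (shift b x1) (shift b' y1)) * A b x1 * A b' y1) * B (shift b x1 + shift b' y1) v" for x1 y1
    proof -
      have "(\<Sum>(x2, y2)\<in>splits v. ?F x1 x2 y1 y2) = A b x1 * A b' y1 *
        (\<Sum>(x2, y2)\<in>splits v. qpow (cross (shift (shift b x1) x2) (shift (shift b' y1) y2)) * B (shift b x1) x2 * B (shift b' y1) y2)"
        by (simp only: sum_distrib_left shift_shift case_prod_unfold mult_ac)
      also have "(\<Sum>(x2, y2)\<in>splits v. qpow (cross (shift (shift b x1) x2) (shift (shift b' y1) y2)) * B (shift b x1) x2 * B (shift b' y1) y2)
         = qpow (cross (shift b x1) (shift b' y1)) * B (shift b x1 + shift b' y1) v"
        by (rule MultD[OF B, symmetric])
      finally show ?thesis by (simp only: mult_ac)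
    qed
    hence "(\<Sum>(x1, y1)\<in>splits u. \<Sum>(x2, y2)\<in>splits v. ?F x1 x2 y1 y2)
        = (\<Sum>p\<in>splits u. (qpow (cross (shift b (fst p)) (shift b' (snd p))) * A b (fst p) * A b' (snd p)) * B (shift b (fst p) + shift b' (snd p)) v)"
      by (simp only: case_prod_unfold)
    also have "\<dots> = (\<Sum>p\<in>splits u. (qpow (cross (shift b (fst p)) (shift b' (snd p))) * A b (fst p) * A b' (snd p)) * B (shift (b + b') u) v)"
      by (intro sum.cong refl) (simp only: splitsD flip: shift_add)
    also have "\<dots> = (\<Sum>(x1, y1)\<in>splits u. qpow (cross (shift b x1) (shift b' y1)) * A b x1 * A b' y1) * B (shift (b + b') u) v"
      by (simp only: sum_distrib_right case_prod_unfold)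
    finally show ?thesis by (simp only: MultD[OF A])
  qed
  have "(\<Sum>(x, y)\<in>splits s. qpow (cross (shift b x) (shift b' y)) * famc A B b x * famc A B b' y)
      = (\<Sum>(u, v)\<in>splits s. (qpow (cross b b') * A (b + b') u) * B (shift (b + b') u) v)"
    unfolding 1 sum_splits_interchange 2 ..
  thus "qpow (cross b b') * famc A B (b + b') s = (\<Sum>(x, y)\<in>splits s. qpow (cross (shift b x) (shift b' y)) * famc A B b x * famc A B b' y)"
    unfolding famc_def by (simp only: sum_distrib_left case_prod_unfold mult.assoc)
qed

lemma is_hom_fid: "is_hom fid"
  unfolding is_hom_def
proof (intro allI)
  fix b b' s
  show "qpow (cross b b') * fid (b + b') s = (\<Sum>(x, y)\<in>splits s. qpow (cross (shift b x) (shift b' y)) * fid b x * fid b' y)"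
  proof (cases "s = 0")
    case False
    hence "(\<Sum>(x, y)\<in>splits s. qpow (cross (shift b x) (shift b' y)) * fid b x * fid b' y) = 0"
      by (intro sum.neutral) (auto simp: fid_def splits_iff zero_prod_def)
    thus ?thesis using False by (simp add: fid_def)
  qed (simp add: splits_0 fid_def)
qed

lemma is_hom_fprod: "(\<And>A. A \<in> set xs \<Longrightarrow> is_hom A) \<Longrightarrow> is_hom B \<Longrightarrow> is_hom (fprod xs B)"
  by (induction xs) (auto intro: is_hom_famc)

text \<open>The coefficients of the \<open>p\<close>-th quantum power of a series, for integers \<open>p\<close>, satisfy this identity;
  it makes the crossing of a wall an algebra homomorphism.\<close>

definition vandermonde :: "(int \<Rightarrow> nat \<Rightarrow> qlaurent) \<Rightarrow> bool" where
  "vandermonde g \<longleftrightarrow> (\<forall>p r m. g (p + r) m = (\<Sum>i\<le>m. qpow (2 * (r * int i - p * int (m - i))) * g p i * g r (m - i)))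
     \<and> (\<forall>m. g 0 m = (if m = 0 then 1 else 0))"

text \<open>Exchanging \<open>p\<close> and \<open>r\<close> reverses the sign in the exponent of
  \<open>q\<close>. This is the form needed for crossings with \<open>e = - 1\<close>.\<close>

lemma vandermonde_sym:
  assumes "vandermonde g"
  shows "g (p + r) m = (\<Sum>i\<le>m. qpow (2 * (p * int (m - i) - r * int i)) * g p i * g r (m - i))"
proof -
  have "g (p + r) m = g (r + p) m" by (simp add: add.commute)
  also have "\<dots> = (\<Sum>i\<le>m. qpow (2 * (p * int i - r * int (m - i))) * g r i * g p (m - i))"
    using assms unfolding vandermonde_def by blast
  also have "\<dots> = (\<Sum>i\<le>m. qpow (2 * (p * int (m - i) - r * int i)) * g p i * g r (m - i))"
    by (rule sum.reindex_bij_witness[where i = "\<lambda>i. m - i" and j = "\<lambda>i. m - i"]) (auto simp: mult_ac)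
  finally show ?thesis .
qed

lemma vandermonde_fps:
  assumes "\<And>p r. F (p + r) = scale (2 * r) (F p) * scale (- (2 * p)) (F r)" "F 0 = 1"
  shows "vandermonde (\<lambda>p. fps_nth (F p))"
proof -
  have "fps_nth (F (p + r)) m
      = (\<Sum>i\<le>m. qpow (2 * (r * int i - p * int (m - i))) * fps_nth (F p) i * fps_nth (F r) (m - i))" for p r m
  proof -
    have "fps_nth (F (p + r)) m
        = (\<Sum>i=0..m. qpow (2 * r * int i) * fps_nth (F p) i * (qpow (- (2 * p) * int (m - i)) * fps_nth (F r) (m - i)))"
      by (simp only: assms fps_mult_nth scale_nth)
    also have "\<dots> = (\<Sum>i\<le>m. qpow (2 * r * int i + (- (2 * p) * int (m - i))) * fps_nth (F p) i * fps_nth (F r) (m - i))"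
      unfolding qpow_add by (rule sum.cong) (auto simp: mult_ac)
    finally show ?thesis by (simp add: algebra_simps)
  qed
  thus ?thesis by (simp add: vandermonde_def assms(2))
qed

lemma vandermonde_gbinom: "vandermonde gbinom"
proof -
  have "gbinom = (\<lambda>p. fps_nth (gbinom_fps p))" by (simp add: fun_eq_iff)
  thus ?thesis using vandermonde_fps[OF gbinom_fps_add gbinom_fps_0] by simp
qed

lemma vandermonde_dcoeff: "vandermonde dcoeff"
proof -
  have "dcoeff = (\<lambda>p. fps_nth (dcoeff_fps p))" by (simp add: fun_eq_iff dcoeff_def)
  thus ?thesis using vandermonde_fps[OF dcoeff_fps_add dcoeff_fps_0] by simp
qed

lemma crossing_diff_eq_0:
  assumes "\<nexists>M. s = mul M d" "mul m d \<le> s"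
  shows "crossing g d e b (s - mul m d) = 0"
proof (rule ccontr)
  assume "\<not> ?thesis"
  then obtain n where "s - mul m d = mul n d" using crossing_nz by blast
  hence "s = mul (m + n) d" using pair_add_diff[OF assms(2)] by (simp add: mul_add)
  with assms(1) show False by blast
qed

text \<open>The product of two images again runs along the ray of \<open>d\<close>, and the power of
  \<open>q\<close> from multiplying the monomials of exponents \<open>b + 2 m d\<close> and
  \<open>b' + 2 n d\<close> is the one in \<open>vandermonde\<close>.\<close>

lemma is_hom_crossing:
  assumes g: "vandermonde g" and d: "d \<noteq> 0" and e: "e = 1 \<or> e = - 1"
  shows "is_hom (crossing g d e)"
  unfolding is_hom_def
proof (intro allI)
  fix b b' s
  let ?p = "e * cross (vec d) b" and ?r = "e * cross (vec d) b'"
  have "(\<Sum>(x, y)\<in>splits s. qpow (cross (shift b x) (shift b' y)) * crossing g d e b x * crossing g d e b' y)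
      = (\<Sum>(x, y)\<in>splits s. crossing g d e b x * (qpow (cross (shift b x) (shift b' y)) * crossing g d e b' y))"
    by (simp add: mult_ac)
  also have "\<dots> = (\<Sum>m | mul m d \<le> s. g ?p m *
       (qpow (cross (shift b (mul m d)) (shift b' (s - mul m d))) * crossing g d e b' (s - mul m d)))"
    by (rule sum_splits_crossing[OF d])
  finally have 1: "(\<Sum>(x, y)\<in>splits s. qpow (cross (shift b x) (shift b' y)) * crossing g d e b x * crossing g d e b' y) = \<dots>" .
  show "qpow (cross b b') * crossing g d e (b + b') s
      = (\<Sum>(x, y)\<in>splits s. qpow (cross (shift b x) (shift b' y)) * crossing g d e b x * crossing g d e b' y)"
  proof (cases "\<exists>M. s = mul M d")
    case False
    have "crossing g d e b' (s - mul m d) = 0" if "mul m d \<le> s" for m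
      using False that by (rule crossing_diff_eq_0)
    hence "(\<Sum>(x, y)\<in>splits s. qpow (cross (shift b x) (shift b' y)) * crossing g d e b x * crossing g d e b' y) = 0"
      unfolding 1 by (intro sum.neutral) auto
    thus ?thesis using False by (simp add: crossing_def)
  next
    case True
    then obtain M where s: "s = mul M d" by blast
    have le: "mul m d \<le> s \<longleftrightarrow> m \<le> M" for m
      using d by (cases d) (auto simp: s less_eq_prod_def zero_prod_def)
    have df: "s - mul m d = mul (M - m) d" for m
      by (simp add: s prod_eq_iff algebra_simps diff_mult_distrib)
    have cre: "cross (vec d) (b + b') = cross (vec d) b + cross (vec d) b'"
      by (simp add: cross_def algebra_simps)
    have "qpow (cross b b') * crossing g d e (b + b') s = qpow (cross b b') * g (?p + ?r) M"
      by (simp only: s crossing_mul[OF d] cre distrib_left)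
    also have "\<dots> = (\<Sum>m\<le>M. g ?p m * (qpow (cross (shift b (mul m d)) (shift b' (mul (M - m) d))) * g ?r (M - m)))"
      using e
    proof
      assume [simp]: "e = 1"
      have c: "cross (shift b (mul m d)) (shift b' (mul n d)) = cross b b' + 2 * (?r * int m - ?p * int n)" for m n
        by (simp add: cross_def algebra_simps)
      have "g (?p + ?r) M = (\<Sum>i\<le>M. qpow (2 * (?r * int i - ?p * int (M - i))) * g ?p i * g ?r (M - i))"
        using g unfolding vandermonde_def by blast
      thus ?thesis unfolding c qpow_add by (simp add: sum_distrib_left mult_ac)
    next
      assume [simp]: "e = - 1"
      have c: "cross (shift b (mul m d)) (shift b' (mul n d)) = cross b b' + 2 * (?p * int n - ?r * int m)" for m n
        by (simp add: cross_def algebra_simps)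
      show ?thesis unfolding c qpow_add vandermonde_sym[OF g] by (simp add: sum_distrib_left mult_ac)
    qed
    also have "\<dots> = (\<Sum>(x, y)\<in>splits s. qpow (cross (shift b x) (shift b' y)) * crossing g d e b x * crossing g d e b' y)"
      unfolding 1 le df using d by (simp add: crossing_mul atMost_def)
    finally show ?thesis .
  qed
qed

text \<open>At the lowest order in which two homomorphisms differ, the difference is a
  derivation of the quantum torus, hence inner, hence determined by a single value.\<close>

lemma is_hom_diff:
  assumes A: "is_hom A" and B: "is_hom B" and A0: "\<And>b. A b 0 = 1" and B0: "\<And>b. B b 0 = 1"
    and s: "s \<noteq> 0" and eq: "\<And>b x. x \<le> s \<Longrightarrow> x \<noteq> s \<Longrightarrow> A b x = B b x"
  shows "(A b s - B b s) * qdiff (cross (vec s) b') = (A b' s - B b' s) * qdiff (cross (vec s) b)"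
proof -
  have *: "A (b + b') s - B (b + b') s
      = qpow (2 * cross (vec s) b') * (A b s - B b s) + qpow (- (2 * cross (vec s) b)) * (A b' s - B b' s)" for b b'
  proof -
    let ?f = "\<lambda>A x y. qpow (cross (shift b x) (shift b' y)) * A b x * A b' y"
    have "qpow (cross b b') * (A (b + b') s - B (b + b') s) = (\<Sum>(x, y)\<in>splits s. ?f A x y - ?f B x y)"
      unfolding right_diff_distrib MultD[OF A] MultD[OF B] by (simp only: sum_subtractf case_prod_unfold)
    \<comment> \<open>In any other decomposition both parts are proper, and there \<open>A\<close>
      and \<open>B\<close> agree.\<close>
    also have "\<dots> = (\<Sum>(x, y)\<in>{(s, 0), (0, s)}. ?f A x y - ?f B x y)"
    proof (rule sum.mono_neutral_right)
      show "\<forall>i\<in>splits s - {(s, 0), (0, s)}. (case i of (x, y) \<Rightarrow> ?f A x y - ?f B x y) = 0"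
      proof
        fix p assume p: "p \<in> splits s - {(s, 0), (0, s)}"
        obtain x y where xy: "p = (x, y)" by (cases p)
        with p have "x + y = s" "x \<noteq> s" "y \<noteq> s" by (auto simp: splits_iff)
        hence "A b x = B b x" "A b' y = B b' y" by (auto intro!: eq)
        thus "(case p of (x, y) \<Rightarrow> ?f A x y - ?f B x y) = 0" by (simp add: xy)
      qed
    qed (auto simp: splits_iff)
    also have "\<dots> = qpow (cross (shift b s) b') * (A b s - B b s) + qpow (cross b (shift b' s)) * (A b' s - B b' s)"
      using s by (simp add: A0 B0 algebra_simps)
    also have "cross (shift b s) b' = cross b b' + 2 * cross (vec s) b'"
      by (simp add: cross_def algebra_simps)
    also have "cross b (shift b' s) = cross b b' + - (2 * cross (vec s) b)"
      by (simp add: cross_def algebra_simps)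
    finally have "qpow (cross b b') * (A (b + b') s - B (b + b') s)
       = qpow (cross b b') * (qpow (2 * cross (vec s) b') * (A b s - B b s) + qpow (- (2 * cross (vec s) b)) * (A b' s - B b' s))"
      unfolding qpow_add by (simp only: distrib_left mult.assoc)
    thus ?thesis by (simp only: mult_left_cancel[OF qpow_nz])
  qed
  define x y where "x = A b s - B b s" and "y = A b' s - B b' s"
  \<comment> \<open>Since \<open>b + b' = b' + b\<close>, the twisted Leibniz rule holds with either
    order of the factors; equating the two expressions isolates the commutators.\<close>
  have "qpow (2 * cross (vec s) b') * x + qpow (- (2 * cross (vec s) b)) * y
      = qpow (2 * cross (vec s) b) * y + qpow (- (2 * cross (vec s) b')) * x"
    using *[of b b'] *[of b' b] by (simp add: x_def y_def add.commute[of b' b])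
  hence "x * qdiff (cross (vec s) b') = y * qdiff (cross (vec s) b)"
    unfolding qdiff_def by (simp add: algebra_simps)
  thus ?thesis by (simp only: x_def y_def)
qed

text \<open>The difference at order \<open>s\<close> is proportional to the commutator with the
  monomial of exponent \<open>2 s\<close>. So it vanishes as soon as it does on one monomial that
  fails to commute with that one.\<close>

lemma is_hom_eqI:
  assumes "is_hom A" "is_hom B" "\<And>b. A b 0 = 1" "\<And>b. B b 0 = 1"
    and s: "s \<noteq> 0" and "\<And>b x. x \<le> s \<Longrightarrow> x \<noteq> s \<Longrightarrow> A b x = B b x"
    and "A b0 s = B b0 s" "cross (vec s) b0 \<noteq> 0"
  shows "A b s = B b s"
  using is_hom_diff[OF assms(1-6), of b b0] assms(7,8) by auto

section \<open>Consistency of the scattering diagram\<close>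

text \<open>The case \<open>k = 0\<close> gives the two axis directions, so that the axis walls fit
  into the cluster families.\<close>

definition lvec :: "nat \<Rightarrow> nat \<times> nat" where "lvec k = (k + 1, k)"
definition uvec :: "nat \<Rightarrow> nat \<times> nat" where "uvec k = (k, k + 1)"

lemma lvec_sel [simp]: "fst (lvec k) = k + 1" "snd (lvec k) = k"
  by (simp_all add: lvec_def)

lemma uvec_sel [simp]: "fst (uvec k) = k" "snd (uvec k) = k + 1"
  by (simp_all add: uvec_def)

lemma lvec_nz [simp]: "lvec k \<noteq> 0" "uvec k \<noteq> 0" "(1 :: nat, 1 :: nat) \<noteq> 0" "(0 :: nat, 1 :: nat) \<noteq> 0"
  "(0 :: nat, Suc 0) \<noteq> 0" "(Suc 0, Suc 0) \<noteq> 0" "(1 :: nat, 0 :: nat) \<noteq> 0" "(Suc 0, 0 :: nat) \<noteq> 0"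
  by (simp_all add: lvec_def uvec_def zero_prod_def)

lemma swap_uvec_lvec [simp]: "prod.swap (lvec k) = uvec k" "prod.swap (uvec k) = lvec k"
  by (simp_all add: lvec_def uvec_def)

section \<open>Exchange of the two coordinates\<close>

definition swap_fam :: "family \<Rightarrow> family" where
  "swap_fam A = (\<lambda>b s. A (prod.swap b) (prod.swap s))"

lemma shift_swap: "shift (prod.swap b) (prod.swap s) = prod.swap (shift b s)"
  by (simp add: shift_def)

lemma swap_0 [simp]: "prod.swap s = (0 :: nat \<times> nat) \<longleftrightarrow> s = 0" "prod.swap (0 :: nat \<times> nat) = 0"
  by (auto simp: zero_prod_def prod_eq_iff)

lemma swap_fam_swap_fam [simp]: "swap_fam (swap_fam A) = A"
  by (simp add: swap_fam_def)

lemma swap_fam_fid [simp]: "swap_fam fid = fid"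
  by (simp add: swap_fam_def fid_def fun_eq_iff)

lemma swap_fam_famc: "swap_fam (famc A B) = famc (swap_fam A) (swap_fam B)"
proof (intro ext)
  fix b s
  show "swap_fam (famc A B) b s = famc (swap_fam A) (swap_fam B) b s"
    unfolding swap_fam_def famc_def
    by (subst sum_splits_swap) (simp add: shift_swap)
qed

lemma swap_fam_fprod: "swap_fam (fprod xs B) = fprod (map swap_fam xs) (swap_fam B)"
  by (induction xs) (simp_all add: swap_fam_famc)

text \<open>The exchange changes the sign of \<open>cross\<close>, hence reverses the sense of a
  crossing.\<close>

lemma swap_fam_crossing:
  assumes "d \<noteq> 0"
  shows "swap_fam (crossing g d e) = crossing g (prod.swap d) (- e)"
proof (intro ext)
  fix b s
  have mul: "mul m (prod.swap d) = prod.swap (mul m d)" for m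
    by (simp add: mul_def)
  show "swap_fam (crossing g d e) b s = crossing g (prod.swap d) (- e) b s"
  proof (cases "\<exists>m. prod.swap s = mul m d")
    case True
    then obtain m where m: "prod.swap s = mul m d" by blast
    hence s: "s = mul m (prod.swap d)" by (metis mul swap_swap)
    have c: "e * cross (vec d) (prod.swap b) = - e * cross (vec (prod.swap d)) b"
      by (simp add: cross_def algebra_simps)
    have "swap_fam (crossing g d e) b s = g (e * cross (vec d) (prod.swap b)) m"
      unfolding swap_fam_def m using assms by (simp add: crossing_mul)
    also have "\<dots> = crossing g (prod.swap d) (- e) b s"
      unfolding c unfolding s using assms by (subst crossing_mul) simp_all
    finally show ?thesis .
  next
    case False
    hence "\<nexists>m. s = mul m (prod.swap d)" by (metis mul swap_swap)
    thus ?thesis using False by (simp add: swap_fam_def crossing_def)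
  qed
qed

text \<open>\<open>img A r\<close> is the image under \<open>A\<close> of the monomial of exponent \<open>2 r - (1, 1)\<close>,
  as a series in the offset from \<open>- (1, 1)\<close>.\<close>

definition img :: "family \<Rightarrow> nat \<times> nat \<Rightarrow> nat \<times> nat \<Rightarrow> qlaurent" where
  "img A r s = (if r \<le> s then A (shift (- 1, - 1) r) (s - r) else 0)"

lemma mul_le_bound:
  assumes "d \<noteq> 0" "mul m d \<le> s"
  shows "m \<le> fst s + snd s"
proof -
  have "m * 1 \<le> m * (fst d + snd d)"
    using assms(1) by (intro mult_le_mono2) (cases d, auto simp: zero_prod_def)
  hence "m \<le> m * fst d + m * snd d" by (simp add: algebra_simps)
  thus ?thesis using assms(2) by (auto simp: less_eq_prod_def)
qed

text \<open>\<open>img\<close> vanishes unless \<open>r \<le> s\<close>, so the sum may run over a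
  range that depends on \<open>s\<close> alone; sums for neighbouring \<open>r\<close> can then be
  combined term by term.\<close>

lemma img_crossing:
  assumes "d \<noteq> 0"
  shows "img (famc (crossing g d e) B) r s
       = (\<Sum>m\<le>fst s + snd s. g (e * cross (vec d) (shift (- 1, - 1) r)) m * img B (r + mul m d) s)"
proof (cases "r \<le> s")
  case True
  have *: "mul m d \<le> s - r \<longleftrightarrow> r + mul m d \<le> s" for m
    using True by (auto simp: less_eq_prod_def)
  have "img (famc (crossing g d e) B) r s
      = (\<Sum>m | r + mul m d \<le> s. g (e * cross (vec d) (shift (- 1, - 1) r)) m * img B (r + mul m d) s)"
    using True unfolding img_def
    by (simp add: famc_crossing[OF assms] shift_shift * diff_diff_eq)
  also have "\<dots> = (\<Sum>m\<le>fst s + snd s. g (e * cross (vec d) (shift (- 1, - 1) r)) m * img B (r + mul m d) s)"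
  proof (rule sum.mono_neutral_left)
    have "mul m d \<le> s" if "r + mul m d \<le> s" for m
      using that by (auto simp: less_eq_prod_def)
    thus "{m. r + mul m d \<le> s} \<subseteq> {..fst s + snd s}"
      using mul_le_bound[OF assms] by auto
  qed (auto simp: img_def)
  finally show ?thesis .
next
  case False
  hence "\<not> r + mul m d \<le> s" for m by (auto simp: less_eq_prod_def)
  thus ?thesis using False by (simp add: img_def)
qed

lemma img_beyond:
  assumes "d \<noteq> 0" "m > fst s + snd s"
  shows "img B (r + mul m d) s = 0"
proof -
  have "\<not> mul m d \<le> s" using mul_le_bound assms by fastforce
  hence "\<not> r + mul m d \<le> s" by (auto simp: less_eq_prod_def)
  thus ?thesis by (simp add: img_def)
qed

lemma sum_alternating_telescope:
  "(\<Sum>m\<le>M. (- 1) ^ m * f m) + (\<Sum>m\<le>M. (- 1) ^ m * f (Suc m)) = f 0 + (- 1) ^ M * (f (Suc M) :: 'a :: comm_ring_1)"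
  by (induction M) (auto simp: algebra_simps)

text \<open>At pairing -1 the crossing inserts the geometric series of \<open>1 / (1 + x)\<close>.
  Applied to two terms that differ by one step \<open>d\<close>, it leaves only the first.\<close>

lemma img_crossing_telescope:
  assumes d: "d \<noteq> 0" and p: "e * cross (vec d) (shift (- 1, - 1) r) = - 1"
  shows "img (famc (crossing gbinom d e) B) r s + img (famc (crossing gbinom d e) B) (r + d) s = img B r s"
proof -
  have d1: "mul (Suc 0) d = d" by (simp add: mul_def)
  have p': "e * cross (vec d) (shift (- 1, - 1) (r + d)) = - 1"
    using p cross_vec_shift_mul[of d "shift (- 1, - 1) r" "Suc 0"] by (simp add: shift_shift d1 del: cross_vec_shift_mul)
  have "r + d + mul m d = r + mul (Suc m) d" for m
    by (simp add: mul_def prod_eq_iff)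
  thus ?thesis
    unfolding img_crossing[OF d] p p' gbinom_minus_1
    using sum_alternating_telescope[of "\<lambda>m. img B (r + mul m d) s" "fst s + snd s"]
      img_beyond[OF d, of s "Suc (fst s + snd s)" B r] by simp
qed

lemma img_crossing_1:
  assumes d: "d \<noteq> 0" and p: "e * cross (vec d) (shift (- 1, - 1) r) = 1"
  shows "img (famc (crossing gbinom d e) B) r s = img B r s + img B (r + d) s"
proof -
  have d1: "mul 1 d = d" by (simp add: mul_def)
  have "img (famc (crossing gbinom d e) B) r s = (\<Sum>m\<in>{0, 1}. gbinom 1 m * img B (r + mul m d) s)"
    unfolding img_crossing[OF d] p
  proof (rule sum.mono_neutral_cong)
    fix m assume "m \<in> {0, 1} - {..fst s + snd s}"
    thus "gbinom 1 m * img B (r + mul m d) s = 0"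
      using img_beyond[OF d, of s m] by auto
  qed (auto simp: gbinom_1)
  thus ?thesis using d1 by (simp add: gbinom_1)
qed

lemma img_crossing_0:
  assumes d: "d \<noteq> 0" and p: "e * cross (vec d) (shift (- 1, - 1) r) = 0" and g: "vandermonde g"
  shows "img (famc (crossing g d e) B) r s = img B r s"
proof -
  have "img (famc (crossing g d e) B) r s = (\<Sum>m\<in>{0}. g 0 m * img B (r + mul m d) s)"
    unfolding img_crossing[OF d] p using g
    by (intro sum.mono_neutral_right) (auto simp: vandermonde_def)
  thus ?thesis using g by (simp add: vandermonde_def)
qed

lemma img_fid: "img fid r s = (if r = s then 1 else 0)"
  by (auto simp: img_def fid_def less_eq_prod_def prod_eq_iff)

lemma img_swap_fam: "img (swap_fam A) r s = img A (prod.swap r) (prod.swap s)"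
  by (simp add: img_def swap_fam_def shift_def less_eq_prod_def prod.swap_def conj_commute minus_prod_def)

section \<open>The image of X[1,1] under the two halves of the diagram\<close>

abbreviation Axis2_step :: family where "Axis2_step \<equiv> crossing gbinom (0, 1) (- 1)"

abbreviation C1_step :: "nat \<Rightarrow> family" where "C1_step k \<equiv> crossing gbinom (lvec k) 1"

definition lower_steps :: "nat \<Rightarrow> family list" where
  "lower_steps N = Axis2_step # map C1_step [0..<Suc N]"

definition tri_img :: "family \<Rightarrow> nat \<times> nat \<Rightarrow> qlaurent" where
  "tri_img A s = img A 0 s + img A (1, 0) s + img A (0, 1) s"

text \<open>The crossing along \<open>lvec i\<close> has pairing -1 at offsets \<open>0\<close> and
  \<open>lvec i\<close>, which telescope to \<open>0\<close>, and pairing 1 at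
  \<open>(1, 1)\<close>, which yields \<open>(1, 1)\<close> and \<open>lvec (i + 1)\<close>. The
  three-term shape persists, and its third term moves out of every bounded range.\<close>

lemma img_chain:
  assumes "i \<le> n"
  shows "img (fprod (map C1_step [i..<n]) B) 0 s + img (fprod (map C1_step [i..<n]) B) (1, 1) s
       + img (fprod (map C1_step [i..<n]) B) (lvec i) s
       = img B 0 s + img B (1, 1) s + img B (lvec n) s"
  using assms
proof (induction i rule: inc_induct)
  case (step i)
  let ?B = "fprod (map C1_step [Suc i..<n]) B"
  have eq: "fprod (map C1_step [i..<n]) B = famc (C1_step i) ?B"
    using step by (simp add: upt_conv_Cons)
  have 1: "img (famc (C1_step i) ?B) 0 s + img (famc (C1_step i) ?B) (lvec i) s = img ?B 0 s"
    using img_crossing_telescope[of "lvec i" 1 0 ?B s] by (simp add: cross_def)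
  have 2: "img (famc (C1_step i) ?B) (1, 1) s = img ?B (1, 1) s + img ?B (lvec (Suc i)) s"
  proof -
    have "(1, 1) + lvec i = lvec (Suc i)" by (simp add: lvec_def)
    thus ?thesis using img_crossing_1[of "lvec i" 1 "(1, 1)" ?B s] by (simp add: cross_def)
  qed
  show ?case unfolding eq using 1 2 step.IH by (simp add: algebra_simps)
qed simp

lemma tri_img_lower_steps: "tri_img (fprod (lower_steps N) B) s = img B 0 s + img B (1, 1) s + img B (lvec (Suc N)) s"
proof -
  let ?B = "fprod (map C1_step [0..<Suc N]) B"
  have 1: "img (famc Axis2_step ?B) 0 s + img (famc Axis2_step ?B) (0, 1) s = img ?B 0 s"
    using img_crossing_telescope[of "(0, 1)" "- 1" 0 ?B s] by (simp add: cross_def)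
  have 2: "img (famc Axis2_step ?B) (1, 0) s = img ?B (1, 0) s + img ?B (1, 1) s"
    using img_crossing_1[of "(0, 1)" "- 1" "(1, 0)" ?B s] by (simp add: cross_def)
  have "tri_img (fprod (lower_steps N) B) s = img ?B 0 s + img ?B (1, 1) s + img ?B (lvec 0) s"
    using 1 2 by (simp add: tri_img_def lower_steps_def lvec_def algebra_simps del: upt_Suc)
  also have "\<dots> = img B 0 s + img B (1, 1) s + img B (lvec (Suc N)) s"
    by (rule img_chain) simp
  finally show ?thesis .
qed

lemma tri_img_swap_fam: "tri_img (swap_fam A) s = tri_img A (prod.swap s)"
  by (simp add: tri_img_def img_swap_fam)

abbreviation Diag_step :: family where "Diag_step \<equiv> crossing dcoeff (1, 1) (- 1)"

text \<open>\<open>lower_steps\<close> crosses \<open>Axis2\<close>, \<open>Axis1\<close> and then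
  the walls \<open>Cluster1\<close>; its reflection crosses \<open>Axis1\<close>,
  \<open>Axis2\<close> and then the walls \<open>Cluster2\<close>. The diagonal is assigned to the
  second list, in the same sense as the other reflected walls.\<close>

definition upper_steps :: "nat \<Rightarrow> family list" where
  "upper_steps N = map swap_fam (lower_steps N) @ [Diag_step]"

lemma dcoeff_0 [simp]: "dcoeff p 0 = 1"
  by (simp add: dcoeff_def dcoeff_fps_def)

lemma fprod_at_0:
  assumes "\<And>A b. A \<in> set xs \<Longrightarrow> A b 0 = 1"
  shows "fprod xs fid b 0 = 1"
  using assms by (induction xs) (simp_all add: famc_at_0 fid_def)

lemma fprod_lower_steps_0: "fprod (lower_steps N) fid b 0 = 1"
  by (rule fprod_at_0) (auto simp: lower_steps_def crossing_0)

lemma swap_fam_at_0: "A (prod.swap b) 0 = 1 \<Longrightarrow> swap_fam A b 0 = 1"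
  by (simp add: swap_fam_def)

lemma fprod_upper_steps: "fprod (upper_steps N) fid = famc (swap_fam (fprod (lower_steps N) fid)) Diag_step"
  unfolding upper_steps_def fprod_snoc swap_fam_fprod by simp

lemma fprod_upper_steps_0: "fprod (upper_steps N) fid b 0 = 1"
  by (simp add: fprod_upper_steps famc_at_0 fprod_lower_steps_0 swap_fam_at_0 crossing_0)

lemma is_hom_lower_steps: "is_hom (fprod (lower_steps N) fid)"
  by (rule is_hom_fprod) (auto simp: lower_steps_def intro!: is_hom_crossing is_hom_fid vandermonde_gbinom)

lemma is_hom_upper_steps: "is_hom (fprod (upper_steps N) fid)"
  by (rule is_hom_fprod) (auto simp: upper_steps_def lower_steps_def swap_fam_crossing intro!: is_hom_crossing is_hom_fid vandermonde_gbinom vandermonde_dcoeff)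

text \<open>On both sides the third term lies outside the range of \<open>s\<close>. What is left
  are the terms of exponents (-1, -1) and (1, 1), which the diagonal crossing fixes because their
  pairing with it is 0.\<close>

lemma tri_img_upper_steps:
  assumes "fst s \<le> N" "snd s \<le> N"
  shows "tri_img (fprod (upper_steps N) fid) s = tri_img (fprod (lower_steps N) fid) s"
proof -
  have big: "img B (lvec (Suc N)) t = 0" if "fst t \<le> N" for B t
    using that by (auto simp: img_def less_eq_prod_def)
  have Diag_step: "swap_fam Diag_step = famc (crossing dcoeff (1, 1) 1) fid"
    by (simp add: swap_fam_crossing)
  have "tri_img (fprod (upper_steps N) fid) s = tri_img (swap_fam (fprod (lower_steps N) (swap_fam Diag_step))) s"
    by (simp add: upper_steps_def fprod_append swap_fam_fprod)
  also have "\<dots> = img (swap_fam Diag_step) 0 (prod.swap s) + img (swap_fam Diag_step) (1, 1) (prod.swap s)"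
    using assms by (simp add: tri_img_swap_fam tri_img_lower_steps big)
  also have "\<dots> = img fid 0 (prod.swap s) + img fid (1, 1) (prod.swap s)"
    unfolding Diag_step by (subst (1 2) img_crossing_0) (simp_all add: vandermonde_dcoeff cross_def)
  also have "\<dots> = img fid 0 s + img fid (1, 1) s"
    by (cases s) (auto simp: img_fid zero_prod_def)
  also have "\<dots> = tri_img (fprod (lower_steps N) fid) s"
    using assms by (simp add: tri_img_lower_steps big)
  finally show ?thesis .
qed

text \<open>Every \<open>lvec k\<close> lies strictly below the diagonal, and so does every nonzero
  offset composed of them.\<close>

lemma fprod_C1_step_zero:
  assumes "fst s \<le> snd s" "s \<noteq> 0"
  shows "fprod (map C1_step ks) fid b s = 0"
  using assms
proof (induction ks arbitrary: b s)
  case (Cons k ks)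
  have "fprod (map C1_step ks) fid (shift b (mul m (lvec k))) (s - mul m (lvec k)) = 0" if "mul m (lvec k) \<le> s" for m
  proof (cases "m = 0")
    case True
    thus ?thesis using Cons by simp
  next
    case False
    have lt: "fst (s - mul m (lvec k)) < snd (s - mul m (lvec k))"
      using that Cons.prems(1) False by (auto simp: less_eq_prod_def algebra_simps)
    hence "s - mul m (lvec k) \<noteq> 0" by (metis fst_zero snd_zero less_irrefl)
    thus ?thesis using lt by (intro Cons.IH) auto
  qed
  thus ?case by (simp add: famc_crossing)
qed (simp add: fid_def)

lemma fprod_C1_step_0: "fprod (map C1_step ks) fid b 0 = 1"
  by (rule fprod_at_0) (auto simp: crossing_0)

text \<open>The excess \<open>fst - snd\<close> is additive and equals 1 on each
  \<open>lvec k\<close>, so an offset of excess 1 comes from a single crossing with multiplicity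
  1.\<close>

lemma fprod_C1_step_lvec:
  assumes "distinct ks"
  shows "fprod (map C1_step ks) fid b (lvec j) = (if j \<in> set ks then gbinom (cross (vec (lvec j)) b) 1 else 0)"
  using assms
proof (induction ks)
  case Nil
  show ?case by (simp add: fid_def)
next
  case (Cons k ks)
  let ?f = "\<lambda>m. gbinom (1 * cross (vec (lvec k)) b) m * fprod (map C1_step ks) fid (shift b (mul m (lvec k))) (lvec j - mul m (lvec k))"
  have e: "fprod (map C1_step (k # ks)) fid b (lvec j) = (\<Sum>m | mul m (lvec k) \<le> lvec j. ?f m)"
    by (simp add: famc_crossing)
  show ?case
  proof (cases "k = j")
    case True
    have "mul m (lvec j) \<le> lvec j \<longleftrightarrow> m \<in> {0, 1}" for m
    proof
      assume "mul m (lvec j) \<le> lvec j"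
      hence "m * (j + 1) \<le> 1 * (j + 1)" by (simp add: less_eq_prod_def)
      hence "m \<le> 1" by (rule mult_right_le_imp_le) simp
      thus "m \<in> {0, 1}" by auto
    qed (auto simp: less_eq_prod_def)
    hence "{m. mul m (lvec k) \<le> lvec j} = {0, 1}" using True by auto
    moreover have "lvec j - mul 1 (lvec j) = 0" by (simp add: prod_eq_iff)
    ultimately show ?thesis unfolding e using True Cons by (simp add: fprod_C1_step_0)
  next
    case False
    have "?f m = 0" if "mul m (lvec k) \<le> lvec j" "m \<noteq> 0" for m
    proof -
      have "fst (lvec j - mul m (lvec k)) \<le> snd (lvec j - mul m (lvec k))"
        using that by (auto simp: less_eq_prod_def algebra_simps)
      moreover have "lvec j - mul m (lvec k) \<noteq> 0"
      proof
        assume "lvec j - mul m (lvec k) = 0"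
        hence "m * k + m \<ge> j + 1" "j \<le> m * k" by (simp_all add: prod_eq_iff algebra_simps)
        moreover have "m * k + m \<le> j + 1" "m * k \<le> j" using that by (simp_all add: less_eq_prod_def algebra_simps)
        ultimately have "m * k = j" "m = 1" by linarith+
        with False show False by simp
      qed
      ultimately show ?thesis using fprod_C1_step_zero by simp
    qed
    hence "(\<Sum>m | mul m (lvec k) \<le> lvec j. ?f m) = (\<Sum>m\<in>{0}. ?f m)"
      by (intro sum.mono_neutral_right finite_mul_le) (auto simp: less_eq_prod_def)
    thus ?thesis unfolding e using False Cons by simp
  qed
qed

text \<open>From (1, 0) the crossing of \<open>Axis2\<close> has pairing 1, and later steps lie
  strictly below the diagonal. So the diagonal is reached only by one step (0, 1) followed by one
  step \<open>lvec (j - 1)\<close>, whose pairing with the exponent (1, 2) is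
  \<open>j + 1\<close>.\<close>

lemma fprod_lower_steps_diagonal:
  assumes "0 < j" "j \<le> Suc N"
  shows "fprod (lower_steps N) fid (1, 0) (j, j) = qint 2 (j + 1)"
proof -
  let ?B = "fprod (map C1_step [0..<Suc N]) fid"
  have "fprod (lower_steps N) fid (1, 0) (j, j) = (\<Sum>m | mul m (0, 1) \<le> (j, j). gbinom 1 m * ?B (shift (1, 0) (mul m (0, 1))) ((j, j) - mul m (0, 1)))"
    using famc_crossing[of "(0, 1)" gbinom "- 1" ?B "(1, 0)" "(j, j)"] by (simp add: lower_steps_def cross_def del: upt_Suc)
  also have "\<dots> = (\<Sum>m\<in>{0, 1}. gbinom 1 m * ?B (shift (1, 0) (mul m (0, 1))) ((j, j) - mul m (0, 1)))"
    using assms by (intro sum.mono_neutral_right) (auto simp: less_eq_prod_def gbinom_1)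
  also have "\<dots> = ?B (1, 0) (j, j) + ?B (1, 2) (j, j - 1)"
    by (simp add: gbinom_1 shift_def mul_def del: upt_Suc)
  also have "?B (1, 0) (j, j) = 0"
    using assms by (intro fprod_C1_step_zero) (auto simp: zero_prod_def)
  also have "?B (1, 2) (j, j - 1) = ?B (1, 2) (lvec (j - 1))"
    using assms by (simp add: lvec_def)
  also have "\<dots> = gbinom (int (j + 1)) 1"
    using assms by (subst fprod_C1_step_lvec) (auto simp: cross_def of_nat_diff add.commute)
  finally show ?thesis using gbinom_Suc_0[of "j + 1"] by simp
qed

text \<open>The first crossing, along (1, 0), has pairing 0 with the exponent (1, 0), and the next
  steps lie strictly above the diagonal. Only the diagonal crossing contributes; its pairing is 1,
  so it returns the diagonal wall function itself.\<close>

lemma fprod_upper_steps_diagonal: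
  assumes "0 < j"
  shows "fprod (upper_steps N) fid (1, 0) (j, j) = qint 2 (j + 1)"
proof -
  let ?A = "swap_fam (fprod (lower_steps N) fid)" and ?B = "fprod (map C1_step [0..<Suc N]) fid"
  have A: "?A (1, 0) (i, i) = (if i = 0 then 1 else 0)" for i
  proof (cases "i = 0")
    case False
    have "?A (1, 0) (i, i) = (\<Sum>m | mul m (0, 1) \<le> (i, i). gbinom 0 m * ?B (shift (0, 1) (mul m (0, 1))) ((i, i) - mul m (0, 1)))"
      using famc_crossing[of "(0, 1)" gbinom "- 1" ?B "(0, 1)" "(i, i)"] by (simp add: swap_fam_def lower_steps_def cross_def del: upt_Suc)
    also have "\<dots> = (\<Sum>m\<in>{0}. gbinom 0 m * ?B (shift (0, 1) (mul m (0, 1))) ((i, i) - mul m (0, 1)))"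
      by (intro sum.mono_neutral_right) (auto simp: less_eq_prod_def gbinom_0_left)
    also have "\<dots> = 0"
      using False fprod_C1_step_zero[of "(i, i)"] by (simp add: zero_prod_def del: upt_Suc)
    finally show ?thesis using False by simp
  next
    case True
    have "?A (1, 0) 0 = 1" by (rule swap_fam_at_0) (rule fprod_lower_steps_0)
    thus ?thesis using True by (simp add: zero_prod_def)
  qed
  have "fprod (upper_steps N) fid (1, 0) (j, j)
      = (\<Sum>m | mul m (1, 1) \<le> (j, j). ?A (1, 0) ((j, j) - mul m (1, 1)) * dcoeff 1 m)"
    unfolding fprod_upper_steps by (subst famc_crossing_right) (simp_all add: cross_def)
  also have "\<dots> = (\<Sum>m\<le>j. (if m = j then dcoeff 1 m else 0))"
    by (rule sum.cong) (auto simp: less_eq_prod_def mul_def A)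
  also have "\<dots> = dcoeff 1 j" by simp
  also have "\<dots> = qint 2 (j + 1)" by (simp add: dcoeff_def dcoeff_fps_1)
  finally show ?thesis .
qed

text \<open>Off the diagonal the comparison is made on the sum of three monomials that has the
  same image on both sides; on the diagonal it is made on \<open>X1\<close>.\<close>

theorem lower_steps_upper_steps:
  assumes "fst s \<le> N" "snd s \<le> N"
  shows "fprod (lower_steps N) fid b s = fprod (upper_steps N) fid b s"
  using assms
proof (induction "fst s + snd s" arbitrary: s b rule: less_induct)
  case (less s)
  have IH: "fprod (lower_steps N) fid b x = fprod (upper_steps N) fid b x" if "x \<le> s" "x \<noteq> s" for b x
  proof (rule less(1))
    show "fst x + snd x < fst s + snd s" "fst x \<le> N" "snd x \<le> N"
      using that less(2,3) by (auto simp: less_eq_prod_def prod_eq_iff)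
  qed
  note eqI = is_hom_eqI[OF is_hom_lower_steps[of N] is_hom_upper_steps[of N] fprod_lower_steps_0 fprod_upper_steps_0 _ IH]
  consider "s = 0" | j where "j > 0" "s = (j, j)" | "fst s \<noteq> snd s"
    by (cases s) (auto simp: zero_prod_def)
  thus ?case
  proof cases
    case 1
    thus ?thesis by (simp add: fprod_lower_steps_0 fprod_upper_steps_0)
  next
    case (2 j)
    have "fprod (lower_steps N) fid (1, 0) s = fprod (upper_steps N) fid (1, 0) s"
      using 2 less by (simp add: fprod_lower_steps_diagonal fprod_upper_steps_diagonal)
    thus ?thesis
      by (rule eqI[rotated -2]) (use 2 in \<open>auto simp: zero_prod_def cross_def\<close>)
  next
    case 3
    \<comment> \<open>For \<open>r \<noteq> 0\<close> the coefficient sits at the smaller offset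
      \<open>s - r\<close>, so of the three monomials only the leading one, with
      \<open>r = 0\<close>, remains to be compared.\<close>
    have low: "img (fprod (lower_steps N) fid) r s = img (fprod (upper_steps N) fid) r s" if "r \<noteq> 0" for r
    proof (cases "r \<le> s")
      case True
      have "s - r \<le> s" "s - r \<noteq> s"
        using that True by (auto simp: less_eq_prod_def prod_eq_iff)
      thus ?thesis using IH by (simp add: img_def)
    qed (simp add: img_def)
    have "img (fprod (lower_steps N) fid) 0 s = img (fprod (upper_steps N) fid) 0 s"
      using tri_img_upper_steps[OF less(2,3)] low[of "(1, 0)"] low[of "(0, 1)"] by (simp add: tri_img_def zero_prod_def)
    hence "fprod (lower_steps N) fid (- 1, - 1) s = fprod (upper_steps N) fid (- 1, - 1) s"
      by (simp add: img_def less_eq_prod_def)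
    thus ?thesis
      by (rule eqI[rotated -2]) (use 3 in \<open>auto simp: zero_prod_def cross_def\<close>)
  qed
qed

text \<open>Broken lines only bend at walls with positive pairing; an algebra homomorphism needs all of them.\<close>

definition pos_only :: "(int \<Rightarrow> nat \<Rightarrow> qlaurent) \<Rightarrow> int \<Rightarrow> nat \<Rightarrow> qlaurent" where
  "pos_only g p m = (if m = 0 then 1 else if p > 0 then g p m else 0)"

definition normalized :: "(int \<Rightarrow> nat \<Rightarrow> qlaurent) \<Rightarrow> bool" where
  "normalized g \<longleftrightarrow> (\<forall>p. g p 0 = 1) \<and> (\<forall>m>0. g 0 m = 0)"

lemma normalized_gbinom [simp]: "normalized gbinom" and normalized_dcoeff [simp]: "normalized dcoeff"
  using vandermonde_dcoeff by (auto simp: normalized_def gbinom_0_left vandermonde_def)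

section \<open>From homomorphisms to sums over bends with positive pairing\<close>

definition signed_prod :: "((int \<Rightarrow> nat \<Rightarrow> qlaurent) \<times> (nat \<times> nat)) list \<Rightarrow> family" where
  "signed_prod xs = fprod (Axis2_step # map (\<lambda>(g, d). crossing g d 1) xs) fid"

definition pos_prod :: "((int \<Rightarrow> nat \<Rightarrow> qlaurent) \<times> (nat \<times> nat)) list \<Rightarrow> family" where
  "pos_prod xs = fprod (crossing (pos_only gbinom) (0, 1) (- 1) # map (\<lambda>(g, d). crossing (pos_only g) d 1) xs) fid"

lemma signed_prod_snoc: "signed_prod (xs @ [(g, d)]) = famc (signed_prod xs) (crossing g d 1)"
  using fprod_snoc[of "Axis2_step # map (\<lambda>(g, d). crossing g d 1) xs" "crossing g d 1"] by (simp add: signed_prod_def)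

lemma pos_prod_snoc: "pos_prod (xs @ [(g, d)]) = famc (pos_prod xs) (crossing (pos_only g) d 1)"
  using fprod_snoc[of "crossing (pos_only gbinom) (0, 1) (- 1) # map (\<lambda>(g, d). crossing (pos_only g) d 1) xs" "crossing (pos_only g) d 1"]
  by (simp add: pos_prod_def)

text \<open>Suppose that the last wall \<open>d\<close> acts with \<open>m > 0\<close>. Its pairing
  at the end exponent is then positive and equals the pairing just before. The earlier walls lie
  clockwise of \<open>d\<close>, so they have positive pairing there too, and the induction applies.
  Negative pairings never arise.\<close>

lemma signed_prod_eq_pos_prod:
  assumes b: "fst b > 0" "snd b > 0"
    and normalized: "\<And>g d. (g, d) \<in> set xs \<Longrightarrow> normalized g \<and> fst d > 0 \<and> cross (vec d) (shift b s) \<ge> 0"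
    and sorted: "sorted_wrt (\<lambda>x y. cross (vec (snd x)) (vec (snd y)) > 0) xs"
  shows "signed_prod xs b s = pos_prod xs b s"
  using normalized sorted
proof (induction xs arbitrary: s rule: rev_induct)
  case Nil
  show ?case using b by (simp add: signed_prod_def pos_prod_def crossing_def pos_only_def cross_def)
next
  case (snoc x xs)
  obtain g d where x: "x = (g, d)" by (cases x)
  have g: "normalized g" and d: "fst d > 0" and p: "cross (vec d) (shift b s) \<ge> 0"
    using snoc.prems(1)[of g d] by (auto simp: x)
  have d0: "d \<noteq> 0" using d by (cases d) (auto simp: zero_prod_def)
  have eq: "signed_prod xs b (s - mul m d) * g (cross (vec d) (shift b s)) m
      = pos_prod xs b (s - mul m d) * pos_only g (cross (vec d) (shift b s)) m" if m: "mul m d \<le> s" for m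
  proof -
    consider "m = 0" | "m > 0" "cross (vec d) (shift b s) = 0" | "m > 0" "cross (vec d) (shift b s) > 0"
      using p by linarith
    thus ?thesis
    proof cases
      case 1
      have "signed_prod xs b s = pos_prod xs b s"
        by (rule snoc.IH) (use snoc.prems in \<open>auto simp: sorted_wrt_append\<close>)
      thus ?thesis using 1 g by (simp add: pos_only_def normalized_def)
    next
      case 2
      thus ?thesis using g by (simp add: pos_only_def normalized_def)
    next
      case 3
      have s': "shift b s = shift (shift b (s - mul m d)) (mul m d)"
        using m by (auto simp: shift_def less_eq_prod_def of_nat_diff)
      hence pos: "cross (vec d) (shift b (s - mul m d)) > 0"
        using 3 by simp
      have "signed_prod xs b (s - mul m d) = pos_prod xs b (s - mul m d)"
      proof (rule snoc.IH)
        show "sorted_wrt (\<lambda>x y. cross (vec (snd x)) (vec (snd y)) > 0) xs"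
          using snoc.prems by (simp add: sorted_wrt_append)
      next
        fix g' d' assume *: "(g', d') \<in> set xs"
        let ?a = "shift b (s - mul m d)"
        have d': "fst d' > 0" "normalized g'" using snoc.prems(1)[of g' d'] * by auto
        have "cross (vec d') (vec d) > 0"
          using snoc.prems(2) * by (auto simp: sorted_wrt_append x)
        hence "int (fst d) * cross (vec d') ?a > 0"
        proof -
          assume c: "cross (vec d') (vec d) > 0"
          \<comment> \<open>The three-term relation between cross products of plane vectors; both
            summands on the right are positive.\<close>
          have "int (fst d) * cross (vec d') ?a
             = int (fst d') * cross (vec d) ?a + fst ?a * cross (vec d') (vec d)"
            by (simp add: cross_def algebra_simps)
          moreover have "int (fst d') * cross (vec d) ?a > 0" using d' pos by simp
          moreover have "fst ?a * cross (vec d') (vec d) > 0"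
            using c b by (intro mult_pos_pos) auto
          ultimately show ?thesis by linarith
        qed
        hence "cross (vec d') ?a > 0" using d by (simp add: zero_less_mult_iff)
        thus "normalized g' \<and> fst d' > 0 \<and> cross (vec d') ?a \<ge> 0" using d' by simp
      qed
      thus ?thesis using 3 by (simp add: pos_only_def)
    qed
  qed
  show ?case
    unfolding x signed_prod_snoc pos_prod_snoc famc_crossing_right[OF d0]
    by (intro sum.cong) (auto simp: eq)
qed

text \<open>At a nonpositive pairing \<open>pos_only\<close> admits only multiplicity 0.\<close>

lemma pos_prod_append_drop:
  assumes "\<And>g d. (g, d) \<in> set ys \<Longrightarrow> d \<noteq> 0 \<and> cross (vec d) (shift b s) \<le> 0"
  shows "pos_prod (xs @ ys) b s = pos_prod xs b s"
  using assms
proof (induction ys rule: rev_induct)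
  case (snoc y ys)
  obtain g d where y: "y = (g, d)" by (cases y)
  have d: "d \<noteq> 0" "cross (vec d) (shift b s) \<le> 0" using snoc.prems[of g d] by (auto simp: y)
  have "pos_prod ((xs @ ys) @ [(g, d)]) b s
      = (\<Sum>m | mul m d \<le> s. pos_prod (xs @ ys) b (s - mul m d) * pos_only g (1 * cross (vec d) (shift b s)) m)"
    unfolding pos_prod_snoc by (rule famc_crossing_right[OF d(1)])
  also have "\<dots> = (\<Sum>m\<in>{0}. pos_prod (xs @ ys) b (s - mul m d) * pos_only g (1 * cross (vec d) (shift b s)) m)"
    using d by (intro sum.mono_neutral_right finite_mul_le) (auto simp: pos_only_def less_eq_prod_def)
  also have "\<dots> = pos_prod (xs @ ys) b s"
    by (simp add: pos_only_def)
  also have "\<dots> = pos_prod xs b s"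
    by (rule snoc.IH) (use snoc.prems in auto)
  finally show ?case by (simp add: y)
qed simp

section \<open>Moving walls to the other side of the consistency relation\<close>

lemma gbinom_fps_inverse: "gbinom_fps p * gbinom_fps (- p) = 1"
proof -
  have "scale (- (2 * p)) (gbinom_fps p * gbinom_fps (- p)) = 1"
    using gbinom_fps_add[of p "- p"] by (simp add: scale_mult)
  hence "scale (2 * p) (scale (- (2 * p)) (gbinom_fps p * gbinom_fps (- p))) = 1" by simp
  thus ?thesis unfolding scale_scale by simp
qed

lemma crossing_inverse:
  assumes d: "d \<noteq> 0"
  shows "famc (crossing gbinom d 1) (crossing gbinom d (- 1)) = fid"
proof (intro ext)
  fix b s
  let ?p = "cross (vec d) b"
  have e: "famc (crossing gbinom d 1) (crossing gbinom d (- 1)) b s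
      = (\<Sum>m | mul m d \<le> s. gbinom ?p m * crossing gbinom d (- 1) (shift b (mul m d)) (s - mul m d))"
    by (subst famc_crossing[OF d]) simp
  show "famc (crossing gbinom d 1) (crossing gbinom d (- 1)) b s = fid b s"
  proof (cases "\<exists>M. s = mul M d")
    case False
    have "crossing gbinom d (- 1) (shift b (mul m d)) (s - mul m d) = 0" if "mul m d \<le> s" for m
      using False that by (rule crossing_diff_eq_0)
    moreover have "s \<noteq> 0" using False mul_0 by metis
    ultimately show ?thesis unfolding e by (simp add: fid_def)
  next
    case True
    then obtain M where s: "s = mul M d" by blast
    have le: "mul m d \<le> s \<longleftrightarrow> m \<le> M" for m
      using d by (cases d) (auto simp: s less_eq_prod_def zero_prod_def)
    have df: "s - mul m d = mul (M - m) d" for m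
      by (simp add: s prod_eq_iff algebra_simps diff_mult_distrib)
    have "(\<Sum>m\<le>M. gbinom ?p m * gbinom (- ?p) (M - m)) = fps_nth (gbinom_fps ?p * gbinom_fps (- ?p)) M"
      by (simp add: fps_mult_nth atLeast0AtMost)
    also have "\<dots> = fid b s"
      using mul_inject[OF d, of M 0] by (simp add: gbinom_fps_inverse fid_def s)
    finally show ?thesis unfolding e le df using d by (simp add: crossing_mul atMost_def)
  qed
qed

lemma fprod_C1_step_cancel:
  assumes "K \<le> N"
  shows "fprod (map C1_step [0..<Suc N] @ map (\<lambda>k. crossing gbinom (lvec k) (- 1)) (rev [Suc K..<Suc N])) B
       = fprod (map C1_step [0..<Suc K]) B"
  using assms
proof (induction N rule: dec_induct)
  case (step N)
  let ?V = "\<lambda>N. map (\<lambda>k. crossing gbinom (lvec k) (- 1)) (rev [Suc K..<Suc N])"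
  have l1: "map C1_step [0..<Suc (Suc N)] = map C1_step [0..<Suc N] @ [C1_step (Suc N)]" by simp
  have l2: "?V (Suc N) = crossing gbinom (lvec (Suc N)) (- 1) # ?V N" using step(1) by simp
  have "fprod (map C1_step [0..<Suc (Suc N)] @ ?V (Suc N)) B
      = fprod (map C1_step [0..<Suc N]) (famc (famc (C1_step (Suc N)) (crossing gbinom (lvec (Suc N)) (- 1))) (fprod (?V N) B))"
    unfolding l1 l2 by (simp only: fprod_append fprod_simps famc_assoc)
  also have "\<dots> = fprod (map C1_step [0..<Suc N] @ ?V N) B"
    by (simp only: crossing_inverse[OF lvec_nz(1)] fid_famc fprod_append)
  finally show ?case using step.IH by simp
qed simp

lemma fprod_lower_steps_upper_steps_append:
  assumes "fst s \<le> N" "snd s \<le> N"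
  shows "fprod (lower_steps N @ Z) fid b s = fprod (upper_steps N @ Z) fid b s"
proof -
  have "fprod (lower_steps N @ Z) fid b s = famc (fprod (lower_steps N) fid) (fprod Z fid) b s"
    by (simp only: fprod_append) (subst fprod_famc, rule refl)
  also have "\<dots> = famc (fprod (upper_steps N) fid) (fprod Z fid) b s"
    unfolding famc_def
  proof (intro sum.cong refl, clarify)
    fix x1 x2 y1 y2 assume "((x1, x2), (y1, y2)) \<in> splits s"
    hence "fst (x1, x2) \<le> N" "snd (x1, x2) \<le> N" using assms by (auto simp: splits_iff)
    thus "fprod (lower_steps N) fid b (x1, x2) * fprod Z fid (shift b (x1, x2)) (y1, y2)
        = fprod (upper_steps N) fid b (x1, x2) * fprod Z fid (shift b (x1, x2)) (y1, y2)"
      by (simp only: lower_steps_upper_steps)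
  qed
  also have "\<dots> = fprod (upper_steps N @ Z) fid b s"
    by (simp only: fprod_append) (subst fprod_famc, rule refl)
  finally show ?thesis .
qed

text \<open>The walls after \<open>Axis2\<close> in counterclockwise order. The walls
  \<open>uvec k\<close> approach the diagonal as \<open>k\<close> grows and hence appear in reverse;
  \<open>k = 0\<close> is omitted there because it is the direction of \<open>Axis2\<close>.\<close>

definition wall_data :: "nat \<Rightarrow> ((int \<Rightarrow> nat \<Rightarrow> qlaurent) \<times> (nat \<times> nat)) list" where
  "wall_data N = map (\<lambda>k. (gbinom, lvec k)) [0..<Suc N] @ (dcoeff, (1, 1)) # map (\<lambda>k. (gbinom, uvec k)) (rev [1..<Suc N])"

text \<open>\<open>K\<close> separates the walls \<open>lvec k\<close> with nonnegative pairing at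
  the end exponent from the others. Dropping the others leaves a signed product, namely
  \<open>lower_steps N\<close> followed by the inverse crossings of
  \<open>lvec N, ..., lvec (K + 1)\<close>. Consistency turns \<open>lower_steps N\<close> into
  \<open>upper_steps N\<close>; after exchange of the coordinates the inverses are crossings of
  \<open>uvec N, ..., uvec (K + 1)\<close> in the positive sense, the walls that follow the
  diagonal. All pairings are again nonnegative, and the missing walls
  \<open>uvec K, ..., uvec 1\<close> have nonpositive pairing.\<close>

lemma pos_prod_swap_aux:
  assumes b: "fst b > 0" "snd b > 0" and s: "fst s \<le> N" "snd s \<le> N" and K: "K \<le> N"
    and le: "\<And>k. k \<le> K \<Longrightarrow> cross (vec (lvec k)) (shift b s) \<ge> 0"
    and gt: "\<And>k. k > K \<Longrightarrow> k \<le> N \<Longrightarrow> cross (vec (lvec k)) (shift b s) \<le> 0"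
    and diag: "snd (shift b s) \<le> fst (shift b s)"
  shows "pos_prod (wall_data N) b s = pos_prod (wall_data N) (prod.swap b) (prod.swap s)"
proof -
  define X where "X = map (\<lambda>k. (gbinom, lvec k)) [0..<Suc K]"
  define Z where "Z = map (\<lambda>k. (gbinom, lvec k)) [Suc K..<Suc N] @ (dcoeff, (1, 1)) # map (\<lambda>k. (gbinom, uvec k)) (rev [1..<Suc N])"
  define X' where "X' = map (\<lambda>k. (gbinom, lvec k)) [0..<Suc N] @ (dcoeff, (1, 1)) # map (\<lambda>k. (gbinom, uvec k)) (rev [Suc K..<Suc N])"
  define Z' where "Z' = map (\<lambda>k. (gbinom, uvec k)) (rev [1..<Suc K])"
  define V where "V = map (\<lambda>k. crossing gbinom (lvec k) (- 1)) (rev [Suc K..<Suc N])"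
  have pos: "fst (shift b s) > 0" "snd (shift b s) > 0" using b by auto
  have ul: "cross (vec (uvec k)) (shift b s) \<le> 0" for k
  proof -
    have "cross (vec (uvec k)) (shift b s) = int k * (snd (shift b s) - fst (shift b s)) - fst (shift b s)"
      by (simp add: cross_def algebra_simps)
    moreover have "int k * (snd (shift b s) - fst (shift b s)) \<le> 0"
      using diag by (intro mult_nonneg_nonpos) auto
    ultimately show ?thesis using pos by linarith
  qed
  have scale: "cross (vec d) (shift (prod.swap b) (prod.swap s)) = - cross (vec (prod.swap d)) (shift b s)" for d
    by (simp add: cross_def algebra_simps)
  have 1: "[0..<Suc N] = [0..<Suc K] @ [Suc K..<Suc N]"
    using K upt_add_eq_append[of 0 "Suc K" "N - K"] by simp
  have 2: "[1..<Suc N] = [1..<Suc K] @ [Suc K..<Suc N]"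
    using K upt_add_eq_append[of 1 "Suc K" "N - K"] by simp
  have wall_data: "wall_data N = X @ Z"
    unfolding wall_data_def X_def Z_def by (subst 1) simp
  have WL': "wall_data N = X' @ Z'"
    unfolding wall_data_def X'_def Z'_def by (subst 2) simp
  have "pos_prod (wall_data N) b s = pos_prod X b s"
    unfolding wall_data by (rule pos_prod_append_drop) (use gt diag ul in \<open>auto simp: Z_def cross_def\<close>)
  also have "\<dots> = signed_prod X b s"
    using le by (intro signed_prod_eq_pos_prod[symmetric] b)
      (auto simp: X_def sorted_wrt_map cross_def algebra_simps sorted_wrt_append simp del: upt_Suc
         intro!: sorted_wrt_mono_rel[OF _ sorted_wrt_upt])
  also have "signed_prod X = fprod (lower_steps N @ V) fid"
    using fprod_C1_step_cancel[OF K, of fid]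
    by (simp add: signed_prod_def X_def lower_steps_def V_def comp_def del: upt_Suc)
  also have "fprod (lower_steps N @ V) fid b s = fprod (upper_steps N @ V) fid b s"
    by (rule fprod_lower_steps_upper_steps_append[OF s])
  also have "fprod (upper_steps N @ V) fid = swap_fam (signed_prod X')"
    by (simp add: signed_prod_def swap_fam_famc swap_fam_fprod upper_steps_def lower_steps_def X'_def V_def fprod_append swap_fam_crossing comp_def famc_assoc
        del: upt_Suc)
  also have "swap_fam (signed_prod X') b s = signed_prod X' (prod.swap b) (prod.swap s)"
    by (simp add: swap_fam_def)
  also have "\<dots> = pos_prod X' (prod.swap b) (prod.swap s)"
  proof (rule signed_prod_eq_pos_prod)
    fix g d assume "(g, d) \<in> set X'"
    thus "normalized g \<and> fst d > 0 \<and> cross (vec d) (shift (prod.swap b) (prod.swap s)) \<ge> 0"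
      unfolding scale using ul gt diag by (auto simp: X'_def) (auto simp: cross_def)
  next
    show "sorted_wrt (\<lambda>x y. cross (vec (snd x)) (vec (snd y)) > 0) X'"
      by (auto simp: X'_def sorted_wrt_map cross_def algebra_simps sorted_wrt_append sorted_wrt_rev rev_map[symmetric]
          simp del: upt_Suc intro!: sorted_wrt_mono_rel[OF _ sorted_wrt_upt])
  qed (use b in auto)
  also have "\<dots> = pos_prod (wall_data N) (prod.swap b) (prod.swap s)"
    unfolding WL' by (rule pos_prod_append_drop[symmetric], unfold scale) (use le in \<open>auto simp: Z'_def\<close>)
  finally show ?thesis .
qed

lemma int_mult_le_iff_le_div:
  assumes "(d :: int) > 0"
  shows "k * d \<le> a \<longleftrightarrow> k \<le> a div d"
proof
  assume "k * d \<le> a"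
  thus "k \<le> a div d" using zdiv_mono1[of "k * d" a d] assms by simp
next
  assume "k \<le> a div d"
  hence "k * d \<le> a div d * d" using assms by simp
  also have "\<dots> \<le> a" using assms by (simp add: minus_mod_eq_div_mult[symmetric])
  finally show "k * d \<le> a" .
qed

text \<open>By symmetry the end exponent \<open>(a1, a2)\<close> may be taken on or below the
  diagonal. Its pairing with \<open>lvec k\<close> is \<open>a2 - k * (a1 - a2)\<close>, which
  decreases with \<open>k\<close>, so the cutoff is the integer part of
  \<open>a2 / (a1 - a2)\<close>, capped at \<open>N\<close>. On the diagonal all these pairings are
  positive.\<close>

theorem pos_prod_swap:
  assumes b: "fst b > 0" "snd b > 0" and s: "fst s \<le> N" "snd s \<le> N"
  shows "pos_prod (wall_data N) b s = pos_prod (wall_data N) (prod.swap b) (prod.swap s)"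
proof -
  have *: "pos_prod (wall_data N) b s = pos_prod (wall_data N) (prod.swap b) (prod.swap s)"
    if b: "fst b > 0" "snd b > 0" and s: "fst s \<le> N" "snd s \<le> N"
      and diag: "snd (shift b s) \<le> fst (shift b s)" for b s
  proof -
    let ?a1 = "fst (shift b s)" and ?a2 = "snd (shift b s)"
    have pos: "?a2 > 0" using b by simp
    have c: "cross (vec (lvec k)) (shift b s) = ?a2 - int k * (?a1 - ?a2)" for k
      by (simp add: cross_def algebra_simps)
    show ?thesis
    proof (cases "?a1 = ?a2")
      case True
      show ?thesis
        by (rule pos_prod_swap_aux[OF b s order.refl _ _ diag]) (use True pos in \<open>auto simp: c simp del: shift_sel\<close>)
    next
      case False
      hence d: "?a1 - ?a2 > 0" using diag by simp
      define q where "q = ?a2 div (?a1 - ?a2)"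
      have q0: "q \<ge> 0" unfolding q_def using d pos by (intro pos_imp_zdiv_nonneg_iff[THEN iffD2]) auto
      have le: "int k * (?a1 - ?a2) \<le> ?a2 \<longleftrightarrow> int k \<le> q" for k
        unfolding q_def by (rule int_mult_le_iff_le_div[OF d])
      show ?thesis
      proof (rule pos_prod_swap_aux[OF b s _ _ _ diag])
        show "min N (nat q) \<le> N" by simp
        show "cross (vec (lvec k)) (shift b s) \<ge> 0" if "k \<le> min N (nat q)" for k
          using that le[of k] q0 unfolding c by linarith
        show "cross (vec (lvec k)) (shift b s) \<le> 0" if "k > min N (nat q)" "k \<le> N" for k
          using that le[of k] q0 unfolding c by linarith
      qed
    qed
  qed
  show ?thesis
  proof (cases "snd (shift b s) \<le> fst (shift b s)")
    case False
    thus ?thesis using *[of "prod.swap b" "prod.swap s"] b s by simp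
  qed (use * b s in blast)
qed

section \<open>Bend lists and the greedy recurrence\<close>

fun wvec :: "wall \<Rightarrow> nat \<times> nat" where
  "wvec Axis1 = lvec 0"
| "wvec Axis2 = (0, 1)"
| "wvec (Cluster1 k) = lvec k"
| "wvec (Cluster2 k) = uvec k"
| "wvec Diagonal = (1, 1)"

lemma vec_wvec: "vec (wvec W) = wall_dir W"
  by (cases W) (simp_all add: vec_def)

text \<open>Counterclockwise from the first quadrant, \<open>Axis2\<close> is met on its positive
  ray and every other wall on its negative ray; hence the opposite sign for
  \<open>Axis2\<close>.\<close>

definition pairing :: "wall \<Rightarrow> int \<times> int \<Rightarrow> int" where
  "pairing W b = (if W = Axis2 then fst b else cross (wall_dir W) b)"

text \<open>The order in which a path that winds counterclockwise from the first quadrant through the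
  second one meets the walls.\<close>

definition before :: "wall \<Rightarrow> wall \<Rightarrow> bool" where
  "before W W' \<longleftrightarrow> W' \<noteq> Axis2 \<and> (W = Axis2 \<or> cross (wall_dir W) (wall_dir W') > 0)"

abbreviation bend_coeff :: "wall \<Rightarrow> int \<Rightarrow> nat \<Rightarrow> int" where
  "bend_coeff W p m \<equiv> fps_nth (wall_series W ^ nat p) m"

text \<open>The bends of a broken line, followed backwards from its end point: the last bend comes first, and
  \<open>b\<close> is the negative of the terminal exponent.\<close>

fun bend_list :: "int \<times> int \<Rightarrow> (wall \<times> nat) list \<Rightarrow> bool" where
  "bend_list b [] \<longleftrightarrow> True"
| "bend_list b ((W, m) # L) \<longleftrightarrow> W \<in> scattering_diagram \<and> m \<ge> 1 \<and> pairing W b > 0 \<and> bend_coeff W (pairing W b) m \<noteq> 0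
     \<and> bend_list (shift b (mul m (wvec W))) L"

fun offset :: "(wall \<times> nat) list \<Rightarrow> nat \<times> nat" where
  "offset [] = 0"
| "offset ((W, m) # L) = mul m (wvec W) + offset L"

fun weight :: "int \<times> int \<Rightarrow> (wall \<times> nat) list \<Rightarrow> qlaurent" where
  "weight b [] = 1"
| "weight b ((W, m) # L) = bend_weight W (nat (pairing W b)) m * weight (shift b (mul m (wvec W))) L"

definition paths :: "wall set \<Rightarrow> int \<times> int \<Rightarrow> nat \<times> nat \<Rightarrow> (wall \<times> nat) list set" where
  "paths S b s = {L. bend_list b L \<and> sorted_wrt before (map fst L) \<and> fst ` set L \<subseteq> S \<and> offset L = s}"

lemma nth_one_plus_X_power: "fps_nth ((1 + fps_X) ^ n :: int fps) k = int (n choose k)"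
proof (induction n arbitrary: k)
  case (Suc n)
  show ?case by (cases k) (simp_all add: Suc distrib_right)
qed (simp add: binomial_eq_0_iff)

lemma nth_diagonal_power_pos: "fps_nth (Abs_fps (\<lambda>j. int j + 1) ^ Suc p) m > 0"
proof (induction p arbitrary: m)
  case (Suc p)
  have "fps_nth (Abs_fps (\<lambda>j. int j + 1) ^ Suc (Suc p)) m
      = (\<Sum>i=0..m. (int i + 1) * fps_nth (Abs_fps (\<lambda>j. int j + 1) ^ Suc p) (m - i))"
    by (subst power_Suc) (simp add: fps_mult_nth del: power_Suc)
  also have "\<dots> > 0"
    by (intro sum_pos mult_pos_pos Suc) auto
  finally show ?case .
qed simp

lemma bend_coeff_cluster: "W \<noteq> Diagonal \<Longrightarrow> bend_coeff W p m = int (nat p choose m)"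
  by (simp add: wall_series_def nth_one_plus_X_power)

text \<open>Bends with vanishing classical coefficient are excluded from broken lines. Their quantum
  weight vanishes too, so the expansion of a crossing loses nothing.\<close>

lemma bend_coeff_eq_0:
  assumes "p > 0" "bend_coeff W p m = 0"
  shows "bend_weight W (nat p) m = 0"
proof (cases "W = Diagonal")
  case True
  obtain q where "nat p = Suc q" using assms(1) by (metis Suc_pred zero_less_nat_eq)
  hence "bend_coeff W p m > 0"
    using True nth_diagonal_power_pos[of q m] by (simp add: wall_series_def del: power_Suc)
  with assms show ?thesis by simp
next
  case False
  thus ?thesis using assms by (simp add: bend_coeff_cluster bend_weight_def qbinom_def)
qed

lemma wvec_nz [simp]: "wvec W \<noteq> 0"
  by (cases W) auto

lemma fst_wvec_pos: "W \<in> scattering_diagram \<Longrightarrow> W \<noteq> Axis2 \<Longrightarrow> fst (wvec W) > 0"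
  by (auto simp: scattering_diagram_def)

lemma snd_wvec_le: "W \<in> scattering_diagram \<Longrightarrow> W \<noteq> Axis2 \<Longrightarrow> snd (wvec W) \<le> 2 * fst (wvec W)"
  by (auto simp: scattering_diagram_def)

section \<open>Expansion of ordered products into bend lists\<close>

definition wall_binom :: "wall \<Rightarrow> int \<Rightarrow> nat \<Rightarrow> qlaurent" where
  "wall_binom W = (if W = Diagonal then dcoeff else gbinom)"

definition wall_step :: "wall \<Rightarrow> family" where
  "wall_step W = crossing (pos_only (wall_binom W)) (wvec W) (if W = Axis2 then - 1 else 1)"

lemma wall_step_arg: "(if W = Axis2 then - 1 else 1) * cross (vec (wvec W)) b = pairing W b"
  by (cases W) (simp_all add: pairing_def cross_def)

lemma wall_binom_weight: "p > 0 \<Longrightarrow> wall_binom W p m = bend_weight W (nat p) m"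
  by (simp add: wall_binom_def bend_weight_gbinom bend_weight_dcoeff)

lemma before_irrefl [simp]: "\<not> before W W"
  by (simp add: before_def cross_def mult.commute)

lemma before_asym: "before W W' \<Longrightarrow> \<not> before W' W"
  by (auto simp: before_def cross_def algebra_simps)

lemma paths_Cons:
  fixes b s
  assumes W: "W \<in> scattering_diagram" and ws: "\<And>W'. W' \<in> S \<Longrightarrow> before W W'"
  defines "I \<equiv> {m. mul m (wvec W) \<le> s \<and> m \<ge> 1 \<and> pairing W b > 0 \<and> bend_coeff W (pairing W b) m \<noteq> 0}"
  shows "paths (insert W S) b s = paths S b s \<union>
     (\<Union>m\<in>I. (#) (W, m) ` paths S (shift b (mul m (wvec W))) (s - mul m (wvec W)))" (is "?L = ?R")
proof (intro equalityI subsetI)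
  fix L assume L: "L \<in> ?L"
  show "L \<in> ?R"
  proof (cases L)
    case Nil
    thus ?thesis using L by (auto simp: paths_def)
  next
    case (Cons x L')
    obtain V m where x: "x = (V, m)" by (cases x)
    have L': "bend_list (shift b (mul m (wvec V))) L'" "sorted_wrt before (map fst L')" "fst ` set L' \<subseteq> insert W S"
      and V: "\<And>U. U \<in> fst ` set L' \<Longrightarrow> before V U" "V \<in> insert W S"
      using L by (auto simp: paths_def Cons x)
    show ?thesis
    proof (cases "V = W")
      case True
      hence "fst ` set L' \<subseteq> S" using L' V(1) by force
      moreover have "m \<in> I" "offset L' = s - mul m (wvec W)"
        using L True by (auto simp: paths_def Cons x I_def)
      ultimately have "L' \<in> paths S (shift b (mul m (wvec W))) (s - mul m (wvec W))"
        using L' True by (auto simp: paths_def)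
      thus ?thesis using \<open>m \<in> I\<close> by (auto simp: Cons x True)
    next
      case False
      hence "before W V" using V ws by auto
      hence "W \<notin> fst ` set L'" using V(1) before_asym by blast
      hence "L \<in> paths S b s" using L False by (auto simp: paths_def Cons x)
      thus ?thesis by blast
    qed
  qed
next
  fix L assume "L \<in> ?R"
  thus "L \<in> ?L"
  proof
    assume "L \<in> paths S b s"
    thus ?thesis by (auto simp: paths_def)
  next
    assume "L \<in> (\<Union>m\<in>I. (#) (W, m) ` paths S (shift b (mul m (wvec W))) (s - mul m (wvec W)))"
    then obtain m L' where m: "m \<in> I" and L: "L = (W, m) # L'"
      and L': "L' \<in> paths S (shift b (mul m (wvec W))) (s - mul m (wvec W))" by blast
    have "mul m (wvec W) + (s - mul m (wvec W)) = s"
      using m by (intro pair_add_diff) (simp add: I_def)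
    thus ?thesis using m L' ws W by (auto simp: paths_def L I_def)
  qed
qed

text \<open>In the expansion of the first crossing, \<open>m = 0\<close> means that the list avoids
  \<open>W\<close>, and \<open>m > 0\<close> puts \<open>(W, m)\<close> at its head; by the order
  \<open>W\<close> can stand nowhere else.\<close>

lemma fprod_paths:
  assumes "sorted_wrt before ws" "set ws \<subseteq> scattering_diagram"
  shows "finite (paths (set ws) b s) \<and> fprod (map wall_step ws) fid b s = (\<Sum>L\<in>paths (set ws) b s. weight b L)"
  using assms
proof (induction ws arbitrary: b s)
  case Nil
  have "paths (set []) b s = (if s = 0 then {[]} else {})"
    by (auto simp: paths_def)
  thus ?case by (simp add: fid_def)
next
  case (Cons W ws)
  let ?p = "pairing W b"
  let ?P = "\<lambda>m. paths (set ws) (shift b (mul m (wvec W))) (s - mul m (wvec W))"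
  define I where "I = {m. mul m (wvec W) \<le> s \<and> m \<ge> 1 \<and> ?p > 0 \<and> bend_coeff W ?p m \<noteq> 0}"
  have W: "W \<in> scattering_diagram" and bef: "\<And>W'. W' \<in> set ws \<Longrightarrow> before W W'"
    using Cons.prems by auto
  have IH: "finite (paths (set ws) b s)" "fprod (map wall_step ws) fid b s = (\<Sum>L\<in>paths (set ws) b s. weight b L)" for b s
    using Cons.IH Cons.prems by simp_all
  have "I \<subseteq> {m. mul m (wvec W) \<le> s}" by (auto simp: I_def)
  hence finI: "finite I" by (rule finite_subset) simp
  have eq: "paths (set (W # ws)) b s = paths (set ws) b s \<union> (\<Union>m\<in>I. (#) (W, m) ` ?P m)"
    unfolding I_def list.set by (rule paths_Cons[OF W bef])
  have disj: "paths (set ws) b s \<inter> (\<Union>m\<in>I. (#) (W, m) ` ?P m) = {}"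
  proof -
    have "W \<notin> set ws" using bef before_irrefl by blast
    moreover have "W \<in> set ws" if L: "L \<in> paths (set ws) b s" "L \<in> (#) (W, m) ` ?P m" for L m
    proof -
      from L(2) obtain L' where L': "L = (W, m) # L'" by (rule imageE)
      have "fst ` set L \<subseteq> set ws" using L(1) by (simp only: paths_def mem_Collect_eq)
      thus ?thesis by (simp add: L')
    qed
    ultimately show ?thesis by blast
  qed
  have "(\<Sum>L\<in>paths (set (W # ws)) b s. weight b L)
      = (\<Sum>L\<in>paths (set ws) b s. weight b L) + (\<Sum>m\<in>I. \<Sum>L\<in>(#) (W, m) ` ?P m. weight b L)"
  proof -
    have fin: "finite (\<Union>m\<in>I. (#) (W, m) ` ?P m)"
      using finI IH(1) by (intro finite_UN_I finite_imageI)
    have "(\<Sum>L\<in>(\<Union>m\<in>I. (#) (W, m) ` ?P m). weight b L) = (\<Sum>m\<in>I. \<Sum>L\<in>(#) (W, m) ` ?P m. weight b L)"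
      by (rule sum.UNION_disjoint) (auto simp: finI IH(1))
    thus ?thesis unfolding eq by (simp only: sum.union_disjoint[OF IH(1) fin disj])
  qed
  also have "(\<Sum>m\<in>I. \<Sum>L\<in>(#) (W, m) ` ?P m. weight b L)
      = (\<Sum>m\<in>I. bend_weight W (nat ?p) m * fprod (map wall_step ws) fid (shift b (mul m (wvec W))) (s - mul m (wvec W)))"
    by (intro sum.cong refl, subst sum.reindex) (simp_all add: IH(2) sum_distrib_left)
  also have "\<dots> = (\<Sum>m\<in>{m. mul m (wvec W) \<le> s} - {0}.
      pos_only (wall_binom W) ?p m * fprod (map wall_step ws) fid (shift b (mul m (wvec W))) (s - mul m (wvec W)))"
  proof (rule sum.mono_neutral_cong_left)
    show "\<forall>m\<in>{m. mul m (wvec W) \<le> s} - {0} - I.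
      pos_only (wall_binom W) ?p m * fprod (map wall_step ws) fid (shift b (mul m (wvec W))) (s - mul m (wvec W)) = 0"
      by (auto simp: I_def pos_only_def wall_binom_weight bend_coeff_eq_0)
  qed (auto simp: I_def pos_only_def wall_binom_weight)
  also have "(\<Sum>L\<in>paths (set ws) b s. weight b L) = pos_only (wall_binom W) ?p 0 * fprod (map wall_step ws) fid (shift b (mul 0 (wvec W))) (s - mul 0 (wvec W))"
    by (simp add: pos_only_def IH)
  also have "\<dots> + (\<Sum>m\<in>{m. mul m (wvec W) \<le> s} - {0}.
      pos_only (wall_binom W) ?p m * fprod (map wall_step ws) fid (shift b (mul m (wvec W))) (s - mul m (wvec W)))
     = (\<Sum>m | mul m (wvec W) \<le> s. pos_only (wall_binom W) ?p m * fprod (map wall_step ws) fid (shift b (mul m (wvec W))) (s - mul m (wvec W)))"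
    by (subst sum.remove[OF finite_mul_le[OF wvec_nz], of 0]) (auto simp: less_eq_prod_def)
  also have "\<dots> = fprod (map wall_step (W # ws)) fid b s"
    unfolding list.map fprod_simps wall_step_def[of W] famc_crossing[OF wvec_nz] wall_step_arg ..
  finally show ?case unfolding eq using IH(1) finI by (intro conjI finite_UnI finite_UN_I finite_imageI) auto
qed

definition tail_walls :: "nat \<Rightarrow> wall list" where
  "tail_walls N = Axis1 # map Cluster1 [1..<Suc N] @ Diagonal # map Cluster2 (rev [1..<Suc N])"

lemma pos_prod_wall_data: "pos_prod (wall_data N) = fprod (map wall_step (Axis2 # tail_walls N)) fid"
proof -
  have 1: "[0..<Suc N] = 0 # [1..<Suc N]" by (simp add: upt_conv_Cons del: upt_Suc)
  show ?thesis
    unfolding pos_prod_def wall_data_def tail_walls_def 1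
    by (simp add: wall_step_def wall_binom_def comp_def del: upt_Suc)
qed

lemma sorted_tail_walls: "sorted_wrt before (Axis2 # tail_walls N)"
  by (auto simp: tail_walls_def sorted_wrt_append sorted_wrt_map sorted_wrt_rev rev_map[symmetric]
        before_def cross_def algebra_simps simp del: upt_Suc intro!: sorted_wrt_mono_rel[OF _ sorted_wrt_upt])

lemma set_tail_walls: "set (Axis2 # tail_walls N) \<subseteq> scattering_diagram"
  by (auto simp: tail_walls_def scattering_diagram_def)

lemma set_tail_walls_eq: "set (tail_walls N) = {Axis1, Diagonal} \<union> Cluster1 ` {1..N} \<union> Cluster2 ` {1..N}"
  by (auto simp: tail_walls_def)

text \<open>A bend adds at least one copy of its wall direction to the offset. So for a given offset
  finitely many walls matter, and a finite product represents the infinite diagram.\<close>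

lemma bend_list_walls:
  assumes "bend_list b L" "offset L \<le> (N, N)"
  shows "fst ` set L \<subseteq> set (Axis2 # tail_walls N)"
  using assms
proof (induction L arbitrary: b)
  case (Cons x L)
  obtain W m where x: "x = (W, m)" by (cases x)
  have "mul m (wvec W) + offset L \<le> (N, N)" "m \<ge> 1" "W \<in> scattering_diagram" using Cons.prems by (auto simp: x)
  moreover from this obtain m' where "m = Suc m'" by (cases m) auto
  ultimately have "fst (wvec W) \<le> N" "snd (wvec W) \<le> N" by (auto simp: less_eq_prod_def)
  hence "W \<in> set (Axis2 # tail_walls N)"
    using \<open>W \<in> scattering_diagram\<close> by (auto simp: scattering_diagram_def set_tail_walls_eq)
  moreover have "fst ` set L \<subseteq> set (Axis2 # tail_walls N)"
    using Cons.prems by (intro Cons.IH[of "shift b (mul m (wvec W))"]) (auto simp: x less_eq_prod_def)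
  ultimately show ?case by (auto simp: x)
qed simp

definition path_sum :: "int \<times> int \<Rightarrow> nat \<times> nat \<Rightarrow> qlaurent" where
  "path_sum b s = (\<Sum>L\<in>paths UNIV b s. weight b L)"

lemma paths_UNIV:
  assumes "fst s \<le> N" "snd s \<le> N"
  shows "paths UNIV b s = paths (set (Axis2 # tail_walls N)) b s"
proof -
  have "s \<le> (N, N)" using assms by (simp add: less_eq_prod_def)
  hence "fst ` set L \<subseteq> set (Axis2 # tail_walls N)" if "bend_list b L" "offset L = s" for L
    using bend_list_walls[OF that(1), of N] that(2) by blast
  thus ?thesis unfolding paths_def by blast
qed

lemma finite_paths: "finite (paths UNIV b s)"
  using fprod_paths[OF sorted_tail_walls set_tail_walls, of "fst s + snd s" b s]
    paths_UNIV[of s "fst s + snd s" b] by simp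

lemma pos_prod_wall_data_path_sum:
  assumes "fst s \<le> N" "snd s \<le> N"
  shows "pos_prod (wall_data N) b s = path_sum b s"
  using fprod_paths[OF sorted_tail_walls set_tail_walls, of N b s] paths_UNIV[OF assms, of b]
  by (simp add: pos_prod_wall_data path_sum_def)

lemma path_sum_swap:
  assumes "fst b > 0" "snd b > 0"
  shows "path_sum (prod.swap b) (prod.swap s) = path_sum b s"
  using pos_prod_swap[OF assms, of s "fst s + snd s"]
    pos_prod_wall_data_path_sum[of s "fst s + snd s" b] pos_prod_wall_data_path_sum[of "prod.swap s" "fst s + snd s" "prod.swap b"] by simp

lemma path_sum_0: "path_sum b 0 = 1"
proof -
  have "pos_prod (wall_data 0) b 0 = 1"
    unfolding pos_prod_wall_data by (rule fprod_at_0) (auto simp: wall_step_def crossing_0 pos_only_def)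
  thus ?thesis using pos_prod_wall_data_path_sum[of 0 0 b] by simp
qed

lemma paths_nonempty: "path_sum b s \<noteq> 0 \<Longrightarrow> paths UNIV b s \<noteq> {}"
  by (auto simp: path_sum_def)

section \<open>Support of the path sums\<close>

lemma cross_vec_add: "cross (vec (x + y)) a = cross (vec x) a + cross (vec y) a"
  "cross a (vec (x + y)) = cross a (vec x) + cross a (vec y)"
  by (simp_all add: cross_def algebra_simps)

lemma cross_vec_mul: "cross (vec (mul m x)) a = int m * cross (vec x) a" "cross a (vec (mul m x)) = int m * cross a (vec x)"
  by (simp_all add: cross_def algebra_simps)

lemma cross_shift: "cross a (shift b s) = cross a b + 2 * cross a (vec s)"
  by (simp add: cross_def algebra_simps)

lemma cross_offset_nonneg:
  assumes "\<And>W'. W' \<in> fst ` set L \<Longrightarrow> before W W'" "W \<noteq> Axis2"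
  shows "cross (wall_dir W) (vec (offset L)) \<ge> 0"
  using assms
proof (induction L)
  case (Cons x L)
  obtain V m where x: "x = (V, m)" by (cases x)
  have "cross (wall_dir W) (wall_dir V) > 0" using Cons.prems by (auto simp: x before_def)
  moreover have "cross (wall_dir W) (vec (offset L)) \<ge> 0" using Cons by auto
  ultimately show ?case by (simp add: x cross_vec_add cross_vec_mul vec_wvec)
qed (simp add: cross_def)

text \<open>With end exponent \<open>a\<close>, the left side is the sum over the bends of
  \<open>m\<close> times the cross product of the wall direction with \<open>a\<close>. That product
  is the positive pairing at the bend plus contributions of later walls, which are nonnegative
  because these lie counterclockwise. For offset \<open>(s, t)\<close> this reads
  \<open>a1 * t < a2 * s\<close>: the case distinction of the greedy recurrence.\<close>

lemma cross_offset_pos: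
  assumes "bend_list b L" "sorted_wrt before (map fst L)" "Axis2 \<notin> fst ` set L" "L \<noteq> []"
  shows "cross (vec (offset L)) (shift b (offset L)) > 0"
  using assms
proof (induction L arbitrary: b)
  case (Cons x L)
  obtain W m where x: "x = (W, m)" by (cases x)
  let ?c = "shift b (mul m (wvec W))"
  have W: "W \<noteq> Axis2" "m \<ge> 1" "pairing W b > 0" using Cons.prems by (auto simp: x)
  have a: "shift b (offset (x # L)) = shift ?c (offset L)" by (simp add: x shift_shift)
  have p: "cross (wall_dir W) ?c = pairing W b"
    using W by (simp add: pairing_def flip: vec_wvec)
  have "cross (wall_dir W) (vec (offset L)) \<ge> 0"
    using Cons.prems W by (intro cross_offset_nonneg) (auto simp: x)
  hence "cross (wall_dir W) (shift ?c (offset L)) > 0"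
    using p W by (simp add: cross_shift[of _ ?c])
  hence 1: "int m * cross (wall_dir W) (shift ?c (offset L)) > 0" using W by simp
  have 2: "cross (vec (offset L)) (shift ?c (offset L)) \<ge> 0"
  proof (cases "L = []")
    case False
    thus ?thesis using Cons.prems by (intro less_imp_le Cons.IH) (auto simp: x)
  qed (simp add: cross_def)
  have "cross (vec (offset (x # L))) (shift b (offset (x # L)))
     = int m * cross (wall_dir W) (shift ?c (offset L)) + cross (vec (offset L)) (shift ?c (offset L))"
    unfolding a by (simp add: x cross_vec_add cross_vec_mul vec_wvec)
  thus ?case using 1 2 by linarith
qed simp

text \<open>The steepest wall apart from \<open>Axis2\<close> is \<open>Cluster2 1\<close>, of
  direction (1, 2).\<close>

lemma snd_offset_le:
  assumes "bend_list b L" "Axis2 \<notin> fst ` set L"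
  shows "snd (offset L) \<le> 2 * fst (offset L)"
  using assms
proof (induction L arbitrary: b)
  case (Cons x L)
  obtain W m where x: "x = (W, m)" by (cases x)
  have "m * snd (wvec W) \<le> m * (2 * fst (wvec W))"
    using Cons.prems by (intro mult_le_mono2 snd_wvec_le) (auto simp: x)
  hence "m * snd (wvec W) \<le> 2 * (m * fst (wvec W))" by (simp only: mult.left_commute)
  moreover have "snd (offset L) \<le> 2 * fst (offset L)"
    using Cons.IH[of "shift b (mul m (wvec W))"] Cons.prems by (auto simp: x)
  ultimately show ?case unfolding x offset.simps fst_add snd_add mul_sel distrib_left by linarith
qed simp

lemma bend_list_snd_pos:
  assumes "bend_list b L" "Axis2 \<notin> fst ` set L" "L \<noteq> []" "fst b > 0"
  shows "snd b > 0"
proof -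
  obtain W m L' where L: "L = (W, m) # L'" using assms(3) by (metis list.exhaust prod.exhaust)
  have W: "W \<in> scattering_diagram" "W \<noteq> Axis2" "pairing W b > 0" using assms by (auto simp: L)
  have "int (fst (wvec W)) * snd b - int (snd (wvec W)) * fst b > 0"
    using W by (simp add: pairing_def cross_def flip: vec_wvec)
  moreover have "int (snd (wvec W)) * fst b \<ge> 0" using assms(4) by simp
  ultimately have "int (fst (wvec W)) * snd b > 0" by linarith
  thus ?thesis by (simp add: zero_less_mult_iff)
qed

lemma paths_cases:
  assumes "L \<in> paths UNIV b s"
  obtains "Axis2 \<notin> fst ` set L"
  | j L' where "L = (Axis2, j) # L'" "Axis2 \<notin> fst ` set L'"
proof (cases L)
  case Nil
  thus ?thesis using that(1) by simp
next
  case (Cons x L')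
  obtain W m where x: "x = (W, m)" by (cases x)
  have "\<And>V. V \<in> fst ` set L' \<Longrightarrow> before W V" using assms by (auto simp: paths_def Cons x)
  hence n: "Axis2 \<notin> fst ` set L'" by (auto simp: before_def)
  show ?thesis
  proof (cases "W = Axis2")
    case True
    thus ?thesis using that(2) n by (simp add: Cons x)
  next
    case False
    thus ?thesis using that(1) n by (simp add: Cons x)
  qed
qed

text \<open>\<open>Axis2\<close> occurs at most once, with multiplicity at most \<open>fst b\<close>
  because larger binomial coefficients vanish; the other bends have slope at most 2.\<close>

lemma paths_bound:
  assumes "L \<in> paths UNIV b s" "fst b > 0"
  shows "int (snd s) \<le> fst b + 2 * int (fst s)"
  using assms(1)
proof (cases rule: paths_cases)
  case 1
  thus ?thesis using assms snd_offset_le[of b L] by (auto simp: paths_def)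
next
  case (2 j L')
  have o: "bend_list b L" "offset L = s" using assms by (auto simp: paths_def)
  have "snd (offset L') \<le> 2 * fst (offset L')" using 2 o by (intro snd_offset_le) auto
  moreover have "bend_coeff Axis2 (pairing Axis2 b) j \<noteq> 0" using 2 o by auto
  hence "j \<le> nat (fst b)" by (simp add: bend_coeff_cluster pairing_def binomial_eq_0_iff)
  ultimately show ?thesis using o(2) assms(2) by (auto simp: 2)
qed

text \<open>For \<open>a = - m\<close> this is the negative of the terminal exponent
  \<open>m + 2 s\<close>: the exponent from which the backward reading starts.\<close>

definition start_exp :: "int \<times> int \<Rightarrow> nat \<times> nat \<Rightarrow> int \<times> int" where
  "start_exp a s = (fst a - 2 * int (fst s), snd a - 2 * int (snd s))"

lemma start_exp_sel [simp]: "fst (start_exp a s) = fst a - 2 * int (fst s)" "snd (start_exp a s) = snd a - 2 * int (snd s)"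
  by (simp_all add: start_exp_def)

lemma shift_start_exp [simp]: "shift (start_exp a s) s = a"
  by (simp add: shift_def start_exp_def)

lemma start_exp_swap: "start_exp (prod.swap a) (prod.swap s) = prod.swap (start_exp a s)"
  by (simp add: start_exp_def)

text \<open>When both components of \<open>start_exp a s\<close> are positive, the two path sums agree by consistency.\<close>

definition pcoeff :: "int \<times> int \<Rightarrow> nat \<times> nat \<Rightarrow> qlaurent" where
  "pcoeff a s = (if fst (start_exp a s) > 0 then path_sum (start_exp a s) s
            else if snd (start_exp a s) > 0 then path_sum (prod.swap (start_exp a s)) (prod.swap s)
            else if s = 0 then 1 else 0)"

lemma pcoeff_0: "pcoeff a 0 = 1"
  by (simp add: pcoeff_def path_sum_0)

lemma pcoeff_swap: "pcoeff (prod.swap a) (prod.swap s) = pcoeff a s"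
  by (auto simp: pcoeff_def start_exp_swap path_sum_swap simp del: start_exp_sel)

lemma gbinom_minus: "p > 0 \<Longrightarrow> gbinom (- p) k = (- 1) ^ k * qbinom 2 (nat p + k - 1) k"
  by (simp add: gbinom_def)

text \<open>Put \<open>p = fst a - 2 * int s\<close>. For \<open>p > 0\<close> the crossing of
  \<open>Axis2\<close> comes first and multiplies the series of a column by
  \<open>gbinom_fps p\<close>; the inverse \<open>gbinom_fps (- p)\<close> carries the signs and
  binomial coefficients of the recurrence. So the recurrence says that the part without a bend at
  \<open>Axis2\<close> vanishes, which is \<open>cross_offset_pos\<close>. For
  \<open>p \<le> 0\<close> both sides are 0.\<close>

lemma pcoeff_column:
  assumes st: "(s, t) \<noteq> (0, 0)" and le: "fst a * int t \<ge> snd a * int s"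
  shows "pcoeff a (s, t) = (\<Sum>k = 1..t. (- 1) ^ (k - 1) * pcoeff a (s, t - k) *
           qbinom 2 (nat (max (fst a - 2 * int s) 0) + k - 1) k)"
proof (cases "fst a - 2 * int s > 0")
  case False
  have z: "qbinom 2 (k - Suc 0) k = 0" if "k \<ge> 1" for k
    using that by (simp add: qbinom_def)
  have "pcoeff a (s, t) = 0"
  proof (rule ccontr)
    assume nz: "pcoeff a (s, t) \<noteq> 0"
    have *: "snd a - 2 * int t > 0" "path_sum (prod.swap (start_exp a (s, t))) (t, s) \<noteq> 0"
      using nz False st by (auto simp: pcoeff_def zero_prod_def split: if_splits)
    then obtain L where L: "L \<in> paths UNIV (prod.swap (start_exp a (s, t))) (t, s)"
      using paths_nonempty by blast
    hence o: "bend_list (prod.swap (start_exp a (s, t))) L" "offset L = (t, s)" by (auto simp: paths_def)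
    \<comment> \<open>In the reflected picture a list without \<open>Axis2\<close> would need a
      positive second component \<open>fst a - 2 * int s\<close> of the start exponent, and a bend
      at \<open>Axis2\<close> adds to \<open>s\<close>.\<close>
    have "s \<ge> 1"
      using L
    proof (cases rule: paths_cases)
      case 1
      have "L \<noteq> []" using o st by (auto simp: zero_prod_def)
      from bend_list_snd_pos[OF o(1) 1 this] show ?thesis using * False by simp
    next
      case (2 j L')
      hence "j \<ge> 1" using o by simp
      moreover have "snd (offset L) \<ge> j" by (simp add: 2)
      ultimately show ?thesis using o(2) by simp
    qed
    hence "int s * (snd a - 2 * int t) > 0" using * by simp
    moreover have "int t * (fst a - 2 * int s) \<le> 0" using False by (intro mult_nonneg_nonpos) auto
    ultimately show False using le by (simp add: algebra_simps)
  qed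
  thus ?thesis using False z by (simp add: max_def)
next
  case True
  define p where "p = fst a - 2 * int s"
  define N where "N = s + t"
  define R where "R = fprod (map wall_step (tail_walls N)) fid"
  \<comment> \<open>For fixed \<open>s\<close> the first component \<open>p\<close> of the start
    exponent does not depend on \<open>t\<close>, so the crossing of \<open>Axis2\<close> acts on
    these series by multiplication.\<close>
  define F where "F = Abs_fps (\<lambda>t. pos_prod (wall_data N) (start_exp a (s, t)) (s, t))"
  define G where "G = Abs_fps (\<lambda>t. R (start_exp a (s, t)) (s, t))"
  have "F = gbinom_fps p * G"
  proof (rule fps_ext)
    fix t
    have "fps_nth F t = (\<Sum>m | mul m (wvec Axis2) \<le> (s, t). pos_only gbinom p m *
        R (shift (start_exp a (s, t)) (mul m (wvec Axis2))) ((s, t) - mul m (wvec Axis2)))"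
      unfolding F_def pos_prod_wall_data R_def
      by (simp add: wall_step_def wall_binom_def famc_crossing cross_def p_def)
    also have "{m. mul m (wvec Axis2) \<le> (s, t)} = {..t}" by (auto simp: less_eq_prod_def)
    also have "(\<Sum>m\<le>t. pos_only gbinom p m * R (shift (start_exp a (s, t)) (mul m (wvec Axis2))) ((s, t) - mul m (wvec Axis2)))
       = (\<Sum>m\<le>t. gbinom p m * fps_nth G (t - m))"
    proof (intro sum.cong refl arg_cong2[where f = "(*)"])
      fix m assume m: "m \<in> {..t}"
      show "pos_only gbinom p m = gbinom p m" using True by (simp add: pos_only_def p_def)
      have "(s, t) - mul m (wvec Axis2) = (s, t - m)" "shift (start_exp a (s, t)) (mul m (wvec Axis2)) = start_exp a (s, t - m)"
        using m by (auto simp: prod_eq_iff of_nat_diff)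
      thus "R (shift (start_exp a (s, t)) (mul m (wvec Axis2))) ((s, t) - mul m (wvec Axis2)) = fps_nth G (t - m)"
        by (simp add: G_def)
    qed
    finally show "fps_nth F t = fps_nth (gbinom_fps p * G) t"
      by (simp add: fps_mult_nth atLeast0AtMost)
  qed
  hence "gbinom_fps (- p) * F = (gbinom_fps p * gbinom_fps (- p)) * G" by (simp add: mult_ac)
  hence GF: "gbinom_fps (- p) * F = G" by (simp add: gbinom_fps_inverse)
  have G0: "fps_nth G t = 0"
  proof (rule ccontr)
    assume "fps_nth G t \<noteq> 0"
    hence "R (start_exp a (s, t)) (s, t) \<noteq> 0" by (simp add: G_def)
    hence "paths (set (tail_walls N)) (start_exp a (s, t)) (s, t) \<noteq> {}"
      using fprod_paths[of "tail_walls N"] sorted_tail_walls[of N] set_tail_walls[of N] by (auto simp: R_def)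
    then obtain L where L: "bend_list (start_exp a (s, t)) L" "sorted_wrt before (map fst L)"
       "fst ` set L \<subseteq> set (tail_walls N)" "offset L = (s, t)"
      by (auto simp: paths_def)
    have "L \<noteq> []" using L(4) st by (auto simp: zero_prod_def)
    moreover have "Axis2 \<notin> fst ` set L" using L(3) by (auto simp: set_tail_walls_eq)
    ultimately have "cross (vec (s, t)) (shift (start_exp a (s, t)) (s, t)) > 0"
      using cross_offset_pos[OF L(1,2)] L(4) by simp
    thus False using le by (simp add: cross_def algebra_simps)
  qed
  \<comment> \<open>\<open>N = s + t\<close> bounds all offsets up to this index, so here the
    truncated product is the full path sum.\<close>
  have F: "fps_nth F (t - k) = pcoeff a (s, t - k)" if "k \<le> t" for k
    using True unfolding F_def by (simp add: pcoeff_def) (rule pos_prod_wall_data_path_sum, auto simp: N_def)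
  have "0 = (\<Sum>k\<le>t. gbinom (- p) k * pcoeff a (s, t - k))"
    using arg_cong[OF GF, of "\<lambda>f. fps_nth f t"] G0 F
    by (simp add: fps_mult_nth atLeast0AtMost)
  also have "\<dots> = pcoeff a (s, t) + (\<Sum>k = 1..t. gbinom (- p) k * pcoeff a (s, t - k))"
    by (subst atLeast0AtMost[symmetric], subst sum.atLeast_Suc_atMost) simp_all
  finally have "pcoeff a (s, t) = (\<Sum>k = 1..t. - (gbinom (- p) k * pcoeff a (s, t - k)))"
    by (simp add: sum_negf add_eq_0_iff2)
  also have "\<dots> = (\<Sum>k = 1..t. (- 1) ^ (k - 1) * pcoeff a (s, t - k) * qbinom 2 (nat p + k - 1) k)"
  proof (intro sum.cong refl)
    fix k assume "k \<in> {1..t}"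
    then obtain k' where "k = Suc k'" by (cases k) auto
    thus "- (gbinom (- p) k * pcoeff a (s, t - k)) = (- 1) ^ (k - 1) * pcoeff a (s, t - k) * qbinom 2 (nat p + k - 1) k"
      using True gbinom_minus[of p "Suc k'"] by (simp add: p_def)
  qed
  finally show ?thesis using True by (simp add: p_def max_def)
qed

text \<open>The recurrence in \<open>s\<close> is the one in \<open>t\<close> for the reflected
  data, by \<open>pcoeff_swap\<close>.\<close>

lemma greedy_coeffs_pcoeff: "greedy_coeffs a1 a2 (\<lambda>s t. pcoeff (a1, a2) (s, t))"
  unfolding greedy_coeffs_def
proof (intro conjI allI impI)
  show "pcoeff (a1, a2) (0, 0) = 1" using pcoeff_0 by (simp add: zero_prod_def)
next
  fix s t :: nat assume st: "(s, t) \<noteq> (0, 0)" and "a1 * int t \<le> a2 * int s"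
  thus "pcoeff (a1, a2) (s, t) = (\<Sum>k = 1..s. (- 1) ^ (k - 1) * pcoeff (a1, a2) (s - k, t) *
                      qbinom 2 (nat (max (a2 - 2 * int t) 0) + k - 1) k)"
    using pcoeff_column[of t s "(a2, a1)"] pcoeff_swap[of "(a1, a2)" "(_, _)"] by auto
next
  fix s t :: nat assume st: "(s, t) \<noteq> (0, 0)" and "a1 * int t \<ge> a2 * int s"
  thus "pcoeff (a1, a2) (s, t) = (\<Sum>k = 1..t. (- 1) ^ (k - 1) * pcoeff (a1, a2) (s, t - k) *
                      qbinom 2 (nat (max (a1 - 2 * int s) 0) + k - 1) k)"
    using pcoeff_column[of s t "(a1, a2)"] by simp
qed

text \<open>Both recurrences refer only to smaller \<open>s + t\<close>. Uniqueness is what gives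
  the definite description \<open>greedy_coeff\<close> its value.\<close>

lemma greedy_coeffs_unique:
  assumes e: "greedy_coeffs a1 a2 e" and f: "greedy_coeffs a1 a2 f"
  shows "e s t = f s t"
proof (induction "s + t" arbitrary: s t rule: less_induct)
  case less
  consider "(s, t) = (0, 0)" | "(s, t) \<noteq> (0, 0)" "a1 * int t \<le> a2 * int s" | "(s, t) \<noteq> (0, 0)" "a1 * int t \<ge> a2 * int s"
    by linarith
  thus ?case
  proof cases
    case 1
    thus ?thesis using e f by (simp add: greedy_coeffs_def)
  next
    case 2
    have "e s t = (\<Sum>k = 1..s. (- 1) ^ (k - 1) * e (s - k) t * qbinom 2 (nat (max (a2 - 2 * int t) 0) + k - 1) k)"
      "f s t = (\<Sum>k = 1..s. (- 1) ^ (k - 1) * f (s - k) t * qbinom 2 (nat (max (a2 - 2 * int t) 0) + k - 1) k)"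
      using e f 2 unfolding greedy_coeffs_def by blast+
    moreover have "e (s - k) t = f (s - k) t" if "k \<in> {1..s}" for k
      using that by (intro less) auto
    ultimately show ?thesis by simp
  next
    case 3
    have "e s t = (\<Sum>k = 1..t. (- 1) ^ (k - 1) * e s (t - k) * qbinom 2 (nat (max (a1 - 2 * int s) 0) + k - 1) k)"
      "f s t = (\<Sum>k = 1..t. (- 1) ^ (k - 1) * f s (t - k) * qbinom 2 (nat (max (a1 - 2 * int s) 0) + k - 1) k)"
      using e f 3 unfolding greedy_coeffs_def by blast+
    moreover have "e s (t - k) = f s (t - k)" if "k \<in> {1..t}" for k
      using that by (intro less) auto
    ultimately show ?thesis by simp
  qed
qed

lemma greedy_coeff_pcoeff: "greedy_coeff a1 a2 = (\<lambda>s t. pcoeff (a1, a2) (s, t))"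
  unfolding greedy_coeff_def
  by (rule the_equality[where P = "greedy_coeffs a1 a2"])
     (auto simp: greedy_coeffs_pcoeff fun_eq_iff intro: greedy_coeffs_unique)

text \<open>A crude box, symmetric under the exchange, that contains the support and serves as
  common index set of the two expansions.\<close>

definition obox :: "int \<times> int \<Rightarrow> (nat \<times> nat) set" where
  "obox a = {..nat (\<bar>fst a\<bar> + \<bar>snd a\<bar>)} \<times> {..nat (\<bar>fst a\<bar> + \<bar>snd a\<bar>)}"

lemma finite_obox [simp]: "finite (obox a)"
  by (simp add: obox_def)

lemma paths_in_obox:
  assumes "paths UNIV (start_exp a s) s \<noteq> {}" "fst (start_exp a s) > 0"
  shows "s \<in> obox a"
proof -
  obtain L where "L \<in> paths UNIV (start_exp a s) s" using assms by blast
  from paths_bound[OF this assms(2)] assms(2) show ?thesis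
    by (cases s) (auto simp: obox_def)
qed

lemma obox_swap: "prod.swap s \<in> obox (prod.swap a) \<longleftrightarrow> s \<in> obox a"
  by (cases s) (auto simp: obox_def add.commute)

lemma pcoeff_nz_in_obox:
  assumes "pcoeff a s \<noteq> 0"
  shows "s \<in> obox a"
proof -
  consider "fst (start_exp a s) > 0" "path_sum (start_exp a s) s \<noteq> 0"
    | "snd (start_exp a s) > 0" "path_sum (prod.swap (start_exp a s)) (prod.swap s) \<noteq> 0" | "s = 0"
    using assms unfolding pcoeff_def by (auto split: if_splits simp del: start_exp_sel)
  thus ?thesis
  proof cases
    case 1
    thus ?thesis using paths_in_obox paths_nonempty by blast
  next
    case 2
    hence "prod.swap s \<in> obox (prod.swap a)"
      using paths_nonempty by (intro paths_in_obox) (auto simp: start_exp_swap simp del: start_exp_sel)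
    thus ?thesis by (simp only: obox_swap)
  qed (auto simp: obox_def zero_prod_def)
qed

lemma scalar_0 [simp]: "scalar 0 = 0"
  by (simp add: scalar_def)

lemma greedy_elt_pcoeff:
  "greedy_elt (fst a) (snd a) = (\<Sum>s\<in>obox a. scalar (pcoeff a s) * Xmon (shift (- fst a, - snd a) s))"
proof -
  have "greedy_elt (fst a) (snd a) = (\<Sum>s | pcoeff a s \<noteq> 0. scalar (pcoeff a s) * Xmon (shift (- fst a, - snd a) s))"
    by (simp add: greedy_elt_def greedy_coeff_pcoeff case_prod_unfold shift_def)
  also have "\<dots> = (\<Sum>s\<in>obox a. scalar (pcoeff a s) * Xmon (shift (- fst a, - snd a) s))"
    by (rule sum.mono_neutral_left) (auto intro: pcoeff_nz_in_obox)
  finally show ?thesis .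
qed

section \<open>Broken lines\<close>

definition rcross :: "real \<times> real \<Rightarrow> real \<times> real \<Rightarrow> real" where
  "rcross P v = fst P * snd v - snd P * fst v"

lemma real_vec_sel [simp]: "fst (real_vec v) = of_int (fst v)" "snd (real_vec v) = of_int (snd v)"
  by (simp_all add: real_vec_def)

lemma rcross_add: "rcross (P + P') v = rcross P v + rcross P' v" "rcross P (v + v') = rcross P v + rcross P v'"
  by (simp_all add: rcross_def algebra_simps)

lemma rcross_scaleR: "rcross (c *\<^sub>R P) v = c * rcross P v" "rcross P (c *\<^sub>R v) = c * rcross P v"
  by (simp_all add: rcross_def algebra_simps)

lemma rcross_self [simp]: "rcross P P = 0"
  by (simp add: rcross_def)

lemma rcross_real_vec: "rcross (real_vec u) (real_vec v) = of_int (cross u v)"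
  by (simp add: rcross_def cross_def)

lemma real_vec_shift: "real_vec (shift v (mul k (wvec W))) = real_vec v + (2 * of_nat k) *\<^sub>R real_vec (wall_dir W)"
  by (simp add: real_vec_def shift_def scaleR_prod_def flip: vec_wvec)

lemma dot_wall_normal: "dot v (wall_normal W v) = \<bar>cross (wall_dir W) v\<bar>"
  by (auto simp: wall_normal_def Let_def dot_def cross_def algebra_simps)

lemma cross_wall_shift [simp]: "cross (wall_dir W) (shift v (mul k (wvec W))) = cross (wall_dir W) v"
  unfolding vec_wvec[symmetric] by simp

definition bend_at :: "real \<times> real \<Rightarrow> wall \<Rightarrow> nat \<Rightarrow> int \<times> int \<Rightarrow> int \<Rightarrow> int \<times> int \<Rightarrow> int \<Rightarrow> bool" where
  "bend_at P W k v c v' c' \<longleftrightarrow> W \<in> scattering_diagram \<and> P \<in> wall_support W \<and> cross (wall_dir W) v \<noteq> 0 \<and> k \<ge> 1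
     \<and> bend_coeff W \<bar>cross (wall_dir W) v\<bar> k \<noteq> 0 \<and> c' = c * bend_coeff W \<bar>cross (wall_dir W) v\<bar> k
     \<and> v' = shift v (mul k (wvec W))"

text \<open>\<open>is_broken_line\<close> with its components unbundled, an arbitrary end time
  \<open>T\<close> and no prescribed end point. In this form a broken line cut off at its last bend
  is of the same kind, which permits induction.\<close>

definition broken where
  "broken m T \<gamma> ts vs cs Ws ks \<longleftrightarrow>
     length vs = Suc (length ts) \<and> length cs = Suc (length ts) \<and> length Ws = length ts \<and> length ks = length ts \<and>
     vs ! 0 = m \<and> cs ! 0 = 1 \<and> sorted_wrt (<) ts \<and> (\<forall>x\<in>set ts. x < T) \<and>
     continuous_on {..T} \<gamma> \<and> (\<forall>x\<le>T. \<gamma> x \<noteq> 0) \<and>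
     (\<forall>i\<le>length ts. \<forall>x<T. (i > 0 \<longrightarrow> ts ! (i - 1) < x) \<longrightarrow> (i < length ts \<longrightarrow> x < ts ! i) \<longrightarrow>
        (\<gamma> has_vector_derivative - real_vec (vs ! i)) (at x)) \<and>
     (\<forall>i<length ts. bend_at (\<gamma> (ts ! i)) (Ws ! i) (ks ! i) (vs ! i) (cs ! i) (vs ! Suc i) (cs ! Suc i))"

lemma is_broken_line_broken:
  "is_broken_line m Q B \<longleftrightarrow> m \<noteq> 0 \<and> bl_path B \<in> extensional {..0} \<and> bl_path B 0 = Q \<and>
     broken m 0 (bl_path B) (bl_times B) (bl_exps B) (bl_coeffs B) (bl_walls B) (bl_mults B)"
proof -
  have *: "valid_bend B i \<longleftrightarrow> bend_at (bl_path B (bl_times B ! i)) (bl_walls B ! i) (bl_mults B ! i)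
      (bl_exps B ! i) (bl_coeffs B ! i) (bl_exps B ! Suc i) (bl_coeffs B ! Suc i)" for i
    unfolding valid_bend_def bend_at_def Let_def bend_pairing_def dot_wall_normal
    by (auto simp: shift_def simp flip: vec_wvec)
  show ?thesis
    unfolding is_broken_line_def broken_def Let_def * by blast
qed

lemma scaleR_has_vector_derivative: "((\<lambda>x. x *\<^sub>R w) has_vector_derivative w) (at y)"
  unfolding has_vector_derivative_def by (rule has_derivative_scaleR_left[OF has_derivative_ident])

text \<open>\<open>K\<close> takes up the end points of a segment, where the derivative is not
  prescribed.\<close>

lemma affine_of_derivative:
  fixes \<gamma> :: "real \<Rightarrow> real \<times> real"
  assumes "convex S" "finite K" "continuous_on S \<gamma>" "T \<in> S" "x \<in> S"
    and "\<And>x. x \<in> S - K \<Longrightarrow> (\<gamma> has_vector_derivative - w) (at x)"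
  shows "\<gamma> x = \<gamma> T + (T - x) *\<^sub>R w"
proof -
  have "\<gamma> x + x *\<^sub>R w = \<gamma> T + T *\<^sub>R w"
  proof (rule has_derivative_zero_unique_strong_convex[OF assms(1,2) _ assms(4) refl _ assms(5)])
    show "continuous_on S (\<lambda>x. \<gamma> x + x *\<^sub>R w)"
      using assms(3) by (intro continuous_intros)
    fix y assume "y \<in> S - K"
    from has_vector_derivative_add[OF assms(6)[OF this] scaleR_has_vector_derivative[of w]]
    have "((\<lambda>x. \<gamma> x + x *\<^sub>R w) has_vector_derivative 0) (at y)" by simp
    thus "((\<lambda>x. \<gamma> x + x *\<^sub>R w) has_derivative (\<lambda>h. 0)) (at y within S)"
      unfolding has_vector_derivative_def scaleR_zero_right by (rule has_derivative_at_withinI)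
  qed
  thus ?thesis by (simp add: algebra_simps)
qed

lemma affine_derivative:
  assumes "open S" "x \<in> S" "\<And>y. y \<in> S \<Longrightarrow> \<gamma> y = \<gamma> T + (T - y) *\<^sub>R w"
  shows "(\<gamma> has_vector_derivative - w) (at x)"
proof (rule has_vector_derivative_transform_within_open[OF _ assms(1,2)])
  have "(\<lambda>y. \<gamma> T + (T - y) *\<^sub>R w) = (\<lambda>y. (\<gamma> T + T *\<^sub>R w) - y *\<^sub>R w)"
    by (simp add: algebra_simps)
  thus "((\<lambda>y. \<gamma> T + (T - y) *\<^sub>R w) has_vector_derivative - w) (at x)"
    using has_vector_derivative_diff[OF has_vector_derivative_const scaleR_has_vector_derivative] by simp
qed (use assms(3) in auto)

text \<open>Kept folded in proofs: as a rewrite rule the equation would apply to its own right-hand side.\<close>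

definition straight :: "real set \<Rightarrow> (real \<Rightarrow> real \<times> real) \<Rightarrow> real \<Rightarrow> int \<times> int \<Rightarrow> bool" where
  "straight S \<gamma> T v \<longleftrightarrow> (\<forall>x\<in>S. \<gamma> x = \<gamma> T + (T - x) *\<^sub>R real_vec v)"

lemma straightD: "straight S \<gamma> T v \<Longrightarrow> x \<in> S \<Longrightarrow> \<gamma> x = \<gamma> T + (T - x) *\<^sub>R real_vec v"
  unfolding straight_def by blast

lemma straight_continuous:
  assumes "straight S \<gamma> T v"
  shows "continuous_on S \<gamma>"
proof -
  have "continuous_on S \<gamma> \<longleftrightarrow> continuous_on S (\<lambda>x. \<gamma> T + (T - x) *\<^sub>R real_vec v)"
    using assms by (intro continuous_on_cong) (auto simp only: straight_def)
  moreover have "continuous_on S (\<lambda>x. \<gamma> T + (T - x) *\<^sub>R real_vec v)"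
    by (intro continuous_intros)
  ultimately show ?thesis by blast
qed

lemma straight_derivative:
  assumes "straight S \<gamma> T v" "open S'" "x \<in> S'" "S' \<subseteq> S"
  shows "(\<gamma> has_vector_derivative - real_vec v) (at x)"
  by (rule affine_derivative[OF assms(2,3), of _ T]) (use assms(1,4) in \<open>unfold straight_def, blast\<close>)

lemma broken_Nil:
  "broken m T \<gamma> [] [v] [c] [] [] \<longleftrightarrow> v = m \<and> c = 1 \<and> straight {..T} \<gamma> T v \<and> (\<forall>x\<le>T. \<gamma> x \<noteq> 0)"
  (is "?L \<longleftrightarrow> ?R")
proof
  assume L: ?L
  have "straight {..T} \<gamma> T v"
    unfolding straight_def
  proof
    fix x assume x: "x \<in> {..T}"
    show "\<gamma> x = \<gamma> T + (T - x) *\<^sub>R real_vec v"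
    proof (rule affine_of_derivative[of "{..T}" "{T}"])
      show "(\<gamma> has_vector_derivative - real_vec v) (at y)" if "y \<in> {..T} - {T}" for y
        using L that by (auto simp: broken_def)
      show "continuous_on {..T} \<gamma>" using L unfolding broken_def by simp
    qed (use x in auto)
  qed
  thus ?R using L by (simp add: broken_def)
next
  assume R: ?R
  hence S: "straight {..T} \<gamma> T v" by blast
  have "(\<gamma> has_vector_derivative - real_vec v) (at x)" if "x < T" for x
    by (rule straight_derivative[OF S, of "{..<T}"]) (use that in auto)
  thus ?L using R straight_continuous[OF S] by (simp add: broken_def)
qed

lemma broken_snoc:
  assumes len: "length vs = Suc (length ts)" "length cs = Suc (length ts)" "length Ws = length ts" "length ks = length ts"
  shows "broken m T \<gamma> (ts @ [t]) (vs @ [v]) (cs @ [c]) (Ws @ [W]) (ks @ [k]) \<longleftrightarrow>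
     t < T \<and> broken m t \<gamma> ts vs cs Ws ks \<and> bend_at (\<gamma> t) W k (last vs) (last cs) v c \<and>
     straight {t..T} \<gamma> T v \<and> (\<forall>x\<in>{t..T}. \<gamma> x \<noteq> 0)"
  (is "?L \<longleftrightarrow> ?R")
proof -
  let ?n = "length ts"
  have nth: "(vs @ [v]) ! i = vs ! i" "(cs @ [c]) ! i = cs ! i" if "i \<le> ?n" for i
    using that len by (auto simp: nth_append)
  have nth': "(ts @ [t]) ! i = ts ! i" "(Ws @ [W]) ! i = Ws ! i" "(ks @ [k]) ! i = ks ! i" if "i < ?n" for i
    using that len by (auto simp: nth_append)
  have nth1: "(vs @ [v]) ! Suc ?n = v" "(cs @ [c]) ! Suc ?n = c" "(ts @ [t]) ! ?n = t" "(Ws @ [W]) ! ?n = W" "(ks @ [k]) ! ?n = k"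
    "vs ! ?n = last vs" "cs ! ?n = last cs"
    using len by (auto simp: nth_append last_conv_nth) (metis Suc_neq_Zero diff_Suc_1 last_conv_nth list.size(3))+
  have bends: "(\<forall>i<Suc ?n. bend_at (\<gamma> ((ts @ [t]) ! i)) ((Ws @ [W]) ! i) ((ks @ [k]) ! i) ((vs @ [v]) ! i) ((cs @ [c]) ! i) ((vs @ [v]) ! Suc i) ((cs @ [c]) ! Suc i))
     \<longleftrightarrow> (\<forall>i<?n. bend_at (\<gamma> (ts ! i)) (Ws ! i) (ks ! i) (vs ! i) (cs ! i) (vs ! Suc i) (cs ! Suc i)) \<and> bend_at (\<gamma> t) W k (last vs) (last cs) v c"
    unfolding All_less_Suc by (auto simp: nth nth' nth1)
  let ?D = "\<lambda>i x. (\<gamma> has_vector_derivative - real_vec ((vs @ [v]) ! i)) (at x)"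
  show ?thesis
  proof
    assume L: ?L
    have ts: "\<forall>x\<in>set ts. x < t" "sorted_wrt (<) ts" and tT: "t < T"
      using L by (auto simp: broken_def sorted_wrt_append)
    have d: "?D i x" if "i \<le> Suc ?n" "x < T" "i > 0 \<Longrightarrow> (ts @ [t]) ! (i - 1) < x" "i < Suc ?n \<Longrightarrow> x < (ts @ [t]) ! i" for i x
      using L that by (auto simp: broken_def)
    have cont: "continuous_on {..T} \<gamma>" and nz: "\<forall>x\<le>T. \<gamma> x \<noteq> 0" using L by (auto simp: broken_def)
    have "\<gamma> x = \<gamma> T + (T - x) *\<^sub>R real_vec v" if "x \<in> {t..T}" for x
    proof (rule affine_of_derivative[of "{t..T}" "{t, T}"])
      show "continuous_on {t..T} \<gamma>" using cont by (rule continuous_on_subset) auto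
      show "(\<gamma> has_vector_derivative - real_vec v) (at x)" if "x \<in> {t..T} - {t, T}" for x
        using d[of "Suc ?n" x] that by (simp add: nth1)
    qed (use that tT in auto)
    hence "straight {t..T} \<gamma> T v" unfolding straight_def by blast
    moreover have "broken m t \<gamma> ts vs cs Ws ks"
      unfolding broken_def
    proof (intro conjI allI impI)
      show "continuous_on {..t} \<gamma>" using cont by (rule continuous_on_subset) (use tT in auto)
      show "(\<gamma> has_vector_derivative - real_vec (vs ! i)) (at x)"
        if "i \<le> ?n" "x < t" "i > 0 \<longrightarrow> ts ! (i - 1) < x" "i < ?n \<longrightarrow> x < ts ! i" for i x
      proof -
        have "x < (ts @ [t]) ! i" using that nth1 nth' by (cases "i = ?n") auto
        moreover have "(ts @ [t]) ! (i - 1) < x" if "i > 0"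
          using that \<open>i \<le> ?n\<close> \<open>i > 0 \<longrightarrow> ts ! (i - 1) < x\<close> nth'(1)[of "i - 1"] by auto
        ultimately have "?D i x" using that tT by (intro d) auto
        thus ?thesis using that nth by simp
      qed
      show "\<gamma> x \<noteq> 0" if "x \<le> t" for x using that nz tT by auto
      show "vs ! 0 = m" "cs ! 0 = 1" using L nth[of 0] by (auto simp: broken_def)
    qed (use L len ts bends in \<open>auto simp: broken_def\<close>)
    ultimately show ?R using L bends nz tT by (auto simp: broken_def)
  next
    assume R: ?R
    hence B: "broken m t \<gamma> ts vs cs Ws ks" and tT: "t < T" and aff: "straight {t..T} \<gamma> T v"
      by auto
    show ?L
      unfolding broken_def
    proof (intro conjI allI impI)
      have "continuous_on {t..T} \<gamma>" by (rule straight_continuous[OF aff])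
      hence "continuous_on ({..t} \<union> {t..T}) \<gamma>"
        using B by (intro continuous_on_closed_Un) (auto simp: broken_def)
      moreover have "{..t} \<union> {t..T} = {..T}" using tT by auto
      ultimately show "continuous_on {..T} \<gamma>" by simp
      show "\<gamma> x \<noteq> 0" if "x \<le> T" for x
        using R that by (cases "x \<le> t") (auto simp: broken_def)
      show "?D i x" if i: "i \<le> length (ts @ [t])" "x < T" "i > 0 \<longrightarrow> (ts @ [t]) ! (i - 1) < x"
        "i < length (ts @ [t]) \<longrightarrow> x < (ts @ [t]) ! i" for i x
      proof (cases "i \<le> ?n")
        case True
        have lt: "x < (ts @ [t]) ! i" using True i by simp
        have "x < t"
        proof (cases "i < ?n")
          case True
          hence "x < ts ! i" "ts ! i < t" using lt nth' B by (auto simp: broken_def)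
          thus ?thesis by simp
        qed (use lt True nth1 in auto)
        moreover have "i > 0 \<longrightarrow> ts ! (i - 1) < x" using i True nth'(1)[of "i - 1"] by auto
        moreover have "i < ?n \<longrightarrow> x < ts ! i" using lt nth' by auto
        ultimately have "(\<gamma> has_vector_derivative - real_vec (vs ! i)) (at x)"
          using B True unfolding broken_def by blast
        thus ?thesis using True nth by simp
      next
        case False
        hence "i = Suc ?n" using i by simp
        hence "t < x" using i nth1 by simp
        hence "(\<gamma> has_vector_derivative - real_vec v) (at x)"
          by (intro straight_derivative[OF aff, of "{t<..<T}"]) (use i in auto)
        thus ?thesis using \<open>i = Suc ?n\<close> nth1 by simp
      qed
      show "sorted_wrt (<) (ts @ [t])" using B by (auto simp: broken_def sorted_wrt_append)
      show "\<forall>x\<in>set (ts @ [t]). x < T" using B tT by (force simp: broken_def)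
      show "(vs @ [v]) ! 0 = m" "(cs @ [c]) ! 0 = 1" using B nth[of 0] by (auto simp: broken_def)
      show "bend_at (\<gamma> ((ts @ [t]) ! i)) ((Ws @ [W]) ! i) ((ks @ [k]) ! i) ((vs @ [v]) ! i) ((cs @ [c]) ! i) ((vs @ [v]) ! Suc i) ((cs @ [c]) ! Suc i)"
        if "i < length (ts @ [t])" for i
        using that bends R by (auto simp: broken_def)
    qed (use len in auto)
  qed
qed

lemma broken_lengths:
  "broken m T \<gamma> ts vs cs Ws ks \<Longrightarrow> length vs = Suc (length ts) \<and> length cs = Suc (length ts) \<and> length Ws = length ts \<and> length ks = length ts"
  by (simp add: broken_def)

lemma broken_induct [consumes 1, case_names Nil snoc]:
  assumes "broken m T \<gamma> ts vs cs Ws ks"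
    and Nil: "\<And>T v c. broken m T \<gamma> [] [v] [c] [] [] \<Longrightarrow> R T [] [v] [c] [] []"
    and snoc: "\<And>T ts t vs v cs c Ws W ks k. t < T \<Longrightarrow> broken m t \<gamma> ts vs cs Ws ks \<Longrightarrow>
       bend_at (\<gamma> t) W k (last vs) (last cs) v c \<Longrightarrow> straight {t..T} \<gamma> T v \<Longrightarrow>
       length Ws = length ks \<Longrightarrow> R t ts vs cs Ws ks \<Longrightarrow>
       R T (ts @ [t]) (vs @ [v]) (cs @ [c]) (Ws @ [W]) (ks @ [k])"
  shows "R T ts vs cs Ws ks"
  using assms(1)
proof (induction ts arbitrary: T vs cs Ws ks rule: rev_induct)
  case Nil
  hence "length vs = Suc 0" "length cs = Suc 0" "Ws = []" "ks = []" using broken_lengths by fastforce+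
  then obtain v c where "vs = [v]" "cs = [c]" by (metis length_0_conv length_Suc_conv)
  thus ?case using Nil \<open>Ws = []\<close> \<open>ks = []\<close> assms(2) by simp
next
  case (snoc t ts)
  have len: "length vs = Suc (Suc (length ts))" "length cs = Suc (Suc (length ts))" "length Ws = Suc (length ts)" "length ks = Suc (length ts)"
    using broken_lengths[OF snoc.prems] by simp_all
  have "vs \<noteq> []" "cs \<noteq> []" "Ws \<noteq> []" "ks \<noteq> []" using len by auto
  then obtain vs' v cs' c Ws' W ks' k where e: "vs = vs' @ [v]" "cs = cs' @ [c]" "Ws = Ws' @ [W]" "ks = ks' @ [k]"
    by (metis append_butlast_last_id)
  have B: "t < T" "broken m t \<gamma> ts vs' cs' Ws' ks'" "bend_at (\<gamma> t) W k (last vs') (last cs') v c"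
    "straight {t..T} \<gamma> T v"
    using snoc.prems len broken_snoc[of vs' ts cs' Ws' ks' m T \<gamma> t v c W k] unfolding e by auto
  show ?case unfolding e
    by (rule assms(3)[OF B(1-4) _ snoc.IH[OF B(2)]]) (use len e in auto)
qed

lemma broken_snocE:
  assumes "broken m T \<gamma> ts vs cs (Ws @ [W]) (ks @ [k])"
  obtains ts' t vs' v cs' c where "ts = ts' @ [t]" "vs = vs' @ [v]" "cs = cs' @ [c]"
    "t < T" "broken m t \<gamma> ts' vs' cs' Ws ks" "bend_at (\<gamma> t) W k (last vs') (last cs') v c" "straight {t..T} \<gamma> T v"
proof -
  have len: "length vs = Suc (length ts)" "length cs = Suc (length ts)" "length ts = Suc (length Ws)" "length ks = length Ws"
    using broken_lengths[OF assms] by simp_all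
  obtain ts' t where 1: "ts = ts' @ [t]" using len by (cases ts rule: rev_cases) auto
  obtain vs' v where 2: "vs = vs' @ [v]" using len by (cases vs rule: rev_cases) auto
  obtain cs' c where 3: "cs = cs' @ [c]" using len by (cases cs rule: rev_cases) auto
  have B: "broken m T \<gamma> (ts' @ [t]) (vs' @ [v]) (cs' @ [c]) (Ws @ [W]) (ks @ [k])"
    using assms by (simp only: 1 2 3)
  have l: "length vs' = Suc (length ts')" "length cs' = Suc (length ts')" "length Ws = length ts'" "length ks = length ts'"
    using len by (simp_all add: 1 2 3)
  from iffD1[OF broken_snoc[OF l] B] show ?thesis by (elim conjE) (rule that[OF 1 2 3])
qed

lemma broken_nonzero: "broken m T \<gamma> ts vs cs Ws ks \<Longrightarrow> x \<le> T \<Longrightarrow> \<gamma> x \<noteq> 0"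
  by (simp add: broken_def)

text \<open>Only times up to \<open>T\<close> matter, so a path can be restricted to them or
  continued by a further segment.\<close>

lemma broken_cong:
  assumes "broken m T \<gamma> ts vs cs Ws ks" "\<And>x. x \<le> T \<Longrightarrow> \<gamma> x = \<gamma>' x"
  shows "broken m T \<gamma>' ts vs cs Ws ks"
proof -
  have cong: "continuous_on {..T} \<gamma> \<longleftrightarrow> continuous_on {..T} \<gamma>'"
    using assms(2) by (intro continuous_on_cong) auto
  have der: "(\<gamma>' has_vector_derivative w) (at x)" if "(\<gamma> has_vector_derivative w) (at x)" "x < T" for w x
    by (rule has_vector_derivative_transform_within_open[OF that(1), of "{..<T}"]) (use that(2) assms(2) in auto)
  have lt: "ts ! i \<le> T" if "i < length ts" for i
  proof -
    have "\<forall>x\<in>set ts. x < T" using assms(1) unfolding broken_def by blast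
    thus ?thesis using nth_mem[OF that] by (blast intro: less_imp_le)
  qed
  show ?thesis
  proof (unfold broken_def, intro conjI allI impI)
    show "continuous_on {..T} \<gamma>'" using assms(1) cong unfolding broken_def by blast
    show "\<gamma>' x \<noteq> 0" if "x \<le> T" for x
      using assms(2)[OF that] broken_nonzero[OF assms(1) that] by metis
    show "(\<gamma>' has_vector_derivative - real_vec (vs ! i)) (at x)"
      if "i \<le> length ts" "x < T" "i > 0 \<longrightarrow> ts ! (i - 1) < x" "i < length ts \<longrightarrow> x < ts ! i" for i x
      by (rule der[OF _ that(2)]) (use assms(1) that in \<open>unfold broken_def, blast\<close>)
    show "bend_at (\<gamma>' (ts ! i)) (Ws ! i) (ks ! i) (vs ! i) (cs ! i) (vs ! Suc i) (cs ! Suc i)" if "i < length ts" for i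
    proof -
      have "bend_at (\<gamma> (ts ! i)) (Ws ! i) (ks ! i) (vs ! i) (cs ! i) (vs ! Suc i) (cs ! Suc i)"
        using assms(1) that unfolding broken_def by blast
      thus ?thesis by (simp only: assms(2)[OF lt[OF that]])
    qed
  qed (use assms(1) in \<open>auto simp: broken_def\<close>)
qed

text \<open>Where a broken line that ends in the first quadrant and has positive angular momentum may be:
  at its end point (\<open>None\<close>) or on a wall.\<close>

definition region :: "wall option \<Rightarrow> real \<times> real \<Rightarrow> bool" where
  "region st P \<longleftrightarrow> (case st of None \<Rightarrow> fst P > 0 \<and> snd P > 0
     | Some W \<Rightarrow> W \<in> scattering_diagram \<and> (if W = Axis2 then fst P = 0 \<and> snd P > 0 else \<exists>c<0. P = c *\<^sub>R real_vec (wall_dir W)))"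

lemma wall_dir_pos:
  assumes "W \<in> scattering_diagram" "W \<noteq> Axis2"
  shows "fst (wall_dir W) > 0" "snd (wall_dir W) \<ge> 0"
  using assms fst_wvec_pos[OF assms] by (simp_all flip: vec_wvec)

lemma region_other:
  assumes "region (Some W) P" "W \<noteq> Axis2"
  shows "fst P < 0" "snd P \<le> 0"
proof -
  obtain c where c: "c < 0" "P = c *\<^sub>R real_vec (wall_dir W)" and W: "W \<in> scattering_diagram"
    using assms by (auto simp: region_def)
  note d = wall_dir_pos[OF W assms(2)]
  have "fst P = c * of_int (fst (wall_dir W))" "snd P = c * of_int (snd (wall_dir W))"
    by (simp_all add: c(2))
  thus "fst P < 0" "snd P \<le> 0"
    using d c(1) by (simp_all add: mult_neg_pos mult_nonpos_nonneg)
qed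

text \<open>The cross product of position and exponent is constant along a broken line, because the exponent
  jumps by a multiple of the wall direction.  Hence a broken line turns around the origin in
  one direction.\<close>

lemma bend_region:
  fixes P P' :: "real \<times> real"
  assumes dl: "\<Delta> > 0" and P': "P' = P + \<Delta> *\<^sub>R real_vec v" and W: "W \<in> scattering_diagram"
    and sup: "P' \<in> wall_support W" and nz: "P' \<noteq> 0" and lam: "rcross P (real_vec v) > 0"
    and reg: "region st P" and st: "st \<noteq> None \<Longrightarrow> fst v < 0"
  shows "fst v < 0 \<and> region (Some W) P' \<and> pairing W (- v) > 0 \<and> (\<forall>W0. st = Some W0 \<longrightarrow> before W0 W)"
proof -
  define v1 v2 where "v1 = real_of_int (fst v)" and "v2 = real_of_int (snd v)"
  have f: "fst P' = fst P + \<Delta> * v1" "snd P' = snd P + \<Delta> * v2"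
    by (simp_all add: P' v1_def v2_def)
  have lam0: "fst P * v2 - snd P * v1 > 0" using lam by (simp add: rcross_def v1_def v2_def)
  have "rcross P' (real_vec v) > 0" using lam by (simp add: P' rcross_add rcross_scaleR)
  hence lam': "fst P' * v2 - snd P' * v1 > 0" by (simp add: rcross_def v1_def v2_def)
  have st': "v1 < 0" if "st \<noteq> None" using st[OF that] by (simp add: v1_def)
  have st_cases: "st = None \<and> fst P > 0 \<and> snd P > 0 \<or> st = Some Axis2 \<and> fst P = 0 \<and> snd P > 0 \<or>
     (\<exists>W0. st = Some W0 \<and> W0 \<noteq> Axis2 \<and> fst P < 0 \<and> snd P \<le> 0)"
  proof (cases st)
    case None
    thus ?thesis using reg by (simp add: region_def)
  next
    case (Some W0)
    show ?thesis
    proof (cases "W0 = Axis2")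
      case True
      thus ?thesis using reg Some by (simp add: region_def)
    next
      case False
      thus ?thesis using reg Some region_other[of W0 P] by blast
    qed
  qed
  have sgn: "\<Delta> * x < 0 \<longleftrightarrow> x < 0" for x using dl by (simp add: mult_less_0_iff)
  consider "W = Axis2" | "W = Axis1" | "W \<noteq> Axis1" "W \<noteq> Axis2" by blast
  thus ?thesis
  proof cases
    case 1
    have P0: "fst P' = 0" using sup by (auto simp: 1 wall_support_def)
    \<comment> \<open>Once on a wall, the path followed backwards has \<open>fst P \<le> 0\<close>
      and moves left, so it never returns to the vertical axis.\<close>
    have none: "st = None"
    proof (rule ccontr)
      assume "st \<noteq> None"
      hence "v1 < 0" by (rule st')
      hence "\<Delta> * v1 < 0" using sgn by blast
      moreover have "fst P \<le> 0" using st_cases \<open>st \<noteq> None\<close> by auto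
      ultimately show False using P0 f(1) by linarith
    qed
    hence "fst P > 0" using st_cases by auto
    hence "\<Delta> * v1 < 0" using P0 f(1) by linarith
    hence v1: "v1 < 0" using sgn by blast
    have "snd P' * v1 < 0" using lam' unfolding P0 by simp
    hence "snd P' > 0" using v1 by (auto simp: mult_less_0_iff)
    thus ?thesis using P0 none v1 by (simp add: 1 region_def pairing_def v1_def scattering_diagram_def)
  next
    case 2
    obtain c where c: "P' = c *\<^sub>R real_vec (1, 0)" using sup by (auto simp: 2 wall_support_def)
    hence P0: "snd P' = 0" "fst P' = c" by simp_all
    \<comment> \<open>From above the horizontal axis, positive angular momentum forces the negative
      half to be hit. From a wall with \<open>snd P \<le> 0\<close> the path would end strictly
      below the axis.\<close>
    have v2: "v2 < 0 \<and> c < 0 \<and> v1 < 0 \<and> (st = None \<or> st = Some Axis2)"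
    proof (cases "snd P > 0")
      case True
      hence "\<Delta> * v2 < 0" using P0 f by simp
      hence v2: "v2 < 0" using sgn by blast
      hence c: "c < 0" using lam' P0 by (simp add: zero_less_mult_iff)
      have "v1 < 0"
      proof (cases "st = None")
        case True
        hence "fst P * v2 < 0" using st_cases v2 by (auto simp: mult_pos_neg)
        hence "snd P * v1 < 0" using lam0 by simp
        thus ?thesis using \<open>snd P > 0\<close> by (simp add: mult_less_0_iff)
      qed (rule st')
      thus ?thesis using v2 c True st_cases by auto
    next
      case False
      hence *: "st \<noteq> None" "fst P < 0" "snd P \<le> 0" using st_cases by auto
      hence "\<Delta> * v1 < 0" using st' sgn by blast
      hence "c < 0" using * P0 f by simp
      hence "v2 < 0" using lam' P0 by (simp add: zero_less_mult_iff)
      hence "\<Delta> * v2 < 0" using sgn by blast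
      hence "snd P' < 0" using * f by simp
      thus ?thesis using P0 by simp
    qed
    have "region (Some W) P'" using c v2 W by (auto simp: region_def 2)
    moreover have "pairing W (- v) > 0" using v2 by (simp add: pairing_def 2 cross_def v2_def)
    ultimately show ?thesis using v2 by (auto simp: v1_def before_def 2)
  next
    case 3
    obtain c where c: "P' = c *\<^sub>R real_vec (wall_dir W)" "c \<le> 0" using sup 3 by (auto simp: wall_support_def)
    have c0: "c < 0" using c nz by (cases "c = 0") auto
    have reg': "region (Some W) P'" using c c0 W 3 by (auto simp: region_def)
    have "rcross P' (real_vec v) = c * of_int (cross (wall_dir W) v)"
      by (simp add: c(1) rcross_scaleR rcross_real_vec)
    hence "c * of_int (cross (wall_dir W) v) > 0" using lam' by (simp add: rcross_def v1_def v2_def)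
    hence "cross (wall_dir W) v < 0" using c0 by (simp add: zero_less_mult_iff)
    hence pairing: "pairing W (- v) > 0" using 3 by (simp add: pairing_def cross_def)
    have v1: "v1 < 0"
    proof (cases "st = None")
      case True
      hence "fst P > 0" using st_cases by auto
      moreover have "fst P' < 0" using region_other[OF reg'] 3 by blast
      ultimately have "\<Delta> * v1 < 0" using f by simp
      thus ?thesis using sgn by blast
    qed (rule st')
    have "before W0 W" if W0: "st = Some W0" for W0
    proof (cases "W0 = Axis2")
      case True
      thus ?thesis using 3 by (simp add: before_def)
    next
      case False
      then obtain c' where c': "c' < 0" "P = c' *\<^sub>R real_vec (wall_dir W0)" using reg W0 by (auto simp: region_def)
      \<comment> \<open>Positive angular momentum puts \<open>P'\<close> counterclockwise of
        \<open>P\<close>. Both are negative multiples of their wall directions, so the two signs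
        cancel.\<close>
      have "rcross P P' = \<Delta> * rcross P (real_vec v)" by (simp add: P' rcross_add rcross_scaleR)
      hence "rcross P P' > 0" using dl lam by simp
      moreover have "rcross P P' = c' * c * of_int (cross (wall_dir W0) (wall_dir W))"
        by (simp add: c(1) c'(2) rcross_scaleR rcross_real_vec)
      moreover have "c' * c > 0" using c0 c'(1) by (rule mult_neg_neg[rotated])
      ultimately have "cross (wall_dir W0) (wall_dir W) > 0" by (simp add: zero_less_mult_iff)
      thus ?thesis using 3 by (simp add: before_def)
    qed
    thus ?thesis using v1 reg' pairing by (simp add: v1_def)
  qed
qed

lemma before_trans:
  assumes "before U V" "before V W" "V \<in> scattering_diagram" "W \<in> scattering_diagram" "U \<in> scattering_diagram"
  shows "before U W"
proof (cases "U = Axis2")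
  case True
  thus ?thesis using assms by (simp add: before_def)
next
  case False
  hence c: "cross (wall_dir U) (wall_dir V) > 0" "cross (wall_dir V) (wall_dir W) > 0" and n: "V \<noteq> Axis2" "W \<noteq> Axis2"
    using assms by (auto simp: before_def)
  note p = wall_dir_pos[OF assms(3) n(1)] wall_dir_pos[OF assms(4) n(2)] wall_dir_pos[OF assms(5) False]
  have "fst (wall_dir V) * cross (wall_dir U) (wall_dir W)
      = fst (wall_dir W) * cross (wall_dir U) (wall_dir V) + fst (wall_dir U) * cross (wall_dir V) (wall_dir W)"
    by (simp add: cross_def algebra_simps)
  moreover have "fst (wall_dir W) * cross (wall_dir U) (wall_dir V) > 0" "fst (wall_dir U) * cross (wall_dir V) (wall_dir W) > 0"
    using c p by simp_all
  ultimately have "fst (wall_dir V) * cross (wall_dir U) (wall_dir W) > 0" by linarith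
  thus ?thesis using p n by (simp add: before_def zero_less_mult_iff)
qed

lemma bend_list_in_diagram: "bend_list b L \<Longrightarrow> x \<in> fst ` set L \<Longrightarrow> x \<in> scattering_diagram"
  by (induction b L rule: bend_list.induct) auto

lemma abs_pairing: "\<bar>cross (wall_dir W) v\<bar> = \<bar>pairing W (- v)\<bar>"
  by (cases W) (auto simp: pairing_def cross_def)

lemma shift_uminus: "shift (- shift v x) x = - v"
  by (simp add: shift_def prod_eq_iff)

lemma rcross_support:
  assumes "P \<in> wall_support W"
  shows "rcross P (real_vec (wall_dir W)) = 0"
  using assms by (auto simp: wall_support_def rcross_scaleR split: if_splits)

text \<open>Induction on the bends, last one first. Carried along are the region of the end point,
  the positive angular momentum and, on a wall, the leftward motion; \<open>bend_region\<close> then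
  places each bend after its predecessor in the list.\<close>

lemma broken_bend_list:
  assumes "broken m T \<gamma> ts vs cs Ws ks" "region st (\<gamma> T)" "rcross (\<gamma> T) (real_vec (last vs)) > 0"
    "st \<noteq> None \<Longrightarrow> fst (last vs) < 0"
  defines "L \<equiv> rev (zip Ws ks)"
  shows "bend_list (- last vs) L \<and> sorted_wrt before (map fst L) \<and> shift (- last vs) (offset L) = - m
    \<and> (L \<noteq> [] \<longrightarrow> fst (last vs) < 0) \<and> (\<forall>W0. st = Some W0 \<longrightarrow> (\<forall>W\<in>fst ` set L. before W0 W))"
  unfolding L_def using assms(1-4)
proof (induction arbitrary: st rule: broken_induct)
  case (Nil T v c)
  thus ?case by (simp add: broken_Nil)
next
  case (snoc T ts t vs v cs c Ws W ks k)
  let ?L = "rev (zip Ws ks)" and ?d = "real_vec (wall_dir W)"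
  have b: "W \<in> scattering_diagram" "\<gamma> t \<in> wall_support W" "k \<ge> 1"
     "bend_coeff W \<bar>cross (wall_dir W) (last vs)\<bar> k \<noteq> 0" and v: "v = shift (last vs) (mul k (wvec W))"
    using snoc(3) by (auto simp: bend_at_def)
  have Pt: "\<gamma> t = \<gamma> T + (T - t) *\<^sub>R real_vec v"
    by (rule straightD[OF snoc(4)]) (use snoc(1) in simp)
  have "fst v < 0 \<and> region (Some W) (\<gamma> t) \<and> pairing W (- v) > 0 \<and> (\<forall>W0. st = Some W0 \<longrightarrow> before W0 W)"
    by (rule bend_region[OF _ Pt b(1,2) broken_nonzero[OF snoc(2)]]) (use snoc(1) snoc.prems in simp_all)
  hence *: "fst v < 0" "region (Some W) (\<gamma> t)" "pairing W (- v) > 0" "\<And>W0. st = Some W0 \<Longrightarrow> before W0 W" by auto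
  have "rcross (\<gamma> t) (real_vec v) = rcross (\<gamma> T) (real_vec v)"
    by (subst Pt) (simp add: rcross_add rcross_scaleR)
  moreover have "rcross (\<gamma> t) (real_vec v) = rcross (\<gamma> t) (real_vec (last vs))"
    unfolding v real_vec_shift by (simp add: rcross_add rcross_scaleR rcross_support[OF b(2)])
  ultimately have lam: "rcross (\<gamma> t) (real_vec (last vs)) > 0" using snoc.prems by simp
  \<comment> \<open>A bend never decreases the first component, so it was negative already before
    this bend.\<close>
  have "0 \<le> int k * int (fst (wvec W))" by simp
  moreover have "fst v = fst (last vs) + 2 * (int k * int (fst (wvec W)))" by (simp add: v)
  ultimately have "fst (last vs) < 0" using *(1) by linarith
  with snoc.IH[OF *(2) lam] have IH: "bend_list (- last vs) ?L" "sorted_wrt before (map fst ?L)"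
    "shift (- last vs) (offset ?L) = - m" "\<And>x. x \<in> fst ` set ?L \<Longrightarrow> before W x" by blast+
  have L: "rev (zip (Ws @ [W]) (ks @ [k])) = (W, k) # ?L" using snoc(5) by simp
  have sh': "shift (- v) (mul k (wvec W)) = - last vs" unfolding v by (rule shift_uminus)
  have pos: "pairing W (- v) = \<bar>cross (wall_dir W) (last vs)\<bar>"
    using *(3) abs_pairing[of W v] unfolding v cross_wall_shift by simp
  have "bend_list (- v) ((W, k) # ?L)" using IH b *(3) by (simp add: sh' pos)
  moreover have "shift (- v) (offset ((W, k) # ?L)) = - m" using IH by (simp add: sh' flip: shift_shift)
  moreover have "before W0 x" if "st = Some W0" "x \<in> fst ` set ((W, k) # ?L)" for W0 x
  proof -
    have W0: "W0 \<in> scattering_diagram" using snoc.prems(1) that(1) by (simp add: region_def)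
    have "x = W \<or> x \<in> fst ` set ?L" using that by auto
    thus ?thesis
    proof
      assume x: "x \<in> fst ` set ?L"
      show ?thesis
        by (rule before_trans[OF *(4)[OF that(1)] IH(4)[OF x] b(1) bend_list_in_diagram[OF IH(1) x] W0])
    qed (use *(4) that in auto)
  qed
  ultimately show ?case unfolding L using IH *(1) by auto
qed

text \<open>On the final segment the path is known, and its cross product with the wall direction is
  affine in time with nonzero slope, as the exponent is not parallel to the wall. So the time of the
  last bend is determined, and induction continues from there.\<close>

lemma broken_unique:
  assumes "broken m T \<gamma> ts vs cs Ws ks" "broken m T \<gamma>' ts' vs' cs' Ws ks" "last vs' = last vs" "\<gamma>' T = \<gamma> T"
  shows "ts' = ts \<and> vs' = vs \<and> cs' = cs \<and> (\<forall>x\<le>T. \<gamma>' x = \<gamma> x)"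
  using assms
proof (induction arbitrary: ts' vs' cs' rule: broken_induct)
  case (Nil T v c)
  have len: "length vs' = Suc 0" "length cs' = Suc 0" "ts' = []" using broken_lengths[OF Nil(2)] by auto
  then obtain v' c' where e: "vs' = [v']" "cs' = [c']" by (metis length_0_conv length_Suc_conv)
  have 1: "v = m" "c = 1" "straight {..T} \<gamma> T v" and 2: "v' = m" "c' = 1" "straight {..T} \<gamma>' T v'"
    using Nil(1,2) unfolding e len(3) broken_Nil by blast+
  have "\<gamma>' x = \<gamma> x" if "x \<le> T" for x
    using straightD[OF 1(3), of x] straightD[OF 2(3), of x] that 1(1) 2(1) Nil(4) by simp
  thus ?case using e len 1(1,2) 2(1,2) by simp
next
  case (snoc T ts t vs v cs c Ws W ks k)
  from snoc.prems(1) obtain us u xs x ds d where e: "ts' = us @ [u]" "vs' = xs @ [x]" "cs' = ds @ [d]"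
    and B: "u < T" "broken m u \<gamma>' us xs ds Ws ks" "bend_at (\<gamma>' u) W k (last xs) (last ds) x d" "straight {u..T} \<gamma>' T x"
    by (rule broken_snocE)
  have x: "x = v" using snoc.prems(2) by (simp add: e)
  have P: "\<gamma> t = \<gamma> T + (T - t) *\<^sub>R real_vec v" "\<gamma>' u = \<gamma> T + (T - u) *\<^sub>R real_vec v"
    using straightD[OF snoc(4), of t] straightD[OF B(4), of u] snoc(1) B(1) snoc.prems(3) x by simp_all
  have last: "last xs = last vs"
    using snoc(3) B(3) by (auto simp: bend_at_def x shift_def prod_eq_iff)
  have cross: "cross v (wall_dir W) \<noteq> 0"
  proof -
    have "cross (wall_dir W) v \<noteq> 0" using snoc(3) by (auto simp: bend_at_def)
    thus ?thesis by (simp add: cross_def algebra_simps)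
  qed
  have "(T - t) * of_int (cross v (wall_dir W)) = (T - u) * of_int (cross v (wall_dir W))"
  proof -
    have "\<gamma> t \<in> wall_support W" "\<gamma>' u \<in> wall_support W" using snoc(3) B(3) unfolding bend_at_def by blast+
    hence "rcross (\<gamma> T + (T - t) *\<^sub>R real_vec v) (real_vec (wall_dir W)) = 0"
      "rcross (\<gamma> T + (T - u) *\<^sub>R real_vec v) (real_vec (wall_dir W)) = 0"
      using rcross_support P by metis+
    thus ?thesis unfolding rcross_add rcross_scaleR rcross_real_vec by linarith
  qed
  hence tu: "u = t" using cross by simp
  have "\<gamma>' t = \<gamma> t" using P tu by simp
  with snoc.IH[of us xs ds] B(2) last tu have IH: "us = ts" "xs = vs" "ds = cs" "\<And>y. y \<le> t \<Longrightarrow> \<gamma>' y = \<gamma> y" by auto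
  moreover have "\<gamma>' y = \<gamma> y" if "y \<le> T" for y
  proof (cases "y \<le> t")
    case False
    hence "y \<in> {t..T}" using that by simp
    from straightD[OF snoc(4) this] straightD[OF B(4)[unfolded tu] this] show ?thesis
      using snoc.prems(3) x by simp
  qed (rule IH(4))
  moreover have "d = c" using snoc(3) B(3) IH by (simp add: bend_at_def)
  ultimately show ?case using e tu x by simp
qed

lemma cross_uminus [simp]: "cross (- u) v = - cross u v" "cross u (- v) = - cross u v"
  by (simp_all add: cross_def)

text \<open>The last assumption says that the first wall of the list lies ahead of \<open>P\<close>.
  After the first bend the order \<open>before\<close> supplies this assumption for the next
  wall.\<close>

lemma exists_broken:
  assumes "bend_list b L" "sorted_wrt before (map fst L)" "rcross P (real_vec (- b)) > 0"
    "L \<noteq> [] \<Longrightarrow> if fst (hd L) = Axis2 then fst P > 0 else rcross P (real_vec (wall_dir (fst (hd L)))) < 0"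
  shows "\<exists>\<gamma> ts vs cs Ws ks. broken (- shift b (offset L)) T \<gamma> ts vs cs Ws ks \<and> last vs = - b \<and> \<gamma> T = P \<and> rev (zip Ws ks) = L"
  using assms
proof (induction L arbitrary: b P T)
  case Nil
  let ?\<gamma> = "\<lambda>x. P + (T - x) *\<^sub>R real_vec (- b)"
  have "rcross (?\<gamma> x) (real_vec (- b)) > 0" for x
    using Nil(3) by (simp add: rcross_add rcross_scaleR)
  hence "?\<gamma> x \<noteq> 0" for x
    by (metis fst_zero mult_zero_left order_less_irrefl rcross_def snd_zero diff_self)
  hence "broken (- b) T ?\<gamma> [] [- b] [1] [] []"
    by (simp add: broken_Nil straight_def)
  thus ?case by (intro exI[of _ ?\<gamma>] exI[of _ "[]"] exI[of _ "[- b]"] exI[of _ "[1]"]) simp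
next
  case (Cons x L)
  obtain W k where x: "x = (W, k)" by (cases x)
  define v where "v = - b"
  define d where "d = real_vec (wall_dir W)"
  define q where "q = rcross (real_vec v) d"
  \<comment> \<open>The solution of \<open>rcross (P + \<Delta> *\<^sub>R real_vec v) d = 0\<close>:
    the time in which the backward ray reaches the line of the wall.\<close>
  define \<Delta> where "\<Delta> = - rcross P d / q"
  define P' where "P' = P + \<Delta> *\<^sub>R real_vec v"
  define t where "t = T - \<Delta>"
  define b' where "b' = shift b (mul k (wvec W))"
  have W: "W \<in> scattering_diagram" "k \<ge> 1" "pairing W b > 0" "bend_coeff W (pairing W b) k \<noteq> 0" and okL: "bend_list b' L"
    using Cons.prems(1) by (simp_all add: x b'_def)
  have srt: "sorted_wrt before (map fst L)" "\<And>V. V \<in> fst ` set L \<Longrightarrow> before W V"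
    using Cons.prems(2) by (auto simp: x)
  have lam: "rcross P (real_vec v) > 0" using Cons.prems(3) by (simp add: v_def)
  have hd: "if W = Axis2 then fst P > 0 else rcross P d < 0" using Cons.prems(4)[unfolded x] by (auto simp: d_def split: if_splits)
  have q: "if W = Axis2 then q < 0 else q > 0"
  proof (cases "W = Axis2")
    case True
    thus ?thesis using W(3) by (simp add: q_def d_def rcross_def pairing_def v_def)
  next
    case False
    have "q = of_int (cross v (wall_dir W))" by (simp add: q_def d_def rcross_real_vec)
    also have "cross v (wall_dir W) = pairing W b" using False by (simp add: v_def pairing_def cross_def)
    finally show ?thesis using False W(3) by simp
  qed
  have q0: "q \<noteq> 0" using q by (auto split: if_splits)
  have dl: "\<Delta> > 0"
  proof (cases "W = Axis2")
    case True
    hence "rcross P d > 0" using hd by (simp add: d_def rcross_def)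
    thus ?thesis using True q by (simp add: \<Delta>_def divide_pos_neg)
  next
    case False
    hence "- rcross P d > 0" "q > 0" using hd q by simp_all
    thus ?thesis unfolding \<Delta>_def by (rule divide_pos_pos)
  qed
  have P'd: "rcross P' d = 0"
    unfolding P'_def rcross_add rcross_scaleR q_def[symmetric] \<Delta>_def using q0 by simp
  have lam': "rcross P' (real_vec v) > 0"
    using lam by (simp add: P'_def rcross_add rcross_scaleR)
  obtain c where c: "P' = c *\<^sub>R d"
  proof (cases "W = Axis2")
    case True
    hence "P' = snd P' *\<^sub>R d" using P'd by (simp add: prod_eq_iff d_def rcross_def)
    thus ?thesis by (rule that)
  next
    case False
    have d1: "fst d > 0" using wall_dir_pos[OF W(1) False] by (simp add: d_def)
    hence "P' = (fst P' / fst d) *\<^sub>R d" using P'd by (simp add: prod_eq_iff rcross_def field_simps)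
    thus ?thesis by (rule that)
  qed
  have "rcross P' (real_vec v) = - (c * q)"
    unfolding c q_def by (simp add: rcross_def algebra_simps)
  hence cq: "c * q < 0" using lam' by simp
  \<comment> \<open>Positive angular momentum decides which half of the line is hit: the positive
    ray for \<open>Axis2\<close>, the negative ray, which is where the wall lies, otherwise.\<close>
  have csgn: "if W = Axis2 then c > 0 else c < 0"
    using cq q by (auto simp: mult_less_0_iff split: if_splits)
  have sup: "P' \<in> wall_support W"
    using csgn c unfolding wall_support_def d_def by (cases "W = Axis2") auto
  have v': "v = shift (- b') (mul k (wvec W))" unfolding v_def b'_def by (rule shift_uminus[symmetric])
  have lamb: "rcross P' (real_vec (- b')) > 0"
    using lam' P'd unfolding v' real_vec_shift by (simp add: rcross_add rcross_scaleR flip: d_def)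
  have hd': "if fst (hd L) = Axis2 then fst P' > 0 else rcross P' (real_vec (wall_dir (fst (hd L)))) < 0" if "L \<noteq> []"
  proof -
    let ?V = "fst (hd L)"
    have V: "?V \<in> fst ` set L" using that by simp
    have V1: "?V \<in> scattering_diagram" by (rule bend_list_in_diagram[OF okL V])
    have V2: "before W ?V" by (rule srt(2)[OF V])
    hence V3: "?V \<noteq> Axis2" by (simp add: before_def)
    have e: "rcross P' (real_vec (wall_dir ?V)) = c * of_int (cross (wall_dir W) (wall_dir ?V))"
      unfolding c d_def by (simp add: rcross_scaleR rcross_real_vec)
    have "c * of_int (cross (wall_dir W) (wall_dir ?V)) < 0"
    proof (cases "W = Axis2")
      case True
      have "cross (wall_dir W) (wall_dir ?V) < 0" using wall_dir_pos[OF V1 V3] by (simp add: True cross_def)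
      thus ?thesis using csgn True by (simp add: mult_pos_neg)
    next
      case False
      have "cross (wall_dir W) (wall_dir ?V) > 0" using V2 False by (simp add: before_def)
      thus ?thesis using csgn False by (simp add: mult_neg_pos)
    qed
    thus ?thesis using V3 e by simp
  qed
  obtain \<gamma>0 ts vs cs Ws ks where B: "broken (- shift b' (offset L)) t \<gamma>0 ts vs cs Ws ks" "last vs = - b'" "\<gamma>0 t = P'" "rev (zip Ws ks) = L"
    using Cons.IH[OF okL srt(1) lamb hd', of t] by blast
  define \<gamma> where "\<gamma> = (\<lambda>x. if x \<le> t then \<gamma>0 x else P + (T - x) *\<^sub>R real_vec v)"
  have tT: "t < T" using dl by (simp add: t_def)
  have gT: "\<gamma> T = P" using tT by (simp add: \<gamma>_def)
  have B': "broken (- shift b' (offset L)) t \<gamma> ts vs cs Ws ks"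
    by (rule broken_cong[OF B(1)]) (simp add: \<gamma>_def)
  have gt: "\<gamma> t = P'" using B(3) by (simp add: \<gamma>_def)
  have seg: "\<gamma> x = P + (T - x) *\<^sub>R real_vec v" if "x \<in> {t..T}" for x
  proof (cases "x = t")
    case True
    thus ?thesis using gt by (simp add: P'_def t_def)
  qed (use that in \<open>simp add: \<gamma>_def\<close>)
  have st: "straight {t..T} \<gamma> T v"
    unfolding straight_def gT using seg by blast
  have nz: "\<gamma> x \<noteq> 0" if "x \<in> {t..T}" for x
  proof
    assume "\<gamma> x = 0"
    hence "rcross (P + (T - x) *\<^sub>R real_vec v) (real_vec v) = 0" using seg[OF that] by (simp add: rcross_def)
    thus False using lam by (simp add: rcross_add rcross_scaleR)
  qed
  have abs: "\<bar>cross (wall_dir W) (last vs)\<bar> = pairing W b"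
  proof -
    have "cross (wall_dir W) (last vs) = cross (wall_dir W) v" unfolding B(2) v' by simp
    thus ?thesis using abs_pairing[of W v] W(3) by (simp add: v_def)
  qed
  have bend: "bend_at (\<gamma> t) W k (last vs) (last cs) v (last cs * bend_coeff W (pairing W b) k)"
    unfolding bend_at_def abs gt using W sup abs v' B(2) by auto
  have len: "length vs = Suc (length ts)" "length cs = Suc (length ts)" "length Ws = length ts" "length ks = length ts"
    using broken_lengths[OF B'] by simp_all
  have "broken (- shift b' (offset L)) T \<gamma> (ts @ [t]) (vs @ [v]) (cs @ [last cs * bend_coeff W (pairing W b) k]) (Ws @ [W]) (ks @ [k])"
    unfolding broken_snoc[OF len] using tT B' bend st nz by blast
  moreover have "shift b' (offset L) = shift b (offset (x # L))" by (simp add: b'_def x shift_shift)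
  moreover have "rev (zip (Ws @ [W]) (ks @ [k])) = x # L" using len B(4) by (simp add: x)
  moreover have "last (vs @ [v]) = - b" by (simp add: v_def)
  ultimately show ?case using gT by metis
qed

definition qweight where
  "qweight vs Ws ks = (\<Prod>i<length Ws. bend_weight (Ws ! i) (nat \<bar>cross (wall_dir (Ws ! i)) (vs ! i)\<bar>) (ks ! i))"

lemma quantum_weight_qweight:
  "length (bl_walls B) = length (bl_times B) \<Longrightarrow> quantum_weight B = qweight (bl_exps B) (bl_walls B) (bl_mults B)"
  by (simp add: quantum_weight_def qweight_def bend_pairing_def dot_wall_normal)

lemma broken_qweight:
  assumes "broken m T \<gamma> ts vs cs Ws ks" "bend_list (- last vs) (rev (zip Ws ks))"
  shows "qweight vs Ws ks = weight (- last vs) (rev (zip Ws ks))"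
  using assms
proof (induction rule: broken_induct)
  case (snoc T ts t vs v cs c Ws W ks k)
  have len: "length vs = Suc (length Ws)" "length ks = length Ws"
    using broken_lengths[OF snoc(2)] by auto
  have v: "v = shift (last vs) (mul k (wvec W))" using snoc(3) by (simp add: bend_at_def)
  have sh': "shift (- v) (mul k (wvec W)) = - last vs" unfolding v by (rule shift_uminus)
  have L: "rev (zip (Ws @ [W]) (ks @ [k])) = (W, k) # rev (zip Ws ks)" using len by simp
  have bend_list: "pairing W (- v) > 0" "bend_list (- last vs) (rev (zip Ws ks))"
    using snoc.prems unfolding L by (simp_all add: sh')
  have pos: "pairing W (- v) = \<bar>cross (wall_dir W) (last vs)\<bar>"
    using bend_list(1) abs_pairing[of W v] unfolding v cross_wall_shift by simp
  have nth: "(vs @ [v]) ! length Ws = last vs"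
    using len by (cases vs rule: rev_cases) (auto simp: nth_append)
  have "qweight (vs @ [v]) (Ws @ [W]) (ks @ [k]) = qweight vs Ws ks * bend_weight W (nat \<bar>cross (wall_dir W) (last vs)\<bar>) k"
  proof -
    have "(\<Prod>i<length Ws. bend_weight ((Ws @ [W]) ! i) (nat \<bar>cross (wall_dir ((Ws @ [W]) ! i)) ((vs @ [v]) ! i)\<bar>) ((ks @ [k]) ! i)) = qweight vs Ws ks"
      unfolding qweight_def by (rule prod.cong) (use len in \<open>auto simp: nth_append\<close>)
    moreover have "(ks @ [k]) ! length Ws = k" "(Ws @ [W]) ! length Ws = W" using len by (simp_all add: nth_append)
    ultimately show ?thesis unfolding qweight_def by (simp add: nth)
  qed
  thus ?case unfolding L using snoc.IH[OF bend_list(2)] by (simp add: sh' pos mult.commute)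
qed (simp add: qweight_def)

section \<open>Broken lines with a given terminal exponent\<close>

definition lines :: "int \<times> int \<Rightarrow> real \<times> real \<Rightarrow> nat \<times> nat \<Rightarrow> broken_line set" where
  "lines m Q s = {B. is_broken_line m Q B \<and> last (bl_exps B) = shift m s}"

definition bends :: "broken_line \<Rightarrow> (wall \<times> nat) list" where
  "bends B = rev (zip (bl_walls B) (bl_mults B))"

text \<open>With positive angular momentum a line that bends moves left when followed backwards from
  \<open>Q\<close>; the unbent line is exempt from this condition. Injectivity is
  \<open>broken_unique\<close>, surjectivity \<open>exists_broken\<close>.\<close>

lemma bij_bends:
  fixes Q m s
  defines "v \<equiv> shift m s"
  assumes m: "m \<noteq> 0" and Q: "fst Q > 0" "snd Q > 0" and lam: "rcross Q (real_vec v) > 0"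
  shows "bij_betw bends (lines m Q s) {L \<in> paths UNIV (- v) s. L \<noteq> [] \<longrightarrow> fst v < 0}"
    and "\<And>B. B \<in> lines m Q s \<Longrightarrow> quantum_weight B = weight (- v) (bends B)"
proof -
  have br: "broken m 0 (bl_path B) (bl_times B) (bl_exps B) (bl_coeffs B) (bl_walls B) (bl_mults B)"
    "last (bl_exps B) = v" "bl_path B 0 = Q" "bl_path B \<in> extensional {..0}" if "B \<in> lines m Q s" for B
    using that by (auto simp: lines_def is_broken_line_broken v_def)
  have bend_list: "bend_list (- v) (bends B) \<and> sorted_wrt before (map fst (bends B)) \<and> shift (- v) (offset (bends B)) = - m
      \<and> (bends B \<noteq> [] \<longrightarrow> fst v < 0)" if "B \<in> lines m Q s" for B
  proof -
    note b = br[OF that]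
    show ?thesis
      using broken_bend_list[OF b(1), of None] Q lam unfolding b(2,3) by (simp add: region_def bends_def)
  qed
  show "quantum_weight B = weight (- v) (bends B)" if "B \<in> lines m Q s" for B
  proof -
    note b = br[OF that]
    have "quantum_weight B = qweight (bl_exps B) (bl_walls B) (bl_mults B)"
      using broken_lengths[OF b(1)] by (intro quantum_weight_qweight) simp
    also have "\<dots> = weight (- v) (bends B)"
      using broken_qweight[OF b(1)] bend_list[OF that] unfolding b(2) bends_def by simp
    finally show ?thesis .
  qed
  show "bij_betw bends (lines m Q s) {L \<in> paths UNIV (- v) s. L \<noteq> [] \<longrightarrow> fst v < 0}"
    unfolding bij_betw_def
  proof (intro conjI inj_onI equalityI subsetI)
    fix B B' assume B: "B \<in> lines m Q s" and B': "B' \<in> lines m Q s" and eq: "bends B = bends B'"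
    note b = br[OF B] and b' = br[OF B']
    have z: "zip (bl_walls B) (bl_mults B) = zip (bl_walls B') (bl_mults B')"
      using eq by (simp add: bends_def)
    have l: "length (bl_walls B) = length (bl_mults B)" "length (bl_walls B') = length (bl_mults B')"
      using broken_lengths[OF b(1)] broken_lengths[OF b'(1)] by simp_all
    have W: "bl_walls B' = bl_walls B" "bl_mults B' = bl_mults B"
      using arg_cong[OF z, of "map fst"] arg_cong[OF z, of "map snd"] l by simp_all
    have u: "bl_times B' = bl_times B \<and> bl_exps B' = bl_exps B \<and> bl_coeffs B' = bl_coeffs B \<and> (\<forall>x\<le>0. bl_path B' x = bl_path B x)"
      by (rule broken_unique[OF b(1) b'(1)[unfolded W]]) (simp_all add: b b')
    hence "bl_path B = bl_path B'"
      by (intro extensionalityI[OF b(4) b'(4)]) auto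
    thus "B = B'" using u W by (intro broken_line.equality) simp_all
  next
    fix L assume "L \<in> bends ` lines m Q s"
    then obtain B where B: "B \<in> lines m Q s" and L: "L = bends B" by blast
    have "offset L = s"
      using bend_list[OF B] unfolding v_def L shift_def by (simp add: prod_eq_iff)
    thus "L \<in> {L \<in> paths UNIV (- v) s. L \<noteq> [] \<longrightarrow> fst v < 0}"
      using bend_list[OF B] by (simp add: paths_def L)
  next
    fix L assume "L \<in> {L \<in> paths UNIV (- v) s. L \<noteq> [] \<longrightarrow> fst v < 0}"
    hence L: "bend_list (- v) L" "sorted_wrt before (map fst L)" "offset L = s" "L \<noteq> [] \<Longrightarrow> fst v < 0"
      by (auto simp: paths_def)
    \<comment> \<open>That the first wall lies ahead of \<open>Q\<close> follows from the positive
      pairing, the positive angular momentum and \<open>fst v < 0\<close> by the three-term relation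
      between cross products.\<close>
    have hd: "if fst (hd L) = Axis2 then fst Q > 0 else rcross Q (real_vec (wall_dir (fst (hd L)))) < 0" if ne: "L \<noteq> []"
    proof (cases "fst (hd L) = Axis2")
      case False
      obtain W k L' where e: "L = (W, k) # L'" using ne by (metis list.exhaust prod.exhaust)
      have W: "W \<noteq> Axis2" "W \<in> scattering_diagram" "pairing W (- v) > 0" using False L(1) by (simp_all add: e)
      define d1 d2 v1 v2 where "d1 = real_of_int (fst (wall_dir W))" and "d2 = real_of_int (snd (wall_dir W))"
        and "v1 = real_of_int (fst v)" and "v2 = real_of_int (snd v)"
      have d1: "d1 > 0" using wall_dir_pos[OF W(2,1)] by (simp add: d1_def)
      have v1: "v1 < 0" using L(4)[OF ne] by (simp add: v1_def)
      have "d1 * v2 - d2 * v1 < 0"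
        using W by (simp add: pairing_def cross_def d1_def d2_def v1_def v2_def flip: of_int_mult)
      hence "fst Q * (d1 * v2 - d2 * v1) < 0" using Q by (simp add: mult_pos_neg)
      moreover have "d1 * (fst Q * v2 - snd Q * v1) > 0"
        using lam d1 by (simp add: rcross_def v1_def v2_def)
      moreover have "v1 * (fst Q * d2 - snd Q * d1) = d1 * (fst Q * v2 - snd Q * v1) - fst Q * (d1 * v2 - d2 * v1)"
        by (simp add: algebra_simps)
      ultimately have "v1 * (fst Q * d2 - snd Q * d1) > 0" by linarith
      hence "fst Q * d2 - snd Q * d1 < 0" using v1 by (simp add: zero_less_mult_iff)
      thus ?thesis using False by (simp add: e rcross_def d1_def d2_def)
    qed (use Q in simp)
    have m': "- shift (- v) (offset L) = m" unfolding L(3) v_def shift_uminus by simp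
    obtain \<gamma> ts vs cs Ws ks where B: "broken m 0 \<gamma> ts vs cs Ws ks" "last vs = v" "\<gamma> 0 = Q" "rev (zip Ws ks) = L"
      using exists_broken[OF L(1,2) _ hd, of 0] lam unfolding m' by auto
    define B where "B = \<lparr>bl_path = restrict \<gamma> {..0}, bl_times = ts, bl_exps = vs, bl_coeffs = cs, bl_walls = Ws, bl_mults = ks\<rparr>"
    have "broken m 0 (restrict \<gamma> {..0}) ts vs cs Ws ks"
      by (rule broken_cong[OF B(1)]) simp
    hence "B \<in> lines m Q s"
      using m B by (simp add: lines_def is_broken_line_broken B_def v_def)
    moreover have "bends B = L" using B by (simp add: bends_def B_def)
    ultimately show "L \<in> bends ` lines m Q s" by blast
  qed
qed

lemma lines_sum:
  assumes m: "m \<noteq> 0" and Q: "fst Q > 0" "snd Q > 0" and lam: "rcross Q (real_vec (shift m s)) > 0"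
  shows "finite (lines m Q s)" "(\<Sum>B\<in>lines m Q s. quantum_weight B) = pcoeff (- m) s"
    "lines m Q s \<noteq> {} \<Longrightarrow> s \<in> obox (- m)"
proof -
  define v where "v = shift m s"
  define A where "A = {L \<in> paths UNIV (- v) s. L \<noteq> [] \<longrightarrow> fst v < 0}"
  have bij: "bij_betw bends (lines m Q s) A" and w: "\<And>B. B \<in> lines m Q s \<Longrightarrow> quantum_weight B = weight (- v) (bends B)"
    using bij_bends[OF m Q lam] unfolding A_def v_def by blast+
  have start_exp: "start_exp (- m) s = - v" by (simp add: v_def prod_eq_iff)
  have "finite A" unfolding A_def using finite_paths by simp
  thus "finite (lines m Q s)" using bij_betw_finite[OF bij] by simp
  have sum: "(\<Sum>B\<in>lines m Q s. quantum_weight B) = (\<Sum>L\<in>A. weight (- v) L)"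
    using sum.reindex_bij_betw[OF bij, of "weight (- v)"] w by simp
  have "(\<Sum>L\<in>A. weight (- v) L) = pcoeff (- m) s \<and> (A \<noteq> {} \<longrightarrow> s \<in> obox (- m))"
  proof (cases "fst v < 0")
    case True
    hence A: "A = paths UNIV (- v) s" by (auto simp: A_def)
    have "pcoeff (- m) s = path_sum (- v) s" using True by (simp add: pcoeff_def start_exp del: start_exp_sel)
    moreover have "s \<in> obox (- m)" if "A \<noteq> {}"
      using that True by (intro paths_in_obox) (simp_all add: start_exp A del: start_exp_sel)
    ultimately show ?thesis by (simp add: A path_sum_def)
  next
    case False
    \<comment> \<open>Only the unbent line can remain. Positive angular momentum gives
      \<open>snd v > 0\<close>, so no component of the start exponent is positive and
      \<open>pcoeff\<close> takes its last case.\<close>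
    hence A: "A = (if s = 0 then {[]} else {})" by (auto simp: A_def paths_def)
    have "fst Q * of_int (snd v) > snd Q * of_int (fst v)" using lam by (simp add: rcross_def v_def)
    moreover have "snd Q * of_int (fst v) \<ge> 0" using False Q by simp
    ultimately have "fst Q * of_int (snd v) > 0" by linarith
    hence "snd v > 0" using Q by (simp add: zero_less_mult_iff)
    hence "pcoeff (- m) s = (if s = 0 then 1 else 0)" using False by (simp add: pcoeff_def start_exp del: start_exp_sel)
    thus ?thesis by (simp add: A obox_def zero_prod_def)
  qed
  thus "(\<Sum>B\<in>lines m Q s. quantum_weight B) = pcoeff (- m) s" "lines m Q s \<noteq> {} \<Longrightarrow> s \<in> obox (- m)"
    using sum bij by (auto simp: bij_betw_def)
qed

section \<open>Reflection of broken lines in the diagonal\<close>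

fun swap_wall :: "wall \<Rightarrow> wall" where
  "swap_wall Axis1 = Axis2"
| "swap_wall Axis2 = Axis1"
| "swap_wall (Cluster1 k) = Cluster2 k"
| "swap_wall (Cluster2 k) = Cluster1 k"
| "swap_wall Diagonal = Diagonal"

lemma swap_wall_swap_wall [simp]: "swap_wall (swap_wall W) = W"
  by (cases W) simp_all

lemma swap_wall_dir: "wall_dir (swap_wall W) = prod.swap (wall_dir W)"
  by (cases W) simp_all

lemma swap_wall_wvec: "wvec (swap_wall W) = prod.swap (wvec W)"
  by (cases W) (simp_all add: lvec_def uvec_def)

lemma swap_wall_Diagonal [simp]: "swap_wall W = Diagonal \<longleftrightarrow> W = Diagonal"
  by (cases W) simp_all

lemma swap_wall_in_diagram: "swap_wall W \<in> scattering_diagram \<longleftrightarrow> W \<in> scattering_diagram"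
  by (cases W) (auto simp: scattering_diagram_def)

lemma cross_swap: "cross (prod.swap u) (prod.swap v) = - cross u v"
  by (simp add: cross_def)

lemma swap_wall_support:
  assumes "P \<in> wall_support W"
  shows "prod.swap P \<in> wall_support (swap_wall W)"
proof -
  have "swap_wall W = Axis1 \<or> swap_wall W = Axis2 \<longleftrightarrow> W = Axis1 \<or> W = Axis2" by (cases W) simp_all
  moreover have "prod.swap (c *\<^sub>R real_vec (wall_dir W)) = c *\<^sub>R real_vec (wall_dir (swap_wall W))" for c
    by (simp add: swap_wall_dir prod_eq_iff)
  ultimately show ?thesis using assms unfolding wall_support_def by (auto split: if_splits)
qed

lemma shift_swap_wall: "prod.swap (shift v (mul k (wvec W))) = shift (prod.swap v) (mul k (wvec (swap_wall W)))"
  by (simp add: shift_def swap_wall_wvec)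

lemma bend_at_swap:
  assumes "bend_at P W k v c v' c'"
  shows "bend_at (prod.swap P) (swap_wall W) k (prod.swap v) c (prod.swap v') c'"
proof -
  have "wall_series (swap_wall W) = wall_series W" by (simp add: wall_series_def)
  thus ?thesis
    using assms unfolding bend_at_def
    by (simp add: swap_wall_dir cross_swap swap_wall_support swap_wall_in_diagram shift_swap_wall)
qed

lemma broken_swap:
  assumes "broken m T \<gamma> ts vs cs Ws ks"
  shows "broken (prod.swap m) T (\<lambda>x. prod.swap (\<gamma> x)) ts (map prod.swap vs) cs (map swap_wall Ws) ks"
proof -
  have bl: "bounded_linear (prod.swap :: real \<times> real \<Rightarrow> real \<times> real)"
  proof -
    have "prod.swap = (\<lambda>x :: real \<times> real. (snd x, fst x))" by (simp add: fun_eq_iff)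
    moreover have "bounded_linear (\<lambda>x :: real \<times> real. (snd x, fst x))"
      by (rule bounded_linear_Pair[OF bounded_linear_snd bounded_linear_fst])
    ultimately show ?thesis by simp
  qed
  have neg: "prod.swap (- real_vec v) = - real_vec (prod.swap v)" for v
    by (simp add: prod_eq_iff)
  note b = assms[unfolded broken_def]
  show ?thesis
  proof (unfold broken_def, intro conjI allI impI)
    show "continuous_on {..T} (\<lambda>x. prod.swap (\<gamma> x))"
      using b by (intro bounded_linear.continuous_on[OF bl]) blast
    show "prod.swap (\<gamma> x) \<noteq> 0" if "x \<le> T" for x
      using broken_nonzero[OF assms that] by (auto simp: prod_eq_iff)
    show "((\<lambda>x. prod.swap (\<gamma> x)) has_vector_derivative - real_vec (map prod.swap vs ! i)) (at x)"
      if i: "i \<le> length ts" "x < T" "i > 0 \<longrightarrow> ts ! (i - 1) < x" "i < length ts \<longrightarrow> x < ts ! i" for i x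
    proof -
      have "(\<gamma> has_vector_derivative - real_vec (vs ! i)) (at x)" using b i by blast
      hence "((\<lambda>x. prod.swap (\<gamma> x)) has_vector_derivative prod.swap (- real_vec (vs ! i))) (at x)"
        by (rule bounded_linear.has_vector_derivative[OF bl])
      thus ?thesis using i b by (simp add: neg)
    qed
    show "bend_at (prod.swap (\<gamma> (ts ! i))) (map swap_wall Ws ! i) (ks ! i) (map prod.swap vs ! i) (cs ! i)
       (map prod.swap vs ! Suc i) (cs ! Suc i)" if "i < length ts" for i
    proof -
      have "bend_at (\<gamma> (ts ! i)) (Ws ! i) (ks ! i) (vs ! i) (cs ! i) (vs ! Suc i) (cs ! Suc i)" using b that by blast
      from bend_at_swap[OF this] show ?thesis using b that by simp
    qed
    show "map prod.swap vs ! 0 = prod.swap m" using b by simp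
  qed (use b in auto)
qed

text \<open>\<open>restrict\<close> restores the conventional value at positive times, which the
  exchange of coordinates need not preserve.\<close>

definition swap_line :: "broken_line \<Rightarrow> broken_line" where
  "swap_line B = \<lparr>bl_path = restrict (\<lambda>x. prod.swap (bl_path B x)) {..0}, bl_times = bl_times B,
     bl_exps = map prod.swap (bl_exps B), bl_coeffs = bl_coeffs B, bl_walls = map swap_wall (bl_walls B),
     bl_mults = bl_mults B\<rparr>"

lemma swap_line_lines:
  assumes "B \<in> lines m Q s"
  shows "swap_line B \<in> lines (prod.swap m) (prod.swap Q) (prod.swap s)" "swap_line (swap_line B) = B"
    "quantum_weight (swap_line B) = quantum_weight B"
proof -
  have B: "m \<noteq> 0" "bl_path B \<in> extensional {..0}" "bl_path B 0 = Q"
    "broken m 0 (bl_path B) (bl_times B) (bl_exps B) (bl_coeffs B) (bl_walls B) (bl_mults B)" "last (bl_exps B) = shift m s"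
    using assms by (auto simp: lines_def is_broken_line_broken)
  have len: "length (bl_exps B) = Suc (length (bl_times B))" "length (bl_walls B) = length (bl_times B)"
    using broken_lengths[OF B(4)] by simp_all
  have m: "prod.swap m \<noteq> 0" using B(1) by (auto simp: prod_eq_iff)
  have "broken (prod.swap m) 0 (restrict (\<lambda>x. prod.swap (bl_path B x)) {..0}) (bl_times B) (map prod.swap (bl_exps B))
     (bl_coeffs B) (map swap_wall (bl_walls B)) (bl_mults B)"
    by (rule broken_cong[OF broken_swap[OF B(4)]]) simp
  moreover have "last (map prod.swap (bl_exps B)) = shift (prod.swap m) (prod.swap s)"
  proof -
    have "bl_exps B \<noteq> []" using len by auto
    thus ?thesis by (simp add: last_map B(5) shift_swap)
  qed
  ultimately show "swap_line B \<in> lines (prod.swap m) (prod.swap Q) (prod.swap s)"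
    using B m by (simp add: lines_def is_broken_line_broken swap_line_def)
  have "restrict (bl_path B) {..0} = bl_path B" by (rule extensional_restrict[OF B(2)])
  moreover have "restrict (\<lambda>x. prod.swap (restrict (\<lambda>x. prod.swap (bl_path B x)) {..0} x)) {..0} = restrict (bl_path B) {..0}"
    by (auto simp: restrict_def)
  ultimately show "swap_line (swap_line B) = B"
    by (intro broken_line.equality) (simp_all add: swap_line_def comp_def)
  have bw: "bend_weight (swap_wall W) p k = bend_weight W p k" for W p k
    by (simp add: bend_weight_def)
  have "qweight (map prod.swap (bl_exps B)) (map swap_wall (bl_walls B)) (bl_mults B) = qweight (bl_exps B) (bl_walls B) (bl_mults B)"
    unfolding qweight_def using len by (auto simp: bw swap_wall_dir cross_swap intro!: prod.cong)
  thus "quantum_weight (swap_line B) = quantum_weight B"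
    using len by (simp add: quantum_weight_qweight swap_line_def)
qed

lemma bij_swap_line: "bij_betw swap_line (lines m Q s) (lines (prod.swap m) (prod.swap Q) (prod.swap s))"
proof (rule bij_betw_byWitness[where f' = swap_line])
  show "swap_line ` lines (prod.swap m) (prod.swap Q) (prod.swap s) \<subseteq> lines m Q s"
    using swap_line_lines(1)[of _ "prod.swap m" "prod.swap Q" "prod.swap s"]
    by (intro image_subsetI) (simp only: swap_swap)
qed (intro ballI image_subsetI; erule swap_line_lines)+

text \<open>A line with negative angular momentum is reflected to one with positive angular
  momentum. That both signs lead to the same coefficient is \<open>pcoeff_swap\<close>; this is
  where consistency enters the comparison.\<close>

lemma lines_sum_generic:
  assumes m: "m \<noteq> 0" and Q: "fst Q > 0" "snd Q > 0" and lam: "rcross Q (real_vec (shift m s)) \<noteq> 0"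
  shows "finite (lines m Q s) \<and> (\<Sum>B\<in>lines m Q s. quantum_weight B) = pcoeff (- m) s
    \<and> (lines m Q s \<noteq> {} \<longrightarrow> s \<in> obox (- m))"
proof (cases "rcross Q (real_vec (shift m s)) > 0")
  case True
  thus ?thesis using lines_sum[OF m Q] by blast
next
  case False
  have "rcross (prod.swap Q) (real_vec (shift (prod.swap m) (prod.swap s))) > 0"
    using False lam by (simp add: shift_swap rcross_def algebra_simps)
  moreover have "prod.swap m \<noteq> 0" using m by (auto simp: prod_eq_iff)
  ultimately have *: "finite (lines (prod.swap m) (prod.swap Q) (prod.swap s))"
    "(\<Sum>B\<in>lines (prod.swap m) (prod.swap Q) (prod.swap s). quantum_weight B) = pcoeff (- prod.swap m) (prod.swap s)"
    "lines (prod.swap m) (prod.swap Q) (prod.swap s) \<noteq> {} \<Longrightarrow> prod.swap s \<in> obox (- prod.swap m)"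
    using lines_sum[of "prod.swap m" "prod.swap Q" "prod.swap s"] Q by simp_all
  have neg: "- prod.swap m = prod.swap (- m)" by (simp add: prod_eq_iff)
  note bij = bij_swap_line[of m Q s]
  have "finite (lines m Q s)" using bij_betw_finite[OF bij] *(1) by simp
  moreover have "(\<Sum>B\<in>lines m Q s. quantum_weight B) = pcoeff (- m) s"
    using sum.reindex_bij_betw[OF bij, of quantum_weight] *(2) swap_line_lines(3)
    unfolding neg pcoeff_swap by simp
  moreover have "s \<in> obox (- m)" if "lines m Q s \<noteq> {}"
    using that *(3) bij unfolding neg obox_swap by (auto simp: bij_betw_def)
  ultimately show ?thesis by blast
qed

text \<open>The pairing with the wall of the last bend is nonzero and unchanged by the bend, so the
  exponent never becomes 0. Hence genericity applies to every terminal exponent.\<close>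

lemma broken_last:
  assumes "broken m T \<gamma> ts vs cs Ws ks" "m \<noteq> 0"
  shows "last vs \<noteq> 0 \<and> (\<exists>s. last vs = shift m s)"
  using assms
proof (induction rule: broken_induct)
  case (Nil T v c)
  hence "last [v] = shift m 0" "last [v] \<noteq> 0" by (simp_all add: broken_Nil)
  thus ?case by blast
next
  case (snoc T ts t vs v cs c Ws W ks k)
  have v: "v = shift (last vs) (mul k (wvec W))" and nz: "cross (wall_dir W) (last vs) \<noteq> 0"
    using snoc(3) by (auto simp: bend_at_def)
  have "cross (wall_dir W) v \<noteq> 0" using nz by (simp add: v)
  hence "v \<noteq> 0" by (auto simp: cross_def)
  moreover obtain s where "last vs = shift m s" using snoc.IH snoc.prems by blast
  hence "v = shift m (s + mul k (wvec W))" by (simp add: v shift_shift)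
  ultimately show ?case unfolding last_snoc by blast
qed

section \<open>Comparison of the two bases\<close>

lemma scalar_superset:
  assumes "finite K" "Poly_Mapping.keys p \<subseteq> K"
  shows "scalar p = (\<Sum>c\<in>K. Poly_Mapping.single (QMon c 0 0) (Poly_Mapping.lookup p c))"
  unfolding scalar_def using assms by (intro sum.mono_neutral_left) (auto simp: in_keys_iff)

lemma scalar_add: "scalar (p + r) = scalar p + scalar r"
proof -
  let ?K = "Poly_Mapping.keys p \<union> Poly_Mapping.keys r"
  have "scalar (p + r) = (\<Sum>c\<in>?K. Poly_Mapping.single (QMon c 0 0) (Poly_Mapping.lookup (p + r) c))"
    by (rule scalar_superset) (simp_all add: Poly_Mapping.keys_add)
  also have "\<dots> = scalar p + scalar r"
    by (simp add: scalar_superset[of ?K] lookup_add single_add sum.distrib)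
  finally show ?thesis .
qed

lemma scalar_sum: "scalar (sum f A) = (\<Sum>x\<in>A. scalar (f x))"
  by (induction A rule: infinite_finite_induct) (simp_all add: scalar_add)

lemma scalar_1: "scalar 1 = 1"
  using scalar_qpow[of 0] by (simp flip: zero_qmon_def)

lemma quantum_theta_pcoeff:
  assumes Q: "generic Q" "fst Q > 0" "snd Q > 0" and m: "m \<noteq> 0"
  shows "quantum_theta Q m = (\<Sum>s\<in>obox (- m). scalar (pcoeff (- m) s) * Xmon (shift m s))"
proof -
  \<comment> \<open>Genericity is applied to \<open>v\<close> turned by a right angle.\<close>
  have lam: "rcross Q (real_vec v) \<noteq> 0" if "v \<noteq> 0" for v
  proof -
    have "(snd v, - fst v) \<noteq> 0" using that by (auto simp: prod_eq_iff)
    hence "real_vec (snd v, - fst v) \<bullet> Q \<noteq> 0" using Q(1) by (auto simp: generic_def)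
    thus ?thesis by (simp add: real_vec_def rcross_def inner_prod_def algebra_simps)
  qed
  have nz: "shift m s \<noteq> 0" if "lines m Q s \<noteq> {}" for s
    using that broken_last by (fastforce simp: lines_def is_broken_line_broken)
  have ls: "finite (lines m Q s) \<and> (\<Sum>B\<in>lines m Q s. quantum_weight B) = pcoeff (- m) s
    \<and> (lines m Q s \<noteq> {} \<longrightarrow> s \<in> obox (- m))" if "shift m s \<noteq> 0" for s
    using lines_sum_generic[OF m Q(2,3) lam[OF that]] .
  have fin: "finite (lines m Q s)" for s
    using ls nz by (cases "lines m Q s = {}") auto
  have Un: "{B. is_broken_line m Q B} = (\<Union>s\<in>obox (- m). lines m Q s)"
  proof (intro equalityI subsetI)
    fix B assume "B \<in> {B. is_broken_line m Q B}"
    hence B: "is_broken_line m Q B" by simp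
    then obtain s where s: "last (bl_exps B) = shift m s"
      using broken_last m unfolding is_broken_line_broken by blast
    hence Bs: "B \<in> lines m Q s" using B by (simp add: lines_def)
    hence "s \<in> obox (- m)" using ls nz by blast
    thus "B \<in> (\<Union>s\<in>obox (- m). lines m Q s)" using Bs by blast
  qed (auto simp: lines_def)
  have disj: "lines m Q s \<inter> lines m Q s' = {}" if "s \<noteq> s'" for s s'
  proof -
    have "shift m s \<noteq> shift m s'" using that by (auto simp: shift_def prod_eq_iff)
    thus ?thesis by (auto simp: lines_def)
  qed
  have "quantum_theta Q m = (\<Sum>s\<in>obox (- m). \<Sum>B\<in>lines m Q s. scalar (quantum_weight B) * Xmon (last (bl_exps B)))"
    unfolding quantum_theta_def Un using m fin disj
    by (simp add: sum.UNION_disjoint)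
  also have "\<dots> = (\<Sum>s\<in>obox (- m). scalar (\<Sum>B\<in>lines m Q s. quantum_weight B) * Xmon (shift m s))"
    by (intro sum.cong refl) (simp add: scalar_sum sum_distrib_right lines_def)
  also have "\<dots> = (\<Sum>s\<in>obox (- m). scalar (pcoeff (- m) s) * Xmon (shift m s))"
  proof (intro sum.cong refl)
    fix s
    show "scalar (\<Sum>B\<in>lines m Q s. quantum_weight B) * Xmon (shift m s) = scalar (pcoeff (- m) s) * Xmon (shift m s)"
    proof (cases "shift m s = 0")
      case False
      thus ?thesis using ls by simp
    next
      case True
      \<comment> \<open>Genericity says nothing about the exponent 0. No broken line ends with it,
        and \<open>pcoeff\<close> is 0 there by the last case of its definition.\<close>
      hence start_exp: "start_exp (- m) s = 0" by (simp add: prod_eq_iff)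
      have "s \<noteq> 0" using True m by auto
      hence "pcoeff (- m) s = 0" by (simp add: pcoeff_def start_exp del: start_exp_sel)
      moreover have "lines m Q s = {}" using nz True by blast
      ultimately show ?thesis by simp
    qed
  qed
  finally show ?thesis .
qed

text \<open>The term \<open>s = t = 0\<close> of X[a1,a2] has exponent \<open>- a\<close>, the
  exponent of an unbent line with initial exponent \<open>- a\<close>; this fixes the matching of
  the two parametrizations.\<close>

lemma greedy_elt_eq_quantum_theta:
  assumes "generic Q" "fst Q > 0" "snd Q > 0"
  shows "greedy_elt (fst a) (snd a) = quantum_theta Q (- a)"
proof (cases "a = 0")
  case True
  have "obox a = {0}" by (auto simp: True obox_def zero_prod_def)
  hence "greedy_elt (fst a) (snd a) = Xmon 0"
    unfolding greedy_elt_pcoeff by (simp add: True pcoeff_0 scalar_1) (simp add: zero_prod_def)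
  also have "\<dots> = 1" by (simp add: Xmon_eq flip: zero_qmon_def)
  finally show ?thesis by (simp add: True quantum_theta_def)
next
  case False
  have "(- fst a, - snd a) = - a" by (simp add: prod_eq_iff)
  thus ?thesis
    using quantum_theta_pcoeff[OF assms, of "- a"] False by (simp add: greedy_elt_pcoeff)
qed

theorem mainTheorem5:
  fixes Q :: "real \<times> real"
  assumes "generic Q" and "fst Q > 0" and "snd Q > 0"
  shows "{greedy_elt a1 a2 | a1 a2. True} = {quantum_theta Q m | m. True}"
proof (intro equalityI subsetI)
  fix x assume "x \<in> {greedy_elt a1 a2 | a1 a2. True}"
  then obtain a1 a2 where "x = greedy_elt a1 a2" by blast
  hence "x = quantum_theta Q (- (a1, a2))"
    using greedy_elt_eq_quantum_theta[OF assms, of "(a1, a2)"] by simp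
  thus "x \<in> {quantum_theta Q m | m. True}" by blast
next
  fix x assume "x \<in> {quantum_theta Q m | m. True}"
  then obtain m where "x = quantum_theta Q m" by blast
  hence "x = greedy_elt (fst (- m)) (snd (- m))"
    using greedy_elt_eq_quantum_theta[OF assms, of "- m"] by (simp only: minus_minus)
  thus "x \<in> {greedy_elt a1 a2 | a1 a2. True}" by blast
qed

end
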